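(* Let $F_2=\langle a,b\rangle$ be the free group on $a,b$, let $P_4\subset F_2$ be the subgroup generated by the fourth powers of all primitive elements of $F_2$, and let $G=F_2/P_4$. Denote the images of $a,b$ in $G$ again by $a,b$ and set $$A = ba^{-1} b^{-1} a, \quad B = b^{-1} a b a^{-1}, \quad C = b^{-1} a^{-1} b a,$$ $$D = a^2 b (a^{-1} b^{-1})^2 a^{-1} b a, \quad E = b^{-1} (ab)^2 a^{-3} b^{-1} a.$$ Let $N$ be the subgroup of $G$ generated by $$a_1=E^{-2}, \quad a_2=A^4 D^2, \quad a_3=A E^{-2} A^{-4} B A^{-1} B^{-1}, \quad a_4=A^9 C A^{-1} C^{-1} B A B^{-1} A^{-1}.$$ Then $N$ is a $5$-dimensional torsion-free nilpotent subgroup of index $2^{12}$ in $F_2/P_4$, and $N$ is isomorphic to $H(\mathbb{Z})\times H(\mathbb{Z})$ with one non-trivial added relator, i.e. to the quotient of $H(\mathbb{Z})\times H(\mathbb{Z})$ by the normal closure of a single non-trivial element.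
   Context: An element of $F_2$ is primitive if it belongs to some two-element generating set of $F_2$. The subgroup $P_4$ is characteristic, hence normal, in $F_2$. $H(\mathbb{Z})$ is the integral Heisenberg group, i.e. the group of $3\times 3$ upper triangular integer matrices with ones on the diagonal. The dimension of a polycyclic group is its Hirsch length: the number of infinite factors in any subnormal series with cyclic factors. *)

theory Defs
  imports
    "HOL-Algebra.Elementary_Groups"
    "HOL-Analysis.Cartesian_Space"
begin

section \<open>Free groups\<close>

text \<open>
  A letter is a pair \<open>(g, e)\<close>: the generator \<open>g\<close> if \<open>e\<close> holds, its formal inverse otherwise.
  The free group on the type \<open>'g\<close> is realised on the freely reduced words; the product of two
  words is the free reduction of their concatenation.
\<close>

type_synonym 'g letter = "'g \<times> bool"

definition inv_letter :: "'g letter \<Rightarrow> 'g letter"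
  where "inv_letter l = (fst l, \<not> snd l)"

definition reduced :: "'g letter list \<Rightarrow> bool"
  where "reduced = successively (\<lambda>l m. m \<noteq> inv_letter l)"

fun cancel_cons :: "'g letter \<Rightarrow> 'g letter list \<Rightarrow> 'g letter list"
  where
    "cancel_cons l [] = [l]"
  | "cancel_cons l (m # w) = (if m = inv_letter l then w else l # m # w)"

definition free_group :: "'g letter list monoid"
  where "free_group =
    \<lparr>carrier = {w. reduced w}, monoid.mult = (\<lambda>u v. foldr cancel_cons u v), one = []\<rparr>"

definition free_gen :: "'g \<Rightarrow> 'g letter list"
  where "free_gen g = [(g, True)]"

lemma inv_letter_inv_letter [simp]: "inv_letter (inv_letter l) = l"
  by (simp add: inv_letter_def)

lemma reduced_Nil [simp]: "reduced []"
  by (simp add: reduced_def)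

lemma reduced_Cons: "reduced (l # w) \<longleftrightarrow> (w = [] \<or> hd w \<noteq> inv_letter l) \<and> reduced w"
  by (auto simp: reduced_def successively_Cons)

lemma reduced_cancel_cons: "reduced w \<Longrightarrow> reduced (cancel_cons l w)"
  by (cases w) (auto simp: reduced_Cons)

lemma reduced_foldr_cancel_cons: "reduced v \<Longrightarrow> reduced (foldr cancel_cons u v)"
  by (induction u) (auto simp: reduced_cancel_cons)

lemma cancel_cons_inv_letter:
  "reduced w \<Longrightarrow> cancel_cons l (cancel_cons (inv_letter l) w) = w"
  by (cases w; cases "tl w") (auto simp: reduced_Cons)

lemma foldr_cancel_cons_reduced: "reduced u \<Longrightarrow> foldr cancel_cons u [] = u"
proof (induction u)
  case (Cons l u)
  then show ?case by (cases u) (auto simp: reduced_Cons)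
qed simp

lemma foldr_cancel_cons_cancel_cons:
  assumes "reduced w"
  shows "foldr cancel_cons (cancel_cons l v) w = cancel_cons l (foldr cancel_cons v w)"
proof (cases v)
  case (Cons m v')
  show ?thesis
  proof (cases "m = inv_letter l")
    case True
    have "reduced (foldr cancel_cons v' w)"
      by (simp add: assms reduced_foldr_cancel_cons)
    then show ?thesis
      using Cons True by (simp add: cancel_cons_inv_letter)
  qed (use Cons in auto)
qed simp

lemma foldr_cancel_cons_assoc:
  "reduced w \<Longrightarrow>
    foldr cancel_cons (foldr cancel_cons u v) w = foldr cancel_cons u (foldr cancel_cons v w)"
  by (induction u) (auto simp: foldr_cancel_cons_cancel_cons)

lemma foldr_cancel_cons_inverse:
  "reduced v \<Longrightarrow> foldr cancel_cons (rev (map inv_letter u)) (foldr cancel_cons u v) = v"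
proof (induction u arbitrary: v)
  case (Cons l u)
  then show ?case
    using cancel_cons_inv_letter[of "foldr cancel_cons u v" "inv_letter l"]
    by (simp add: reduced_foldr_cancel_cons)
qed simp

lemma free_group_group: "group (free_group :: 'g letter list monoid)"
proof (rule groupI)
  fix u v w :: "'g letter list"
  let ?F = "free_group :: 'g letter list monoid"
  show "\<one>\<^bsub>?F\<^esub> \<in> carrier ?F" by (simp add: free_group_def)
  show "\<one>\<^bsub>?F\<^esub> \<otimes>\<^bsub>?F\<^esub> u = u" by (simp add: free_group_def)
  assume u: "u \<in> carrier ?F"
  have "foldr cancel_cons (rev (map inv_letter u)) [] \<otimes>\<^bsub>?F\<^esub> u = \<one>\<^bsub>?F\<^esub>"
    using u foldr_cancel_cons_inverse[of "[]" u] foldr_cancel_cons_reduced[of u]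
      foldr_cancel_cons_assoc[of u "rev (map inv_letter u)" "[]"]
    by (simp add: free_group_def)
  moreover have "foldr cancel_cons (rev (map inv_letter u)) [] \<in> carrier ?F"
    by (simp add: free_group_def reduced_foldr_cancel_cons)
  ultimately show "\<exists>y\<in>carrier ?F. y \<otimes>\<^bsub>?F\<^esub> u = \<one>\<^bsub>?F\<^esub>" by blast
  assume "v \<in> carrier ?F"
  then show "u \<otimes>\<^bsub>?F\<^esub> v \<in> carrier ?F"
    by (simp add: free_group_def reduced_foldr_cancel_cons)
  assume "w \<in> carrier ?F"
  then show "u \<otimes>\<^bsub>?F\<^esub> v \<otimes>\<^bsub>?F\<^esub> w = u \<otimes>\<^bsub>?F\<^esub> (v \<otimes>\<^bsub>?F\<^esub> w)"
    by (simp add: free_group_def foldr_cancel_cons_assoc)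
qed

lemma free_gen_closed: "free_gen g \<in> carrier free_group"
  by (simp add: free_gen_def free_group_def reduced_Cons)

text \<open>The universal property confirms that \<^const>\<open>free_group\<close> is free on \<^const>\<open>free_gen\<close>.\<close>

theorem free_group_universal:
  fixes H :: "('h, 'm) monoid_scheme" and f :: "'g \<Rightarrow> 'h"
  assumes "group H" and f: "\<And>g. f g \<in> carrier H"
  shows "\<exists>h \<in> hom free_group H. \<forall>g. h (free_gen g) = f g"
    and "\<And>h h' :: 'g letter list \<Rightarrow> 'h. \<lbrakk>h \<in> hom free_group H; h' \<in> hom free_group H;
           \<And>g. h (free_gen g) = h' (free_gen g)\<rbrakk>
         \<Longrightarrow> \<forall>w \<in> carrier free_group. h w = h' w"
proof -
  interpret H: group H by fact
  let ?F = "free_group :: 'g letter list monoid"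
  interpret F: group ?F by (rule free_group_group)
  define e where "e l = (if snd l then f (fst l) else inv\<^bsub>H\<^esub> f (fst l))" for l
  define h where "h w = foldr (\<lambda>l x. e l \<otimes>\<^bsub>H\<^esub> x) w \<one>\<^bsub>H\<^esub>" for w
  have e: "e l \<in> carrier H" for l using f by (simp add: e_def)
  have hcl: "h w \<in> carrier H" for w by (induction w) (auto simp: h_def e)
  have einv: "e (inv_letter l) = inv\<^bsub>H\<^esub> e l" for l
    using f by (auto simp: e_def inv_letter_def)
  have hc: "h (cancel_cons l w) = e l \<otimes>\<^bsub>H\<^esub> h w" for l w
  proof (cases w)
    case (Cons m v)
    have "e l \<otimes>\<^bsub>H\<^esub> (inv\<^bsub>H\<^esub> e l \<otimes>\<^bsub>H\<^esub> h v) = h v"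
      using e[of l] hcl[of v] by (simp flip: H.m_assoc)
    then show ?thesis using Cons einv[of l] by (auto simp: h_def)
  qed (simp add: h_def)
  have "h (foldr cancel_cons u v) = h u \<otimes>\<^bsub>H\<^esub> h v" for u v
  proof (induction u)
    case Nil
    show ?case using hcl[of v] by (simp add: h_def[of "[]"])
  next
    case (Cons l u)
    have "h (l # u) = e l \<otimes>\<^bsub>H\<^esub> h u" by (simp add: h_def)
    then show ?case using Cons hc e hcl by (simp add: H.m_assoc)
  qed
  then have "h \<in> hom ?F H"
    using hcl by (auto simp: hom_def free_group_def)
  moreover have "\<forall>g. h (free_gen g) = f g"
    using f by (simp add: h_def e_def free_gen_def)
  ultimately show "\<exists>h \<in> hom ?F H. \<forall>g. h (free_gen g) = f g" by blast
  fix h h' :: "'g letter list \<Rightarrow> 'h"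
  assume h: "h \<in> hom ?F H" and h': "h' \<in> hom ?F H"
    and eq: "\<And>g. h (free_gen g) = h' (free_gen g)"
  interpret h: group_hom ?F H h using h by unfold_locales
  interpret h': group_hom ?F H h' using h' by unfold_locales
  have letter: "h [l] = h' [l]" for l
  proof (cases l)
    case (Pair g s)
    have "[(g, False)] \<otimes>\<^bsub>?F\<^esub> free_gen g = \<one>\<^bsub>?F\<^esub>"
      by (simp add: free_group_def free_gen_def inv_letter_def)
    then have "inv\<^bsub>?F\<^esub> (free_gen g) = [(g, False)]"
      by (intro F.inv_equality free_gen_closed) (auto simp: free_group_def reduced_Cons)
    then have "h [(g, False)] = h' [(g, False)]"
      using h.hom_inv[OF free_gen_closed] h'.hom_inv[OF free_gen_closed] eq by metis
    then show ?thesis using Pair eq[of g] by (cases s) (auto simp: free_gen_def)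
  qed
  have "reduced w \<Longrightarrow> h w = h' w" for w
  proof (induction w)
    case Nil
    show ?case using h.hom_one h'.hom_one by (simp add: free_group_def)
  next
    case (Cons l w)
    have "l # w = [l] \<otimes>\<^bsub>?F\<^esub> w"
      using Cons.prems by (cases w) (auto simp: free_group_def reduced_Cons)
    moreover have "[l] \<in> carrier ?F" "w \<in> carrier ?F"
      using Cons.prems by (auto simp: free_group_def reduced_Cons)
    moreover have "h w = h' w"
      using Cons by (simp add: reduced_Cons)
    ultimately show ?case
      using letter[of l] by (metis h.hom_mult h'.hom_mult)
  qed
  then show "\<forall>w \<in> carrier ?F. h w = h' w"
    by (simp add: free_group_def)
qed


section \<open>The group \<open>F\<^sub>2\<close> and its power subgroups\<close>

datatype gen2 = Gen_a | Gen_b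

abbreviation F2 :: "gen2 letter list monoid"
  where "F2 \<equiv> free_group"

definition primitive :: "gen2 letter list \<Rightarrow> bool"
  where "primitive x \<longleftrightarrow>
    (\<exists>S \<subseteq> carrier F2. card S = 2 \<and> generate F2 S = carrier F2 \<and> x \<in> S)"

definition primitive_powers :: "nat \<Rightarrow> gen2 letter list set"
  where "primitive_powers n = generate F2 {x [^]\<^bsub>F2\<^esub> n | x. primitive x}"

abbreviation P4 :: "gen2 letter list set"
  where "P4 \<equiv> primitive_powers 4"


section \<open>Group-theoretic notions\<close>

definition torsion_free :: "('a, 'b) monoid_scheme \<Rightarrow> bool"
  where "torsion_free G \<longleftrightarrow>
    (\<forall>x \<in> carrier G. \<forall>n::nat. n > 0 \<and> x [^]\<^bsub>G\<^esub> n = \<one>\<^bsub>G\<^esub> \<longrightarrow> x = \<one>\<^bsub>G\<^esub>)"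

primrec lower_central :: "('a, 'b) monoid_scheme \<Rightarrow> nat \<Rightarrow> 'a set"
  where
    "lower_central G 0 = carrier G"
  | "lower_central G (Suc n) = generate G
       {x \<otimes>\<^bsub>G\<^esub> y \<otimes>\<^bsub>G\<^esub> inv\<^bsub>G\<^esub> x \<otimes>\<^bsub>G\<^esub> inv\<^bsub>G\<^esub> y | x y. x \<in> lower_central G n \<and> y \<in> carrier G}"

definition nilpotent :: "('a, 'b) monoid_scheme \<Rightarrow> bool"
  where "nilpotent G \<longleftrightarrow> group G \<and> (\<exists>n. lower_central G n = {\<one>\<^bsub>G\<^esub>})"

text \<open>
  A subnormal series \<open>G = H\<^sub>0 \<rhd> H\<^sub>1 \<rhd> \<dots> \<rhd> H\<^sub>k = 1\<close> with cyclic factors, given as the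
  list of its terms.
\<close>

definition cyclic_series :: "('a, 'b) monoid_scheme \<Rightarrow> 'a set list \<Rightarrow> bool"
  where "cyclic_series G Hs \<longleftrightarrow>
    Hs \<noteq> [] \<and> hd Hs = carrier G \<and> last Hs = {\<one>\<^bsub>G\<^esub>} \<and> (\<forall>H \<in> set Hs. subgroup H G) \<and>
    (\<forall>i. Suc i < length Hs \<longrightarrow>
       Hs ! Suc i \<lhd> G\<lparr>carrier := Hs ! i\<rparr> \<and>
       cyclic_group (G\<lparr>carrier := Hs ! i\<rparr> Mod Hs ! Suc i))"

definition infinite_factors :: "('a, 'b) monoid_scheme \<Rightarrow> 'a set list \<Rightarrow> nat"
  where "infinite_factors G Hs =
    card {i. Suc i < length Hs \<and> infinite (carrier (G\<lparr>carrier := Hs ! i\<rparr> Mod Hs ! Suc i))}"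

text \<open>
  \<open>has_dimension G d\<close>: the group \<open>G\<close> is polycyclic and \<open>d\<close> is the number of infinite factors of
  any of its subnormal series with cyclic factors.
\<close>

definition has_dimension :: "('a, 'b) monoid_scheme \<Rightarrow> nat \<Rightarrow> bool"
  where "has_dimension G d \<longleftrightarrow> group G \<and>
    (\<exists>Hs. cyclic_series G Hs) \<and> (\<forall>Hs. cyclic_series G Hs \<longrightarrow> infinite_factors G Hs = d)"

definition normal_closure :: "('a, 'b) monoid_scheme \<Rightarrow> 'a set \<Rightarrow> 'a set"
  where "normal_closure G S =
    generate G {g \<otimes>\<^bsub>G\<^esub> s \<otimes>\<^bsub>G\<^esub> inv\<^bsub>G\<^esub> g | g s. g \<in> carrier G \<and> s \<in> S}"

lemma (in group) normal_closure_normal: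
  assumes "S \<subseteq> carrier G"
  shows "normal_closure G S \<lhd> G"
  unfolding normal_closure_def
proof (rule normal_generateI)
  show "{g \<otimes> s \<otimes> inv g |g s. g \<in> carrier G \<and> s \<in> S} \<subseteq> carrier G"
    using assms by auto
  fix h g
  assume "h \<in> {g \<otimes> s \<otimes> inv g |g s. g \<in> carrier G \<and> s \<in> S}" and g: "g \<in> carrier G"
  then obtain k s where k: "k \<in> carrier G" "s \<in> S" and h: "h = k \<otimes> s \<otimes> inv k" by auto
  have "g \<otimes> h \<otimes> inv g = (g \<otimes> k) \<otimes> s \<otimes> inv (g \<otimes> k)"
    using g k assms by (auto simp: h m_assoc inv_mult_group)
  then show "g \<otimes> h \<otimes> inv g \<in> {g \<otimes> s \<otimes> inv g |g s. g \<in> carrier G \<and> s \<in> S}"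
    using g k by blast
qed

text \<open>
  The indices of \<^typ>\<open>int^3^3\<close> are \<open>1, 2, 3\<close> with \<open>3 = 0\<close> in the type \<open>3\<close>, so the order on that
  type is not the order of the indices; hence the entries below the diagonal are listed.
\<close>

definition heisenberg :: "(int^3^3) monoid"
  where "heisenberg =
    \<lparr>carrier = {M. M $ 1 $ 1 = 1 \<and> M $ 2 $ 2 = 1 \<and> M $ 3 $ 3 = 1 \<and>
                   M $ 2 $ 1 = 0 \<and> M $ 3 $ 1 = 0 \<and> M $ 3 $ 2 = 0},
     monoid.mult = (**), one = mat 1\<rparr>"

lemma heisenberg_group: "group heisenberg"
proof (rule groupI)
  fix M :: "int^3^3"
  assume M: "M \<in> carrier heisenberg"
  define x y z where "x = M $ 1 $ 2" and "y = M $ 2 $ 3" and "z = M $ 1 $ 3"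
  define M' :: "int^3^3"
    where "M' = vector [vector [1, - x, x * y - z], vector [0, 1, - y], vector [0, 0, 1]]"
  have "M' \<in> carrier heisenberg"
    by (simp add: heisenberg_def M'_def)
  moreover have "M' ** M = mat 1"
    using M by (simp add: heisenberg_def vec_eq_iff forall_3 matrix_matrix_mult_def sum_3 mat_def
        M'_def x_def y_def z_def)
  ultimately show "\<exists>N \<in> carrier heisenberg. N \<otimes>\<^bsub>heisenberg\<^esub> M = \<one>\<^bsub>heisenberg\<^esub>"
    by (auto simp: heisenberg_def)
next
  fix L M N :: "int^3^3"
  assume "L \<in> carrier heisenberg" "M \<in> carrier heisenberg"
  then show "L \<otimes>\<^bsub>heisenberg\<^esub> M \<in> carrier heisenberg"
    by (simp add: heisenberg_def matrix_matrix_mult_def sum_3)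
  show "L \<otimes>\<^bsub>heisenberg\<^esub> M \<otimes>\<^bsub>heisenberg\<^esub> N = L \<otimes>\<^bsub>heisenberg\<^esub> (M \<otimes>\<^bsub>heisenberg\<^esub> N)"
    by (simp add: heisenberg_def matrix_mul_assoc)
  show "\<one>\<^bsub>heisenberg\<^esub> \<otimes>\<^bsub>heisenberg\<^esub> M = M"
    by (simp add: heisenberg_def)
qed (simp add: heisenberg_def mat_def)


section \<open>Normality of the power subgroups\<close>

text \<open>
  Hence \<open>F2 Mod P4\<close> is a genuine quotient group.
\<close>

lemma primitive_powers_normal: "primitive_powers n \<lhd> F2"
proof -
  interpret F: group F2 by (rule free_group_group)
  let ?c = "\<lambda>g x. g \<otimes>\<^bsub>F2\<^esub> x \<otimes>\<^bsub>F2\<^esub> inv\<^bsub>F2\<^esub> g"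
  have prim: "primitive (?c g x)" if g: "g \<in> carrier F2" and "primitive x" for g x
  proof -
    from \<open>primitive x\<close> obtain S where S: "S \<subseteq> carrier F2" "card S = 2"
      "generate F2 S = carrier F2" "x \<in> S"
      unfolding primitive_def by blast
    have hom: "?c g \<in> hom F2 F2"
    proof (rule homI)
      fix u v assume "u \<in> carrier F2" "v \<in> carrier F2"
      then show "?c g (u \<otimes>\<^bsub>F2\<^esub> v) = ?c g u \<otimes>\<^bsub>F2\<^esub> ?c g v"
        using g by (simp add: F.m_assoc F.inv_solve_left flip: F.m_assoc[of "inv\<^bsub>F2\<^esub> g" g])
    qed (use g in auto)
    interpret c: group_hom F2 F2 "?c g" using hom by unfold_locales
    have inj: "inj_on (?c g) (carrier F2)"
      using g by (intro inj_onI) simp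
    have surj: "?c g ` carrier F2 = carrier F2"
    proof
      show "carrier F2 \<subseteq> ?c g ` carrier F2"
      proof
        fix y assume y: "y \<in> carrier F2"
        have "y = ?c g (inv\<^bsub>F2\<^esub> g \<otimes>\<^bsub>F2\<^esub> y \<otimes>\<^bsub>F2\<^esub> g)"
          using g y by (simp add: F.m_assoc flip: F.m_assoc[of g "inv\<^bsub>F2\<^esub> g"])
        then show "y \<in> ?c g ` carrier F2" using g y by blast
      qed
    qed (use g in auto)
    have "generate F2 (?c g ` S) = carrier F2"
      using c.generate_img[OF S(1)] S(3) surj by simp
    moreover have "card (?c g ` S) = 2"
      using card_image inj_on_subset[OF inj S(1)] S(2) by metis
    moreover have "?c g ` S \<subseteq> carrier F2" using S(1) g by auto
    ultimately show ?thesis unfolding primitive_def using S(4) by blast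
  qed
  have car: "x \<in> carrier F2" if "primitive x" for x
    using that unfolding primitive_def by blast
  have pow: "?c g x [^]\<^bsub>F2\<^esub> n = ?c g (x [^]\<^bsub>F2\<^esub> n)"
    if g: "g \<in> carrier F2" and x: "x \<in> carrier F2" for g x
  proof (induction n)
    case 0
    show ?case using g by simp
  next
    case (Suc n)
    then show ?case
      using g x by (simp add: F.m_assoc flip: F.m_assoc[of "inv\<^bsub>F2\<^esub> g" g])
  qed
  show ?thesis
    unfolding primitive_powers_def
  proof (rule F.normal_generateI)
    show "{x [^]\<^bsub>F2\<^esub> n |x. primitive x} \<subseteq> carrier F2" using car by auto
    fix h g assume "h \<in> {x [^]\<^bsub>F2\<^esub> n |x. primitive x}" and g: "g \<in> carrier F2"
    then obtain x where x: "primitive x" and h: "h = x [^]\<^bsub>F2\<^esub> n" by auto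
    show "?c g h \<in> {x [^]\<^bsub>F2\<^esub> n |x. primitive x}"
      using pow[OF g car[OF x]] prim[OF g x] h by (metis (mono_tags, lifting) mem_Collect_eq)
  qed
qed

end

theory Submission
  imports Defs "HOL-Algebra.Multiplicative_Group"
begin

text \<open>
  Write \<open>Q\<close> for the quaternion group \<open>{\<plusminus>1, \<plusminus>i, \<plusminus>j, \<plusminus>k}\<close>. It acts by left multiplication on the
  lattice \<open>\<int>\<^sup>4\<close> of quaternions with integer coordinates, and the \<open>i\<close>-component of \<open>u\<^sup>* v\<close> is an
  alternating form on this lattice which the action preserves. The form defines a Heisenberg group
  on \<open>\<int>\<^sup>4 \<times> \<int>\<close>, and \<open>QH\<close> below is the semidirect product of this group with \<open>Q\<close>. The theorem is
  true because \<open>F2/P4\<close> embeds into it by \<open>a \<mapsto> (i, 0, 0)\<close>, \<open>b \<mapsto> (j, 1, 0)\<close>, where all the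
  assertions become computations with integers.

  The map kills \<open>P4\<close>. The fourth power of an element of \<open>QH\<close> whose component in \<open>Q\<close> squares to
  \<open>-1\<close> is trivial if and only if one integer, quadratic in the coordinates, vanishes
  (\<open>quarter_turn_iff\<close>). These integers satisfy a linear relation of Markov type, by which they
  vanish at \<open>X Y Y\<close> when they vanish at \<open>X\<close>, \<open>Y\<close>, \<open>X Y\<close> and \<open>X Y\<^sup>-\<^sup>1\<close> (\<open>quarter_turn_triple\<close>).
  So the vanishing at these four elements is preserved by the Nielsen moves on pairs \<open>(X, Y)\<close>. Any two
  generators of \<open>F2\<close> arise from \<open>a, b\<close> by Nielsen moves and conjugation
  (\<open>nielsen_pair_of_generators\<close>), hence every primitive element is mapped to an element with trivial
  fourth power (\<open>quarter_turn_primitive\<close>).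

  The map is injective on the quotient. For this the fourth powers of the six primitive elements
  \<open>a, b, ab, ab\<^sup>-\<^sup>1, aab, abb\<close> suffice. The kernel \<open>K\<close> of the map to \<open>Q\<close> has eight cosets and is
  generated by four words \<open>x1, \<dots>, x4\<close> (\<open>K_cosets\<close>). Tracing the six relators through the coset table
  gives seven relations between these words, and from them it follows that \<open>x5 = [x1, x3]\<close> is
  central and that all commutators of the \<open>xi\<close> are powers of \<open>x5\<close> (\<open>commutator_calculus\<close>). Thus every
  element of \<open>K\<close> is a product of powers of \<open>x1, \<dots>, x5\<close> in this order, and the images of these five
  elements are independent (\<open>\<psi>_one_iff\<close>).

  Finally \<open>N\<close> is a group of translations. Its image is the image of \<open>H(\<int>) \<times> H(\<int>)\<close> under a
  homomorphism \<open>chi\<close> whose kernel is generated by \<open>(Z\<^sup>2, Z\<^sup>-\<^sup>1)\<close>, where \<open>Z\<close> generates the centre of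
  \<open>H(\<int>)\<close> (\<open>chi_image\<close>, \<open>kernel_chi\<close>): the commutator forms on the two factors have ratio two. The
  five integer coordinates filter \<open>K\<close> and \<open>N\<close> by subgroups with infinite cyclic factors. For \<open>N\<close> this
  gives dimension five and the absence of torsion (\<open>poly_Z\<close>); comparing the two filtrations gives
  the index \<open>8 \<sqdot> 2 \<sqdot> 4 \<sqdot> 4 \<sqdot> 2 = 2\<^sup>9\<close> of \<open>N\<close> in \<open>K\<close>, and \<open>K\<close> has index \<open>2\<^sup>3\<close> (\<open>card_rcosets_N\<close>).
\<close>


section \<open>Words and commutators in groups\<close>

lemma (in group) mult_inv_cancel:
  assumes "x \<in> carrier G" "y \<in> carrier G"
  shows "x \<otimes> (inv x \<otimes> y) = y" "inv x \<otimes> (x \<otimes> y) = y"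
  using assms by (simp_all flip: m_assoc)

lemmas (in group) word_simps = m_assoc inv_mult_group mult_inv_cancel

lemma (in group) generate_eq_carrier_mono:
  assumes "generate G S = carrier G" "S \<subseteq> generate G T" "T \<subseteq> carrier G"
  shows "generate G T = carrier G"
  using generate_subgroup_incl[OF assms(2) generate_is_subgroup[OF assms(3)]]
    generate_incl[OF assms(3)] assms(1) by blast

lemma (in group) generate_conj:
  assumes "generate G {x, y} = carrier G" "x \<in> carrier G" "y \<in> carrier G" "g \<in> carrier G"
  shows "generate G {g \<otimes> x \<otimes> inv g, g \<otimes> y \<otimes> inv g} = carrier G"
proof -
  let ?T = "{g \<otimes> x \<otimes> inv g, g \<otimes> y \<otimes> inv g}"
  let ?H = "generate G ?T"
  have T: "?T \<subseteq> carrier G" using assms by auto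
  have H: "g \<otimes> h \<otimes> inv g \<in> ?H" if "h \<in> generate G {x, y}" for h
    using that
  proof (induction rule: generate.induct)
    case one
    show ?case using assms generate.one by simp
  next
    case (incl h)
    then show ?case by (auto intro: generate.incl)
  next
    case (inv h)
    then have "inv (g \<otimes> h \<otimes> inv g) \<in> ?H" by (auto intro: generate.inv)
    then show ?case using inv assms by (auto simp: word_simps)
  next
    case (eng h1 h2)
    then have h: "h1 \<in> carrier G" "h2 \<in> carrier G"
      using assms generate_in_carrier[of "{x, y}"] by auto
    have "(g \<otimes> h1 \<otimes> inv g) \<otimes> (g \<otimes> h2 \<otimes> inv g) \<in> ?H"
      using eng.IH by (rule generate.eng)
    then show ?case using h assms by (simp add: word_simps)
  qed
  have "k \<in> ?H" if k: "k \<in> carrier G" for k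
  proof -
    have "g \<otimes> (inv g \<otimes> k \<otimes> g) \<otimes> inv g \<in> ?H" using H assms k by simp
    then show ?thesis using k assms by (simp add: word_simps)
  qed
  then show ?thesis using generate_incl[OF T] by blast
qed

lemma (in group) commute_inv:
  assumes "g \<otimes> h = h \<otimes> g" "g \<in> carrier G" "h \<in> carrier G"
  shows "inv g \<otimes> h = h \<otimes> inv g"
proof -
  have "inv g \<otimes> h = inv g \<otimes> (h \<otimes> g) \<otimes> inv g" using assms(2,3) by (simp add: word_simps)
  also have "\<dots> = h \<otimes> inv g"
    unfolding assms(1)[symmetric] using assms(2,3) by (simp add: word_simps)
  finally show ?thesis .
qed

lemma (in group) commute_int_pow:
  assumes "g \<otimes> h = h \<otimes> g" "g \<in> carrier G" "h \<in> carrier G"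
  shows "g [^] (n::int) \<otimes> h = h \<otimes> g [^] n"
proof (cases n rule: int_cases2)
  case (nonneg m)
  then show ?thesis using group_commutes_pow[OF assms] by (simp add: int_pow_int)
next
  case (nonpos m)
  then show ?thesis
    using commute_inv[OF group_commutes_pow[OF assms]] assms by (simp add: int_pow_neg_int)
qed

text \<open>
  Modulo the central element \<open>t\<close> the generator \<open>x\<close> commutes with \<open>S\<close>. So the powers of \<open>x\<close> can be
  collected on the left; the powers of \<open>t\<close> that this costs stay in the subgroup generated by \<open>S\<close>.
\<close>

lemma (in group) generate_insert_normal_form:
  assumes S: "S \<subseteq> carrier G" and x [simp]: "x \<in> carrier G" and t: "t \<in> generate G S"
    and t_x: "t \<otimes> x = x \<otimes> t" and t_S: "\<And>s. s \<in> S \<Longrightarrow> t \<otimes> s = s \<otimes> t"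
    and commute: "\<And>s. s \<in> S \<Longrightarrow> \<exists>e::int. s \<otimes> x = x \<otimes> s \<otimes> t [^] e"
    and g: "g \<in> generate G (insert x S)"
  shows "\<exists>n::int. \<exists>h \<in> generate G S. g = x [^] n \<otimes> h"
proof -
  let ?H = "generate G S"
  interpret H: subgroup ?H G using S by (rule generate_is_subgroup)
  have H [simp]: "h \<in> carrier G" if "h \<in> ?H" for h using that by (rule H.mem_carrier)
  have tc [simp]: "t \<in> carrier G" using t by simp
  have pow_comm: "t [^] (e::int) \<otimes> h = h \<otimes> t [^] e" if "t \<otimes> h = h \<otimes> t" "h \<in> carrier G" for h e
    using commute_int_pow[OF that(1) tc that(2)] .
  have t_H: "t \<otimes> h = h \<otimes> t" if "h \<in> ?H" for h
    using that
  proof (induction rule: generate.induct)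
    case (inv s)
    then have [simp]: "s \<in> carrier G" using S by blast
    have "t \<otimes> inv s = inv s \<otimes> (s \<otimes> t) \<otimes> inv s" by (simp add: word_simps)
    then show ?case unfolding t_S[OF inv, symmetric] by (simp add: word_simps)
  next
    case (eng g h)
    then have [simp]: "g \<in> carrier G" "h \<in> carrier G" by simp_all
    have "t \<otimes> (g \<otimes> h) = (t \<otimes> g) \<otimes> h" by (simp add: m_assoc)
    also have "\<dots> = g \<otimes> (t \<otimes> h)" unfolding eng.IH(1) by (simp add: m_assoc)
    also have "\<dots> = g \<otimes> h \<otimes> t" unfolding eng.IH(2) by (simp add: m_assoc)
    finally show ?case .
  qed (use t_S in auto)
  have x_H: "\<exists>e::int. h \<otimes> x = x \<otimes> h \<otimes> t [^] e" if "h \<in> ?H" for h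
    using that
  proof (induction rule: generate.induct)
    case one
    show ?case by (intro exI[of _ 0]) simp
  next
    case (incl s)
    then show ?case using commute by blast
  next
    case (inv s)
    then have [simp]: "s \<in> carrier G" using S by blast
    obtain e :: int where e: "s \<otimes> x = x \<otimes> s \<otimes> t [^] e" using commute inv by blast
    have "inv s \<otimes> x = inv s \<otimes> (x \<otimes> s \<otimes> t [^] e) \<otimes> t [^] (- e) \<otimes> inv s"
      by (simp add: m_assoc int_pow_neg)
    also have "\<dots> = x \<otimes> t [^] (- e) \<otimes> inv s" unfolding e[symmetric] by (simp add: word_simps)
    also have "\<dots> = x \<otimes> inv s \<otimes> t [^] (- e)"
      using pow_comm[OF t_H[OF generate.inv[OF inv]], of "- e"] by (simp add: m_assoc)
    finally show ?case by blast
  next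
    case (eng g h)
    then have [simp]: "g \<in> carrier G" "h \<in> carrier G" by simp_all
    obtain d e :: int where de: "g \<otimes> x = x \<otimes> g \<otimes> t [^] d" "h \<otimes> x = x \<otimes> h \<otimes> t [^] e"
      using eng by blast
    have "g \<otimes> h \<otimes> x = g \<otimes> x \<otimes> h \<otimes> t [^] e" using de(2) by (simp add: m_assoc)
    also have "\<dots> = x \<otimes> g \<otimes> (t [^] d \<otimes> h) \<otimes> t [^] e" unfolding de(1) by (simp add: m_assoc)
    also have "\<dots> = x \<otimes> (g \<otimes> h) \<otimes> t [^] (d + e)"
      using pow_comm[OF t_H[OF eng.hyps(2)], of d] by (simp add: m_assoc int_pow_mult)
    finally show ?case by blast
  qed
  \<comment> \<open>The set of normal forms is closed under right multiplication by the generators and their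
    inverses; this avoids proving that it is a subgroup.\<close>
  define D where "D = {d. \<exists>n::int. \<exists>h \<in> ?H. d = x [^] n \<otimes> h}"
  have step: "d \<otimes> x \<in> D \<and> d \<otimes> inv x \<in> D" if d: "d \<in> D" for d
  proof -
    obtain n :: int and h where h: "h \<in> ?H" "d = x [^] n \<otimes> h" using d by (auto simp: D_def)
    have [simp]: "h \<in> carrier G" using h(1) by simp
    obtain e :: int where e: "h \<otimes> x = x \<otimes> h \<otimes> t [^] e" using x_H h by blast
    have tpow: "h \<otimes> t [^] (k::int) \<in> ?H" for k
      using h t subgroup_int_pow_closed[OF H.subgroup_axioms] by simp
    have xi: "x [^] n \<otimes> x = x [^] (n + 1)" "x [^] n \<otimes> inv x = x [^] (n - 1)"
      using int_pow_mult[OF x, of n 1] int_pow_mult[OF x, of n "-1"] by (simp_all add: int_pow_neg)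
    have "d \<otimes> x = x [^] n \<otimes> x \<otimes> (h \<otimes> t [^] e)" unfolding h(2) using e by (simp add: m_assoc)
    then have "d \<otimes> x = x [^] (n + 1) \<otimes> (h \<otimes> t [^] e)" by (simp only: xi)
    moreover have "d \<otimes> inv x = x [^] (n - 1) \<otimes> (h \<otimes> t [^] (- e))"
    proof -
      have "t [^] (- e) \<otimes> x = x \<otimes> t [^] (- e)" by (rule pow_comm) (simp_all add: t_x)
      then have 1: "x \<otimes> h \<otimes> t [^] (- e) = x \<otimes> (h \<otimes> t [^] (- e))" by (simp add: m_assoc)
      have "h = inv x \<otimes> (x \<otimes> h \<otimes> t [^] e) \<otimes> t [^] (- e)" by (simp add: word_simps int_pow_neg)
      also have "\<dots> = inv x \<otimes> (h \<otimes> t [^] (- e)) \<otimes> x"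
        unfolding e[symmetric] using \<open>t [^] (- e) \<otimes> x = x \<otimes> t [^] (- e)\<close> by (simp add: m_assoc)
      finally have "h \<otimes> inv x = inv x \<otimes> (h \<otimes> t [^] (- e)) \<otimes> x \<otimes> inv x" by simp
      then have "h \<otimes> inv x = inv x \<otimes> (h \<otimes> t [^] (- e))" by (simp add: m_assoc)
      then have "d \<otimes> inv x = x [^] n \<otimes> inv x \<otimes> (h \<otimes> t [^] (- e))" unfolding h(2) by (simp add: m_assoc)
      then show ?thesis by (simp only: xi)
    qed
    ultimately show ?thesis unfolding D_def using tpow by blast
  qed
  have stepH: "d \<otimes> h \<in> D" if dh: "d \<in> D" "h \<in> ?H" for d h
  proof -
    obtain n :: int and k where k: "k \<in> ?H" "d = x [^] n \<otimes> k" using dh(1) by (auto simp: D_def)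
    then have "d \<otimes> h = x [^] n \<otimes> (k \<otimes> h)" using dh by (simp add: m_assoc)
    moreover have "k \<otimes> h \<in> ?H" using k(1) dh(2) by (rule H.m_closed)
    ultimately show ?thesis unfolding D_def by blast
  qed
  have Dc: "d \<in> carrier G" if "d \<in> D" for d using that by (auto simp: D_def)
  have "d \<otimes> g \<in> D" if "d \<in> D" for d
    using g that
  proof (induction arbitrary: d rule: generate.induct)
    case one
    then show ?case using Dc by simp
  next
    case (incl s)
    then show ?case using step stepH[OF _ generate.incl[of s S G]] by blast
  next
    case (inv s)
    then show ?case using step stepH[OF _ generate.inv[of s S G]] by blast
  next
    case (eng g h)
    have "{g, h} \<subseteq> carrier G" using generate_in_carrier[of "insert x S"] eng S by auto
    then have "d \<otimes> (g \<otimes> h) = d \<otimes> g \<otimes> h" using Dc[OF eng.prems] by (simp add: m_assoc)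
    then show ?case using eng by simp
  qed
  moreover have "\<one> \<in> D" unfolding D_def by (rule CollectI, rule exI[of _ 0], rule bexI[of _ \<one>]) auto
  ultimately have "\<one> \<otimes> g \<in> D" by blast
  moreover have "g \<in> carrier G" using generate_in_carrier[OF _ g] S by simp
  ultimately show ?thesis by (simp add: D_def)
qed

lemma (in group) int_pow_neg_numeral:
  "g \<in> carrier G \<Longrightarrow> g [^] (- numeral n :: int) = inv (g [^] (numeral n :: nat))"
  using int_pow_neg_int[of g "numeral n"] by simp

lemma (in group) nilpotent_if_commutators_central:
  assumes "\<And>x y g. \<lbrakk>x \<in> carrier G; y \<in> carrier G; g \<in> carrier G\<rbrakk> \<Longrightarrow>
    (x \<otimes> y \<otimes> inv x \<otimes> inv y) \<otimes> g = g \<otimes> (x \<otimes> y \<otimes> inv x \<otimes> inv y)"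
  shows "nilpotent G"
proof -
  let ?S = "{x \<otimes> y \<otimes> inv x \<otimes> inv y |x y. x \<in> carrier G \<and> y \<in> carrier G}"
  have S: "?S \<subseteq> carrier G" by auto
  have central: "g \<otimes> h = h \<otimes> g" if "g \<in> generate G ?S" "h \<in> carrier G" for g h
    using that
  proof (induction arbitrary: h rule: generate.induct)
    case (incl g)
    then show ?case using assms by blast
  next
    case (inv g)
    then have "g \<otimes> h = h \<otimes> g" "g \<in> carrier G" using assms S by blast+
    then show ?case using commute_inv inv by blast
  next
    case (eng g g')
    then have [simp]: "g \<in> carrier G" "g' \<in> carrier G" "h \<in> carrier G"
      using generate_in_carrier[OF S] by blast+
    have "g \<otimes> g' \<otimes> h = g \<otimes> (g' \<otimes> h)" by (simp add: m_assoc)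
    also have "\<dots> = (g \<otimes> h) \<otimes> g'" using eng.IH(2) by (simp add: m_assoc)
    also have "\<dots> = h \<otimes> (g \<otimes> g')" using eng.IH(1) by (simp add: m_assoc)
    finally show ?case .
  qed simp
  have "{x \<otimes> y \<otimes> inv x \<otimes> inv y |x y. x \<in> generate G ?S \<and> y \<in> carrier G} \<subseteq> {\<one>}"
  proof clarify
    fix g h assume g: "g \<in> generate G ?S" and h: "h \<in> carrier G"
    have "g \<in> carrier G" using generate_in_carrier[OF S g] .
    then show "g \<otimes> h \<otimes> inv g \<otimes> inv h = \<one>" unfolding central[OF g h] using h by (simp add: m_assoc)
  qed
  then have "generate G {x \<otimes> y \<otimes> inv x \<otimes> inv y |x y. x \<in> generate G ?S \<and> y \<in> carrier G} \<subseteq> {\<one>}"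
    by (intro generate_subgroup_incl triv_subgroup)
  then have "lower_central G (Suc (Suc 0)) = {\<one>}"
    using generate.one by fastforce
  then show ?thesis unfolding nilpotent_def using is_group by blast
qed


section \<open>Nielsen reduction in the free group of rank two\<close>

abbreviation winv :: "'g letter list \<Rightarrow> 'g letter list"
  where "winv w \<equiv> rev (map inv_letter w)"

lemma inv_letter_neq [simp]: "inv_letter l \<noteq> l" "l \<noteq> inv_letter l"
  by (cases l; simp add: inv_letter_def)+

lemma inv_letter_eq_iff [simp]: "inv_letter l = inv_letter m \<longleftrightarrow> l = m"
  by (metis inv_letter_inv_letter)

lemma reduced_append:
  "reduced (u @ v) \<longleftrightarrow>
    reduced u \<and> reduced v \<and> (u = [] \<or> v = [] \<or> hd v \<noteq> inv_letter (last u))"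
  by (auto simp: reduced_def successively_append_iff)

lemma reduced_winv [simp]: "reduced (winv w) \<longleftrightarrow> reduced w"
proof (induction w)
  case (Cons l w)
  then show ?case
    by (cases w) (auto simp: reduced_append reduced_Cons last_rev hd_map eq_commute)
qed simp

lemma winv_winv [simp]: "winv (winv w) = w"
  by (induction w) auto

lemma winv_append [simp]: "winv (u @ v) = winv v @ winv u"
  by simp

lemma carrier_free_group: "w \<in> carrier free_group \<longleftrightarrow> reduced w"
  by (simp add: free_group_def)

lemma one_free_group: "\<one>\<^bsub>free_group\<^esub> = []"
  by (simp add: free_group_def)

abbreviation free_mult (infixl "\<cdot>" 70)
  where "u \<cdot> v \<equiv> u \<otimes>\<^bsub>free_group\<^esub> v"

lemma mult_reduced_append: "reduced (u @ v) \<Longrightarrow> u \<cdot> v = u @ v"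
proof (induction u)
  case (Cons l u)
  then show ?case by (cases "u @ v") (auto simp: free_group_def reduced_Cons)
qed (simp add: free_group_def)

lemma inv_free_group: "reduced w \<Longrightarrow> inv\<^bsub>free_group\<^esub> w = winv w"
proof -
  assume w: "reduced w"
  interpret F: group free_group by (rule free_group_group)
  have "foldr cancel_cons (winv w) (foldr cancel_cons w []) = []"
    by (rule foldr_cancel_cons_inverse) simp
  then have "winv w \<cdot> w = \<one>\<^bsub>free_group\<^esub>"
    using w by (simp add: free_group_def foldr_cancel_cons_reduced)
  then show ?thesis using w by (intro F.inv_equality) (auto simp: carrier_free_group)
qed

lemma mult_cancellation:
  assumes "reduced u" "reduced v"
  obtains p q r where "u = p @ q" "v = winv q @ r" "reduced (p @ r)"
    "u \<cdot> v = p @ r"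
  using assms
proof (induction u arbitrary: v thesis rule: rev_induct)
  case Nil
  show ?case by (rule Nil(1)[of "[]" "[]" v]) (use Nil in \<open>auto simp: free_group_def\<close>)
next
  case (snoc l u)
  have u: "reduced u" using snoc.prems by (simp add: reduced_append)
  show ?case
  proof (cases "v \<noteq> [] \<and> hd v = inv_letter l")
    case True
    then obtain v' where v: "v = inv_letter l # v'" by (cases v) auto
    have v': "reduced v'" using snoc.prems v by (simp add: reduced_Cons)
    obtain p q r where pqr: "u = p @ q" "v' = winv q @ r" "reduced (p @ r)"
      "u \<cdot> v' = p @ r"
      using snoc.IH[OF _ u v'] by blast
    show ?thesis
      by (rule snoc.prems(1)[of p "q @ [l]" r]) (use pqr v in \<open>auto simp: free_group_def\<close>)
  next
    case False
    then have red: "reduced ((u @ [l]) @ v)"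
      using snoc.prems by (auto simp: reduced_append reduced_Cons)
    show ?thesis
      by (rule snoc.prems(1)[of "u @ [l]" "[]" v])
        (use red in \<open>auto simp: mult_reduced_append\<close>)
  qed
qed

text \<open>
  The number of letters of \<open>u\<close> that cancel against letters of \<open>v\<close>. The difference of the lengths
  is even, so nothing is lost in the division; see \<open>mult_cancelled\<close>.
\<close>

definition cancelled :: "'g letter list \<Rightarrow> 'g letter list \<Rightarrow> nat"
  where "cancelled u v = (length u + length v - length (u \<cdot> v)) div 2"

lemma mult_cancelled:
  assumes "reduced u" "reduced v"
  obtains p q r where "u = p @ q" "v = winv q @ r" "reduced (p @ r)"
    "u \<cdot> v = p @ r" "length q = cancelled u v"
proof -
  obtain p q r where *: "u = p @ q" "v = winv q @ r" "reduced (p @ r)"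
    "u \<cdot> v = p @ r"
    using mult_cancellation[OF assms] .
  moreover have "length q = cancelled u v" using * by (simp add: cancelled_def)
  ultimately show ?thesis by (rule that)
qed

lemma reduced_append_winv: "reduced (q @ winv q) \<Longrightarrow> q = []"
  by (cases q rule: rev_cases) (auto simp: reduced_append reduced_Cons)

text \<open>
  The first and the last letter of such a word are mutually inverse. They can be stripped off, and
  what remains in the end are two adjacent inverse letters, or a letter that is its own inverse.
\<close>

lemma reduced_winv_fixed:
  assumes "reduced s" "winv s = s"
  shows "s = []"
  using assms
proof (induction s rule: length_induct)
  case (1 s)
  show ?case
  proof (cases s)
    case (Cons l s')
    show ?thesis
    proof (cases s' rule: rev_cases)
      case Nil
      then show ?thesis using 1 Cons by simp
    next
      case (snoc s'' m)
      then have "m = inv_letter l" "winv s'' = s''" "reduced s''"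
        using 1 Cons by (auto simp: reduced_append reduced_Cons)
      moreover from this have "s'' = []" using 1 Cons snoc by auto
      ultimately show ?thesis using 1 Cons snoc by (simp add: reduced_Cons)
    qed
  qed simp
qed

text \<open>
  If at least half of a word cancelled against the word itself, then the prefix \<open>winv q\<close> and
  the suffix \<open>q\<close> would overlap in a word equal to its own inverse.
\<close>

lemma self_cancellation:
  assumes "u = p @ q" "u = winv q @ r" "reduced u" "u \<noteq> []"
  shows "length q < length r"
proof (rule ccontr)
  assume "\<not> length q < length r"
  moreover have len: "length p = length r"
    using arg_cong[OF assms(1), of length] arg_cong[OF assms(2), of length] by auto
  ultimately have le: "length p \<le> length q" by simp
  define s where "s = drop (length p) (winv q)"
  have wq: "winv q = p @ s"
  proof -
    have "take (length p) (winv q) = p"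
      using le arg_cong[OF trans[OF assms(2)[symmetric] assms(1)], of "take (length p)"] by simp
    then show ?thesis unfolding s_def by (metis append_take_drop_id)
  qed
  then have q: "q = winv s @ winv p" by (metis winv_append winv_winv)
  have "p @ q = p @ s @ r" using assms wq by simp
  then have qs: "q = s @ r" by simp
  then have "winv s @ winv p = s @ r" using q by simp
  then have "winv s = s" by (simp add: append_eq_append_conv)
  moreover have "reduced s" using assms(1,3) qs by (simp add: reduced_append)
  ultimately have "s = []" by (rule reduced_winv_fixed[rotated])
  then have "q = winv p" using q by simp
  then show False using reduced_append_winv[of p] assms by auto
qed

lemma cancelled_self:
  assumes "reduced u" "u \<noteq> []"
  shows "2 * cancelled u u < length u"
proof -
  obtain p q r where *: "u = p @ q" "u = winv q @ r" "length q = cancelled u u"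
    using mult_cancelled[OF assms(1) assms(1)] by metis
  have "length q < length r" using self_cancellation[OF *(1,2)] assms by simp
  then show ?thesis using *(3) arg_cong[OF *(2), of length] by simp
qed

lemma length_mult_cancelled:
  assumes "reduced u" "reduced v"
  shows "length (u \<cdot> v) + 2 * cancelled u v = length u + length v"
proof -
  obtain p q r where "u = p @ q" "v = winv q @ r" "u \<cdot> v = p @ r"
    "length q = cancelled u v"
    using mult_cancelled[OF assms] by metis
  then show ?thesis by simp
qed

text \<open>
  A letter \<open>l\<close> stands for the word \<open>e l\<close>. The conditions say that neighbouring factors cancel at most
  half of each other, and that the two neighbours of a factor do not cancel it completely.
\<close>

locale nielsen_reduced =
  fixes e :: "gen2 letter \<Rightarrow> 'g letter list"
  assumes red: "reduced (e l)"
    and nonempty: "e l \<noteq> []"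
    and half: "m \<noteq> inv_letter l \<Longrightarrow>
      2 * cancelled (e l) (e m) \<le> length (e l) \<and> 2 * cancelled (e l) (e m) \<le> length (e m)"
    and middle: "\<lbrakk>m \<noteq> inv_letter l; n \<noteq> inv_letter m\<rbrakk> \<Longrightarrow>
      cancelled (e l) (e m) + cancelled (e m) (e n) < length (e m)"
begin

definition val :: "gen2 letter list \<Rightarrow> 'g letter list"
  where "val w = foldr (\<lambda>l v. e l \<cdot> v) w []"

text \<open>
  Induction from the right. By \<open>middle\<close> more survives of the factor \<open>e m\<close> than the preceding factor
  can cancel, so \<open>e l\<close> cancels against the value of the remaining word exactly as it would against
  \<open>e m\<close> alone. A letter of \<open>e l\<close> survives because of \<open>half\<close> and one of \<open>e m\<close> because of \<open>middle\<close>, whence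
  the bound on the length.
\<close>

lemma val_prefix:
  assumes "reduced (l # w)"
  shows "reduced (val (l # w)) \<and>
    (\<exists>s. val (l # w) =
      take (length (e l) - (if w = [] then 0 else cancelled (e l) (e (hd w)))) (e l) @ s) \<and>
    (w \<noteq> [] \<longrightarrow> length (val (l # w)) \<ge> 2)"
  using assms
proof (induction w arbitrary: l)
  case Nil
  have "val [l] = e l" using red[of l] by (simp add: val_def mult_reduced_append)
  then show ?case using red by simp
next
  case (Cons m w)
  have lm: "m \<noteq> inv_letter l" and mw: "reduced (m # w)"
    using Cons.prems by (auto simp: reduced_Cons)
  define k where "k = (if w = [] then 0 else cancelled (e m) (e (hd w)))"
    note IH = Cons.IH[OF mw]
    obtain s where s: "val (m # w) = take (length (e m) - k) (e m) @ s"
      using IH unfolding k_def by blast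
    obtain p q r where pqr: "e l = p @ q" "e m = winv q @ r" "reduced (p @ r)"
      "length q = cancelled (e l) (e m)"
      using mult_cancelled[OF red red] by metis
    have "length q + k < length (e m)"
    proof (cases "w = []")
      case True
      then show ?thesis using half[OF lm] nonempty[of m] pqr(4)
        by (cases "e m") (auto simp: k_def)
    next
      case False
      then have "hd w \<noteq> inv_letter m" using mw by (simp add: reduced_Cons)
      then show ?thesis using middle[OF lm] False pqr(4) by (simp add: k_def)
    qed
    then have kr: "k < length r" using pqr(2) by simp
    \<comment> \<open>the part of \<open>e m\<close> that cancels on neither side\<close>
    define r' where "r' = take (length r - k) r"
    have r': "r' \<noteq> []" "hd r' = hd r" using kr by (auto simp: r'_def)
    have val: "val (m # w) = winv q @ r' @ s"
      using s kr pqr(2) by (simp add: r'_def)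
    have "reduced (winv q @ r' @ s)" using IH val by simp
    then have "reduced (r' @ s)" by (subst (asm) reduced_append) simp
    then have prs: "reduced (p @ r' @ s)"
      using pqr(3) r' kr by (auto simp: reduced_append)
    interpret F: group "free_group :: 'g letter list monoid" by (rule free_group_group)
    have q: "reduced q" "reduced p" using red[of l] pqr(1) by (auto simp: reduced_append)
    have "val (l # m # w) = e l \<cdot> (winv q @ r' @ s)"
      using val by (simp add: val_def)
    also have "\<dots> = (p \<cdot> q) \<cdot>
        (inv\<^bsub>free_group\<^esub> q \<cdot> (r' @ s))"
      using red[of l] pqr(1) q \<open>reduced (winv q @ r' @ s)\<close>
      by (simp add: mult_reduced_append inv_free_group)
    also have "\<dots> = p \<cdot> (r' @ s)"
      using q \<open>reduced (r' @ s)\<close>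
      by (simp add: F.m_assoc carrier_free_group[symmetric] F.inv_solve_left flip: F.m_assoc[of q])
    also have "\<dots> = p @ r' @ s" using prs by (rule mult_reduced_append)
    finally have v: "val (l # m # w) = p @ r' @ s" .
    have "p \<noteq> []"
      using half[OF lm] nonempty[of l] pqr(1,4) by (cases p) auto
    then have len: "length (val (l # m # w)) \<ge> 2" using v r' by (cases p; cases r') auto
    have "take (length (e l) - cancelled (e l) (e m)) (e l) = p" using pqr(1,4) by simp
    then have ex: "\<exists>s. val (l # m # w) = take (length (e l) - cancelled (e l) (e m)) (e l) @ s"
      using v by simp
    show ?case using prs v len ex by simp
qed

lemma val_single_letter:
  assumes "reduced w" "length (val w) = 1"
  obtains l where "val w = e l"
proof -
  consider "w = []" | l where "w = [l]" | l w' where "w = l # w'" "w' \<noteq> []"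
    by (cases w) auto
  then show ?thesis
  proof cases
    case 1 then show ?thesis using assms by (simp add: val_def)
  next
    case (2 l)
    then show ?thesis using that[of l] red[of l] by (simp add: val_def mult_reduced_append)
  next
    case 3 then show ?thesis using assms val_prefix by fastforce
  qed
qed

end

interpretation F2: group F2
  by (rule free_group_group)

text \<open>
  Conjugation is admitted as a move because the total length of a pair then suffices to measure
  the progress of the reduction. With the Nielsen moves alone, ties between pairs of the same length
  have to be broken by an ordering of words.
\<close>

inductive nielsen_pair :: "gen2 letter list \<Rightarrow> gen2 letter list \<Rightarrow> bool"
  where
    base: "nielsen_pair (free_gen Gen_a) (free_gen Gen_b)"
  | swap: "nielsen_pair x y \<Longrightarrow> nielsen_pair y x"
  | invert: "nielsen_pair x y \<Longrightarrow> nielsen_pair (inv\<^bsub>F2\<^esub> x) y"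
  | mult: "nielsen_pair x y \<Longrightarrow> nielsen_pair (x \<cdot> y) y"
  | conj: "\<lbrakk>nielsen_pair x y; g \<in> carrier F2\<rbrakk> \<Longrightarrow>
      nielsen_pair (g \<cdot> x \<cdot> inv\<^bsub>F2\<^esub> g) (g \<cdot> y \<cdot> inv\<^bsub>F2\<^esub> g)"

text \<open>
  The moves are invertible, so a pair can be replaced by a shorter one.
\<close>

lemma nielsen_pair_mult_right:
  assumes "nielsen_pair (x \<cdot> y) y" "x \<in> carrier F2" "y \<in> carrier F2"
  shows "nielsen_pair x y"
proof -
  have "nielsen_pair (x \<cdot> y \<cdot> inv\<^bsub>F2\<^esub> y) (inv\<^bsub>F2\<^esub> y)"
    by (rule mult[OF swap[OF invert[OF swap[OF assms(1)]]]])
  then have "nielsen_pair x (inv\<^bsub>F2\<^esub> y)" using assms by (simp add: F2.word_simps)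
  then have "nielsen_pair (inv\<^bsub>F2\<^esub> (inv\<^bsub>F2\<^esub> y)) x" by (rule invert[OF swap])
  then show ?thesis using assms by (simp add: swap)
qed

lemma nielsen_pair_mult_left:
  assumes "nielsen_pair x (x \<cdot> y)" "x \<in> carrier F2" "y \<in> carrier F2"
  shows "nielsen_pair x y"
proof -
  have "nielsen_pair (inv\<^bsub>F2\<^esub> (x \<cdot> y) \<cdot> x) x"
    by (rule mult[OF invert[OF swap[OF assms(1)]]])
  then have "nielsen_pair (inv\<^bsub>F2\<^esub> y) x" using assms by (simp add: F2.word_simps)
  then have "nielsen_pair (inv\<^bsub>F2\<^esub> (inv\<^bsub>F2\<^esub> y)) x" by (rule invert)
  then show ?thesis using assms by (simp add: swap)
qed

definition letter_value :: "gen2 letter list \<Rightarrow> gen2 letter list \<Rightarrow> gen2 letter \<Rightarrow> gen2 letter list"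
  where "letter_value x y l =
    (let u = (case fst l of Gen_a \<Rightarrow> x | Gen_b \<Rightarrow> y) in if snd l then u else inv\<^bsub>F2\<^esub> u)"

context
  fixes x y :: "gen2 letter list"
  assumes xy: "x \<in> carrier F2" "y \<in> carrier F2"
begin

lemma letter_value_closed: "letter_value x y l \<in> carrier F2"
  using xy by (auto simp: letter_value_def Let_def split: gen2.split)

lemma letter_value_inv_letter: "letter_value x y (inv_letter l) = inv\<^bsub>F2\<^esub> letter_value x y l"
  using xy by (auto simp: letter_value_def inv_letter_def Let_def split: gen2.split)

lemma length_letter_values:
  "fst l \<noteq> fst m \<Longrightarrow>
    length (letter_value x y l) + length (letter_value x y m) = length x + length y"
  using xy by (cases "fst l"; cases "fst m")
    (auto simp: letter_value_def inv_free_group carrier_free_group)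

lemma nielsen_pair_letter_values:
  assumes "fst l \<noteq> fst m" "nielsen_pair (letter_value x y l) (letter_value x y m)"
  shows "nielsen_pair x y"
proof -
  have *: "nielsen_pair u v" if "nielsen_pair (inv\<^bsub>F2\<^esub> u) v" "u \<in> carrier F2" for u v
    using invert[OF that(1)] that(2) by simp
  have **: "nielsen_pair u v" if "nielsen_pair u (inv\<^bsub>F2\<^esub> v)" "v \<in> carrier F2" for u v
    using swap[OF *[OF swap[OF that(1)] that(2)]] .
  have signs: "nielsen_pair u v"
    if "nielsen_pair (if s then u else inv\<^bsub>F2\<^esub> u) (if t then v else inv\<^bsub>F2\<^esub> v)"
      "u \<in> carrier F2" "v \<in> carrier F2" for u v s t
    using that(1) *[OF _ that(2)] **[OF _ that(3)] by (cases s; cases t) auto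
  show ?thesis
  proof (cases "fst l")
    case Gen_a
    then have "fst m = Gen_b" using assms(1) by (cases "fst m") auto
    then show ?thesis using signs[of "snd l" x "snd m" y] assms(2) xy Gen_a
      by (simp add: letter_value_def Let_def)
  next
    case Gen_b
    then have "fst m = Gen_a" using assms(1) by (cases "fst m") auto
    then show ?thesis using signs[of "snd l" y "snd m" x] assms(2) xy Gen_b
      by (intro swap[of y]) (simp add: letter_value_def Let_def)
  qed
qed

lemma generate_letter_values:
  assumes "fst l \<noteq> fst m"
  shows "{x, y} \<subseteq> generate F2 {letter_value x y l, letter_value x y m}"
proof -
  let ?S = "{letter_value x y l, letter_value x y m}"
  have "?S \<subseteq> generate F2 ?S" by (auto intro: generate.incl)
  moreover have "inv\<^bsub>F2\<^esub> letter_value x y l \<in> generate F2 ?S"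
    "inv\<^bsub>F2\<^esub> letter_value x y m \<in> generate F2 ?S"
    by (auto intro: generate.inv)
  ultimately show ?thesis
    using assms xy by (cases "fst l"; cases "fst m")
      (auto simp: letter_value_def split: if_splits)
qed

end

text \<open>
  The generators \<open>a\<close> and \<open>b\<close> are values of words in \<open>x\<close> and \<open>y\<close>. They have length one, so these
  words are single letters and \<open>x, y\<close> agree with \<open>a, b\<close> up to order and inverses.
\<close>

lemma letter_value_nielsen_reduced_base:
  assumes "nielsen_reduced (letter_value x y)"
    and xy: "x \<in> carrier F2" "y \<in> carrier F2" and gen: "generate F2 {x, y} = carrier F2"
  shows "nielsen_pair x y"
proof -
  interpret nielsen_reduced "letter_value x y" by fact
  define f where "f = case_gen2 x y"
  have "f g \<in> carrier F2" for g using xy by (cases g) (auto simp: f_def)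
  then obtain h where h: "h \<in> hom F2 F2" "\<And>g. h (free_gen g) = f g"
    using free_group_universal(1)[OF free_group_group, of f] by blast
  interpret h: group_hom F2 F2 h using h(1) by unfold_locales
  have letter: "h [l] = letter_value x y l" for l
  proof (cases l)
    case (Pair g s)
    have "h [(g, False)] = h (inv\<^bsub>F2\<^esub> (free_gen g))"
      by (subst inv_free_group) (auto simp: free_gen_def inv_letter_def reduced_Cons)
    then have "h [(g, False)] = inv\<^bsub>F2\<^esub> (f g)"
      using h(2) h.hom_inv[OF free_gen_closed] by simp
    then show ?thesis
      using Pair h(2)[of g] by (cases s; cases g) (auto simp: letter_value_def f_def free_gen_def)
  qed
  have val: "h w = val w" if "reduced w" for w
    using that
  proof (induction w)
    case Nil
    show ?case using h.hom_one by (simp add: val_def one_free_group)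
  next
    case (Cons l w)
    have "l # w = [l] \<cdot> w" using Cons.prems by (simp add: mult_reduced_append)
    then have "h (l # w) = h [l] \<cdot> h w"
      using Cons.prems h.hom_mult[of "[l]" w] unfolding carrier_free_group reduced_Cons by simp
    then show ?case using Cons letter by (simp add: val_def reduced_Cons)
  qed
  have "{x, y} \<subseteq> h ` carrier F2"
    using h(2)[of Gen_a] h(2)[of Gen_b] free_gen_closed by (force simp: f_def)
  then have surj: "carrier F2 \<subseteq> h ` carrier F2"
    using F2.generate_subgroup_incl[OF _ h.img_is_subgroup] gen by blast
  have ex: "\<exists>l. free_gen g = letter_value x y l" for g
  proof -
    obtain w where w: "reduced w" "free_gen g = val w"
      using surj free_gen_closed[of g] val by (force simp: carrier_free_group)
    then have "length (val w) = 1" by (simp add: free_gen_def flip: w(2))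
    then show ?thesis using val_single_letter[OF w(1)] w(2) by metis
  qed
  obtain l m where lm: "free_gen Gen_a = letter_value x y l" "free_gen Gen_b = letter_value x y m"
    using ex by metis
  have "fst l \<noteq> fst m"
  proof
    assume "fst l = fst m"
    then have "m = l \<or> m = inv_letter l" by (cases l; cases m) (auto simp: inv_letter_def)
    then have "free_gen Gen_b = free_gen Gen_a \<or> free_gen Gen_b = inv\<^bsub>F2\<^esub> free_gen Gen_a"
      using lm letter_value_inv_letter[OF xy] by metis
    then show False
      by (auto simp: free_gen_def inv_free_group reduced_Cons inv_letter_def)
  qed
  then show ?thesis
    using nielsen_pair_letter_values[OF xy] base lm by metis
qed

text \<open>
  Otherwise \<open>F2\<close> would be cyclic, but \<open>a\<close> and \<open>b\<close> do not commute.
\<close>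

lemma nielsen_generators_nontrivial:
  assumes "generate F2 {x, y} = carrier F2" "y \<in> carrier F2"
  shows "x \<noteq> []"
proof
  assume x: "x = []"
  have "generate F2 {x, y} \<subseteq> generate F2 {y}"
    using x generate.one[of F2 "{y}"] generate.incl[of y "{y}" F2] assms(2)
    by (intro F2.generate_subgroup_incl F2.generate_is_subgroup) (auto simp: one_free_group)
  then have sub: "carrier F2 \<subseteq> {y [^]\<^bsub>F2\<^esub> (k::int) |k. k \<in> UNIV}"
    using assms F2.generate_pow[OF assms(2)] by simp
  obtain i :: int where "free_gen Gen_a = y [^]\<^bsub>F2\<^esub> i"
    using subsetD[OF sub free_gen_closed[of Gen_a]] by auto
  moreover obtain j :: int where "free_gen Gen_b = y [^]\<^bsub>F2\<^esub> j"
    using subsetD[OF sub free_gen_closed[of Gen_b]] by auto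
  ultimately have "free_gen Gen_a \<cdot> free_gen Gen_b = free_gen Gen_b \<cdot> free_gen Gen_a"
    using assms(2) by (simp add: F2.int_pow_mult[symmetric] add.commute)
  then show False
    by (simp add: free_gen_def free_group_def inv_letter_def)
qed

lemma letter_of_other_generator:
  fixes l m n :: "gen2 letter"
  assumes "fst n \<noteq> fst m" "fst m \<noteq> fst l"
  shows "n = l \<or> n = inv_letter l"
proof -
  have "fst n = fst l" using assms by (metis gen2.exhaust)
  then show ?thesis by (cases l; cases n) (auto simp: inv_letter_def)
qed

text \<open>
  Nielsen reduction by induction on the total length. If two neighbours cancel more than half of one
  of them, then their product is shorter than the other factor and replaces it. The other way in which a
  pair can fail to be reduced is that a factor \<open>v = p q\<close> is cancelled completely, its halves by
  different neighbours. Both neighbours then come from the other generator, because a word cancels less than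
  half of itself. They are in fact the same word \<open>u = q\<^sup>-\<^sup>1 c p\<^sup>-\<^sup>1\<close>, and \<open>(v, v u)\<close> is conjugate to the
  shorter pair \<open>(q p, c)\<close>.
\<close>

theorem nielsen_pair_of_generators:
  assumes "x \<in> carrier F2" "y \<in> carrier F2" "generate F2 {x, y} = carrier F2"
  shows "nielsen_pair x y"
  using assms
proof (induction "length x + length y" arbitrary: x y rule: less_induct)
  case less
  note xy = less.prems(1,2)
  let ?e = "letter_value x y"
  have ecl: "?e l \<in> carrier F2" for l by (rule letter_value_closed[OF xy])
  have ered: "reduced (?e l)" for l using ecl[of l] by (simp add: carrier_free_group)
  have gen: "generate F2 {?e l, ?e m} = carrier F2" if "fst l \<noteq> fst m" for l m
    using F2.generate_eq_carrier_mono[OF less.prems(3) generate_letter_values[OF xy that]] ecl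
    by simp
  have nonempty: "?e l \<noteq> []" for l
    using nielsen_generators_nontrivial[OF gen[of l "(if fst l = Gen_a then Gen_b else Gen_a, True)"]] ecl
    by (cases "fst l") auto
  have other: "fst l \<noteq> fst m" if "m \<noteq> inv_letter l" "m \<noteq> l" for l m :: "gen2 letter"
    using that by (cases l; cases m) (auto simp: inv_letter_def)
  show ?case
  proof (cases "nielsen_reduced ?e")
    case True
    then show ?thesis by (rule letter_value_nielsen_reduced_base) (use less in auto)
  next
    case False
    show ?thesis
    proof (cases "\<forall>l m. m \<noteq> inv_letter l \<longrightarrow>
        2 * cancelled (?e l) (?e m) \<le> length (?e l) \<and> 2 * cancelled (?e l) (?e m) \<le> length (?e m)")
      case False
      then obtain l m where lm: "m \<noteq> inv_letter l" and
        long: "2 * cancelled (?e l) (?e m) > length (?e l) \<or> 2 * cancelled (?e l) (?e m) > length (?e m)"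
        by (auto simp: not_le)
      have "m \<noteq> l" using long cancelled_self[OF ered nonempty, of l] by auto
      then have fst: "fst l \<noteq> fst m" using other lm by blast
      define u v where "u = ?e l" and "v = ?e m"
      have uv: "u \<in> carrier F2" "v \<in> carrier F2" using ecl by (auto simp: u_def v_def)
      have np: "nielsen_pair x y" if "nielsen_pair u v"
        using nielsen_pair_letter_values[OF xy fst] that by (simp add: u_def v_def)
      have len: "length u + length v = length x + length y"
        using length_letter_values[OF xy fst] by (simp add: u_def v_def)
      have prod: "length (u \<cdot> v) + 2 * cancelled u v = length u + length v"
        using length_mult_cancelled[OF ered ered] by (simp add: u_def v_def)
      have guv: "generate F2 {u, v} = carrier F2" using gen[OF fst] by (simp add: u_def v_def)
      show ?thesis
      proof (cases "2 * cancelled u v > length u")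
        case True
        let ?w = "u \<cdot> v"
        have "inv\<^bsub>F2\<^esub> u \<cdot> ?w \<in> generate F2 {u, ?w}"
          by (intro generate.eng generate.inv generate.incl) auto
        then have "{u, v} \<subseteq> generate F2 {u, ?w}"
          using uv by (auto simp: F2.word_simps intro: generate.incl)
        then have "generate F2 {u, ?w} = carrier F2"
          using F2.generate_eq_carrier_mono[OF guv] uv by simp
        then have "nielsen_pair u ?w"
          using uv True prod len by (intro less.hyps) auto
        then show ?thesis using nielsen_pair_mult_left uv np by blast
      next
        case False
        let ?w = "u \<cdot> v"
        have "?w \<cdot> inv\<^bsub>F2\<^esub> v \<in> generate F2 {?w, v}"
          by (intro generate.eng generate.inv generate.incl) auto
        then have "{u, v} \<subseteq> generate F2 {?w, v}"
          using uv by (auto simp: F2.word_simps intro: generate.incl)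
        then have "generate F2 {?w, v} = carrier F2"
          using F2.generate_eq_carrier_mono[OF guv] uv by simp
        moreover have "2 * cancelled u v > length v" using False long by (simp add: u_def v_def)
        ultimately have "nielsen_pair ?w v"
          using uv prod len by (intro less.hyps) auto
        then show ?thesis using nielsen_pair_mult_right uv np by blast
      qed
    next
      case half: True
      then obtain l m n where lm: "m \<noteq> inv_letter l" and mn: "n \<noteq> inv_letter m" and
        mid: "cancelled (?e l) (?e m) + cancelled (?e m) (?e n) \<ge> length (?e m)"
        using False ered nonempty unfolding nielsen_reduced_def by (auto simp: not_less)
      have full: "2 * cancelled (?e l) (?e m) = length (?e m)"
        "2 * cancelled (?e m) (?e n) = length (?e m)"
        "length (?e m) \<le> length (?e l)"
        using half[rule_format, OF lm] half[rule_format, OF mn] mid by auto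
      have "m \<noteq> l" "n \<noteq> m"
        using full cancelled_self[OF ered nonempty, of m] by auto
      have fst: "fst m \<noteq> fst l" using other lm \<open>m \<noteq> l\<close> by metis
      have "fst n \<noteq> fst m" using other mn \<open>n \<noteq> m\<close> by metis
      then have nl: "n = l \<or> n = inv_letter l"
        using fst by (rule letter_of_other_generator)
      obtain u1 q1 r1 where 1: "?e l = u1 @ q1" "?e m = winv q1 @ r1"
        "length q1 = cancelled (?e l) (?e m)"
        using mult_cancelled[OF ered ered] by metis
      obtain p2 q r where 2: "?e m = p2 @ q" "?e n = winv q @ r"
        "length q = cancelled (?e m) (?e n)"
        using mult_cancelled[OF ered ered] by metis
      define p where "p = winv q1"
      have q1: "q1 = winv p" by (simp add: p_def)
      have len: "length p = length q" using full 1 2 by (simp add: p_def)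
      have "p2 = p" using 1 2 full len by (auto simp: p_def append_eq_append_conv)
      have v: "?e m = p @ q" using 2 \<open>p2 = p\<close> by simp
      have u: "?e l = u1 @ winv p" using 1 q1 by simp
      have "q \<noteq> []" using v len nonempty[of m] by auto
      have "n = l"
      proof (rule ccontr)
        assume "n \<noteq> l"
        then have "?e n = inv\<^bsub>F2\<^esub> ?e l" using nl letter_value_inv_letter[OF xy] by simp
        then have "winv q @ r = p @ winv u1"
          using 2 u ered[of l] by (simp add: inv_free_group)
        then have "p = winv q" using len by (simp add: append_eq_append_conv)
        then have "winv q @ winv (winv q) = ?e m" using v by simp
        then show False using reduced_append_winv[of "winv q"] ered[of m] \<open>q \<noteq> []\<close> by simp
      qed
      then have uq: "?e l = winv q @ r" using 2 by simp
      have "length (winv q) \<le> length u1"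
        using full(3) v len arg_cong[OF u, of length] by simp
      then have "take (length q) u1 = winv q"
        using arg_cong[OF trans[OF u[symmetric] uq], of "take (length q)"] by simp
      then obtain c where "u1 = winv q @ c" by (metis append_take_drop_id)
      then have uc: "?e l = winv q @ c @ winv p" using u by simp
      have red: "reduced p" "reduced q" "reduced c"
        using ered[of l] ered[of m] uc v by (auto simp: reduced_append)
      have cl: "p \<in> carrier F2" "q \<in> carrier F2" "c \<in> carrier F2"
        using red by (auto simp: carrier_free_group)
      have v': "?e m = p \<cdot> q" using v ered[of m] by (simp add: mult_reduced_append)
      have u': "?e l = inv\<^bsub>F2\<^esub> q \<cdot> (c \<cdot> inv\<^bsub>F2\<^esub> p)"
      proof -
        have "reduced (winv q @ c @ winv p)" using ered[of l] uc by simp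
        moreover from this have "reduced (c @ winv p)" by (subst (asm) reduced_append) simp
        ultimately show ?thesis using uc red by (simp add: inv_free_group mult_reduced_append)
      qed
      let ?v = "?e m" and ?w = "?e m \<cdot> ?e l"
      let ?q = "q \<cdot> p"
      have w: "?w = p \<cdot> c \<cdot> inv\<^bsub>F2\<^esub> p" using v' u' cl by (simp add: F2.word_simps)
      have v2: "?v = p \<cdot> ?q \<cdot> inv\<^bsub>F2\<^esub> p" using v' cl by (simp add: F2.word_simps)
      have "inv\<^bsub>F2\<^esub> ?v \<cdot> ?w \<in> generate F2 {?v, ?w}"
        by (intro generate.eng generate.inv generate.incl) auto
      then have "{?v, ?e l} \<subseteq> generate F2 {?v, ?w}"
        using ecl by (auto simp: F2.mult_inv_cancel intro: generate.incl)
      then have "generate F2 {?v, ?w} = carrier F2"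
        using F2.generate_eq_carrier_mono[OF gen[OF fst]] ecl by simp
      then have "generate F2 {inv\<^bsub>F2\<^esub> p \<cdot> ?v \<cdot> inv\<^bsub>F2\<^esub> (inv\<^bsub>F2\<^esub> p),
          inv\<^bsub>F2\<^esub> p \<cdot> ?w \<cdot> inv\<^bsub>F2\<^esub> (inv\<^bsub>F2\<^esub> p)} = carrier F2"
        using ecl cl by (intro F2.generate_conj) auto
      moreover have "inv\<^bsub>F2\<^esub> p \<cdot> ?w \<cdot> inv\<^bsub>F2\<^esub> (inv\<^bsub>F2\<^esub> p) = c"
        unfolding w using cl by (simp add: F2.word_simps)
      moreover have "inv\<^bsub>F2\<^esub> p \<cdot> ?v \<cdot> inv\<^bsub>F2\<^esub> (inv\<^bsub>F2\<^esub> p) = ?q"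
        unfolding v2 using cl by (simp add: F2.word_simps)
      ultimately have g: "generate F2 {?q, c} = carrier F2" by (simp only:)
      have "length ?q \<le> length (?e m)"
        using length_mult_cancelled[of q p] red v by simp
      moreover have "length c < length (?e l)" using uc \<open>q \<noteq> []\<close> by simp
      moreover have "length (?e m) + length (?e l) = length x + length y"
        by (rule length_letter_values[OF xy fst])
      ultimately have "nielsen_pair ?q c" using g cl by (intro less.hyps) auto
      then have "nielsen_pair (p \<cdot> ?q \<cdot> inv\<^bsub>F2\<^esub> p) (p \<cdot> c \<cdot> inv\<^bsub>F2\<^esub> p)"
        using cl by (intro conj)
      then have "nielsen_pair ?v ?w" by (simp only: w[symmetric] v2[symmetric])
      then have "nielsen_pair ?v (?e l)" using nielsen_pair_mult_left ecl by blast
      then show ?thesis by (rule nielsen_pair_letter_values[OF xy fst])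
    qed
  qed
qed


section \<open>Groups filtered with infinite cyclic factors\<close>

text \<open>
  The image of \<open>c i\<close> is a nontrivial subgroup of the integers, so the factors of the filtration are
  infinite cyclic.
\<close>

locale poly_Z = group G for G (structure) +
  fixes P :: "nat \<Rightarrow> 'a set" and c :: "nat \<Rightarrow> 'a \<Rightarrow> int" and n :: nat
  assumes P_0: "P 0 = {\<one>}"
    and P_n: "P n = carrier G"
    and subgroup_P: "i \<le> n \<Longrightarrow> subgroup (P i) G"
    and c_mult: "\<lbrakk>i < n; x \<in> P (Suc i); y \<in> P (Suc i)\<rbrakk> \<Longrightarrow> c i (x \<otimes> y) = c i x + c i y"
    and c_kernel: "i < n \<Longrightarrow> {x \<in> P (Suc i). c i x = 0} = P i"
    and c_nonzero: "i < n \<Longrightarrow> \<exists>x \<in> P (Suc i). c i x \<noteq> 0"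
begin

lemma P_Suc: "i < n \<Longrightarrow> P i \<subseteq> P (Suc i)"
  using c_kernel by blast

lemma P_mono: "\<lbrakk>i \<le> j; j \<le> n\<rbrakk> \<Longrightarrow> P i \<subseteq> P j"
proof (induction rule: dec_induct)
  case (step j)
  then show ?case using P_Suc[of j] by auto
qed simp

lemma c_hom: "i < n \<Longrightarrow> c i \<in> hom (G\<lparr>carrier := P (Suc i)\<rparr>) integer_group"
  by (simp add: hom_def c_mult)

lemma c_group_hom: "i < n \<Longrightarrow> group_hom (G\<lparr>carrier := P (Suc i)\<rparr>) integer_group (c i)"
  using c_hom subgroup_imp_group[OF subgroup_P[of "Suc i"]]
  by (simp add: group_hom_def group_hom_axioms_def)

lemma P_int_pow: "\<lbrakk>i \<le> n; x \<in> P i\<rbrakk> \<Longrightarrow> x [^] (k::int) \<in> P i"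
  using subgroup_int_pow_closed[OF subgroup_P] by blast

lemma c_int_pow:
  assumes "i < n" "x \<in> P (Suc i)"
  shows "c i (x [^] (k::int)) = k * c i x"
proof -
  interpret c: group_hom "G\<lparr>carrier := P (Suc i)\<rparr>" integer_group "c i"
    by (rule c_group_hom[OF assms(1)])
  have "c i (x [^]\<^bsub>G\<lparr>carrier := P (Suc i)\<rparr>\<^esub> k) = c i x [^]\<^bsub>integer_group\<^esub> k"
    using assms by (intro c.hom_int_pow) simp
  then show ?thesis
    using int_pow_consistent[OF subgroup_P[of "Suc i"]] assms by (simp add: mult.commute)
qed

lemma torsion_free: "torsion_free G"
proof -
  have "x = \<one>" if "i \<le> n" "x \<in> P i" "x [^] (k::nat) = \<one>" "k > 0" for i x k
    using that
  proof (induction i)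
    case (Suc i)
    have "c i (x [^] (int k)) = int k * c i x" using Suc.prems by (intro c_int_pow) auto
    moreover have "c i \<one> = 0" using c_kernel[of i] subgroup.one_closed[OF subgroup_P[of i]] Suc.prems by auto
    ultimately have "c i x = 0" using Suc.prems by (simp add: int_pow_int)
    then show ?case using Suc c_kernel[of i] by auto
  qed (simp add: P_0)
  from this[OF order_refl] show ?thesis unfolding torsion_free_def P_n by blast
qed

text \<open>
  The layers of the filtration that a subgroup meets nontrivially. Their number turns out to be the
  dimension of the subgroup.
\<close>

definition jumps :: "'a set \<Rightarrow> nat set"
  where "jumps H = {i. i < n \<and> (\<exists>x \<in> H \<inter> P (Suc i). c i x \<noteq> 0)}"

lemma finite_jumps: "finite (jumps H)"
  by (rule finite_subset[of _ "{..<n}"]) (auto simp: jumps_def)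

lemma jumps_carrier: "jumps (carrier G) = {..<n}"
proof -
  have "\<exists>x \<in> carrier G \<inter> P (Suc i). c i x \<noteq> 0" if "i < n" for i
    using c_nonzero[OF that] subgroup.subset[OF subgroup_P[of "Suc i"]] that by auto
  then show ?thesis by (auto simp: jumps_def)
qed

lemma jumps_one: "jumps {\<one>} = {}"
proof -
  have "c i \<one> = 0" if "i < n" for i
    using c_kernel[OF that] subgroup.one_closed[OF subgroup_P[of i]] that by auto
  then show ?thesis by (auto simp: jumps_def)
qed

context
  notes mult_FactGroup [simp del] and one_FactGroup [simp del]
  fixes H H'
  assumes H: "subgroup H G" and H': "subgroup H' G" and normal: "H' \<lhd> G\<lparr>carrier := H\<rparr>"
begin

abbreviation Q where "Q \<equiv> G\<lparr>carrier := H\<rparr> Mod H'"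
abbreviation coset where "coset \<equiv> \<lambda>x. H' #>\<^bsub>G\<lparr>carrier := H\<rparr>\<^esub> x"

lemma group_Q: "group Q"
  using normal by (rule normal.factorgroup_is_group)

lemma sub: "H' \<subseteq> H"
  using normal.axioms(1)[OF normal] subgroup.subset by fastforce

lemma coset_hom: "group_hom (G\<lparr>carrier := H\<rparr>) Q coset"
  using normal.r_coset_hom_Mod[OF normal] group_Q subgroup_imp_group[OF H]
  by (simp add: group_hom_def group_hom_axioms_def)

lemma coset_eq_one: "x \<in> H \<Longrightarrow> coset x = \<one>\<^bsub>Q\<^esub> \<longleftrightarrow> x \<in> H'"
proof -
  assume x: "x \<in> H"
  interpret HG: group "G\<lparr>carrier := H\<rparr>" by (rule subgroup_imp_group[OF H])
  have "subgroup H' (G\<lparr>carrier := H\<rparr>)" using normal by (rule normal.axioms(1))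
  then show ?thesis
    using HG.coset_join1[of H' x] HG.coset_join2[of x H'] x by (auto simp: one_FactGroup)
qed

lemma coset_int_pow: "x \<in> H \<Longrightarrow> coset (x [^] (k::int)) = coset x [^]\<^bsub>Q\<^esub> k"
  using group_hom.hom_int_pow[OF coset_hom, of x k] int_pow_consistent[OF H] by simp

lemma coset_mult: "\<lbrakk>x \<in> H; y \<in> H\<rbrakk> \<Longrightarrow> coset (x \<otimes> y) = coset x \<otimes>\<^bsub>Q\<^esub> coset y"
  using group_hom.hom_mult[OF coset_hom, of x y] by simp

lemma carrier_Q: "carrier Q = coset ` H"
  by (auto simp: FactGroup_def RCOSETS_def)

lemma H_int_pow: "x \<in> H \<Longrightarrow> x [^] (k::int) \<in> H"
  using subgroup_int_pow_closed[OF H] by blast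

lemma jumps_sub: "jumps H' \<subseteq> jumps H"
  using sub by (auto simp: jumps_def)

text \<open>
  If \<open>H'\<close> meets the same layers as \<open>H\<close>, then \<open>H/H'\<close> is a torsion group: an element \<open>x\<close> of layer \<open>i\<close>
  and an element \<open>y\<close> of \<open>H'\<close> in the same layer have powers with equal coordinate, so that a
  power of \<open>x\<close> agrees modulo \<open>H'\<close> with an element of a lower layer.
\<close>

lemma torsion_if_jumps_eq:
  assumes "jumps H' = jumps H" "i \<le> n" "x \<in> H \<inter> P i"
  shows "\<exists>k. k \<noteq> 0 \<and> coset x [^]\<^bsub>Q\<^esub> (k::int) = \<one>\<^bsub>Q\<^esub>"
  using assms(2,3)
proof (induction i arbitrary: x)
  case 0
  then have "coset x = \<one>\<^bsub>Q\<^esub>" using coset_eq_one subgroup.one_closed[OF H'] by (auto simp: P_0)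
  then show ?case using group.int_pow_one[OF group_Q] by (intro exI[of _ 1]) simp
next
  case (Suc i)
  interpret Q: group Q by (rule group_Q)
  have i: "i < n" using Suc.prems by simp
  have xQ: "coset x \<in> carrier Q" using Suc.prems carrier_Q by auto
  show ?case
  proof (cases "c i x = 0")
    case True
    then show ?thesis using Suc c_kernel[OF i] by auto
  next
    case False
    then have "i \<in> jumps H'" using assms(1) i Suc.prems by (auto simp: jumps_def)
    then obtain y where y: "y \<in> H'" "y \<in> P (Suc i)" "c i y \<noteq> 0" by (auto simp: jumps_def)
    define z where "z = x [^] c i y \<otimes> y [^] (- c i x)"
    have yH: "y \<in> H" using y sub by auto
    have z: "z \<in> H" "z \<in> P (Suc i)"
      using Suc.prems y yH H_int_pow P_int_pow[of "Suc i"] subgroup.m_closed[OF H]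
        subgroup.m_closed[OF subgroup_P[of "Suc i"]] by (auto simp: z_def)
    have "c i z = 0" unfolding z_def using Suc.prems y i
      by (subst c_mult) (auto simp: c_int_pow P_int_pow)
    then have "z \<in> H \<inter> P i" using z c_kernel[OF i] by auto
    then obtain k where k: "k \<noteq> 0" "coset z [^]\<^bsub>Q\<^esub> (k::int) = \<one>\<^bsub>Q\<^esub>"
      using Suc.IH i by force
    have "coset z = coset x [^]\<^bsub>Q\<^esub> c i y \<otimes>\<^bsub>Q\<^esub> coset y [^]\<^bsub>Q\<^esub> (- c i x)"
      unfolding z_def using Suc.prems
      by (simp only: coset_mult[OF H_int_pow H_int_pow[OF yH]] coset_int_pow yH Int_iff)
    also have "coset y = \<one>\<^bsub>Q\<^esub>" using coset_eq_one[OF yH] y by simp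
    finally have "coset z = coset x [^]\<^bsub>Q\<^esub> c i y" using xQ by (simp add: Q.int_pow_one)
    then have "coset x [^]\<^bsub>Q\<^esub> (c i y * k) = \<one>\<^bsub>Q\<^esub>" using k(2) xQ by (simp add: Q.int_pow_pow)
    then show ?thesis using k(1) y(3) by (intro exI[of _ "c i y * k"]) simp
  qed
qed

text \<open>
  If the cyclic group \<open>H/H'\<close> is finite, every element of \<open>H\<close> has a power in \<open>H'\<close> and the layers agree.
  If it is infinite, they cannot agree, for then \<open>H/H'\<close> would be torsion. They cannot differ in two
  places \<open>i < j\<close> either. Let \<open>x\<close> and \<open>y\<close> be elements of \<open>H\<close> in these layers, with cosets \<open>g\<^sup>m\<close> and \<open>g\<^sup>l\<close>. Then
  \<open>x\<^sup>l y\<^sup>-\<^sup>m\<close> belongs to \<open>H'\<close> and has coordinate \<open>- m c\<^sub>j y\<close>, so that \<open>m = 0\<close> because \<open>H'\<close> does not meet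
  layer \<open>j\<close>; but then \<open>x\<close> belongs to \<open>H'\<close>, which does not meet layer \<open>i\<close>.
\<close>

lemma card_jumps_step:
  assumes "cyclic_group Q"
  shows "card (jumps H) = card (jumps H') + (if infinite (carrier Q) then 1 else 0)"
proof -
  interpret Q: group Q by (rule group_Q)
  obtain g where g: "g \<in> carrier Q" "carrier Q = range (\<lambda>k::int. g [^]\<^bsub>Q\<^esub> k)"
    using assms Q.cyclic_group by blast
  show ?thesis
  proof (cases "finite (carrier Q)")
    case True
    have "i \<in> jumps H'" if "i \<in> jumps H" for i
    proof -
      from that obtain x where x: "i < n" "x \<in> H" "x \<in> P (Suc i)" "c i x \<noteq> 0"
        by (auto simp: jumps_def)
      define k where "k = int (order Q)"
      have k: "k > 0" using True Q.order_gt_0_iff_finite by (simp add: k_def)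
      have "coset x [^]\<^bsub>Q\<^esub> k = \<one>\<^bsub>Q\<^esub>"
        using Q.pow_order_eq_1[of "coset x"] x carrier_Q by (simp add: k_def int_pow_int)
      then have "x [^] k \<in> H'"
        using coset_eq_one[of "x [^] k"] coset_int_pow[of x k] x H_int_pow by simp
      moreover have "x [^] k \<in> P (Suc i)" using x P_int_pow by simp
      moreover have "c i (x [^] k) \<noteq> 0" using x k c_int_pow by simp
      ultimately show ?thesis using x(1) by (auto simp: jumps_def)
    qed
    then have "jumps H = jumps H'" using jumps_sub by blast
    then show ?thesis using True by simp
  next
    case False
    have "jumps H' \<noteq> jumps H"
    proof
      assume eq: "jumps H' = jumps H"
      obtain x where x: "x \<in> H" "g = coset x" using g(1) carrier_Q by auto
      have "x \<in> H \<inter> P n" using x P_n subgroup.subset[OF H] by auto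
      then obtain k :: int where k: "k \<noteq> 0" "g [^]\<^bsub>Q\<^esub> k = \<one>\<^bsub>Q\<^esub>"
        using torsion_if_jumps_eq[OF eq order_refl] x(2) by blast
      have "g [^]\<^bsub>Q\<^esub> m = g [^]\<^bsub>Q\<^esub> (m mod k)" for m
      proof -
        have "g [^]\<^bsub>Q\<^esub> m = g [^]\<^bsub>Q\<^esub> (k * (m div k) + m mod k)" by simp
        also have "\<dots> = (g [^]\<^bsub>Q\<^esub> k) [^]\<^bsub>Q\<^esub> (m div k) \<otimes>\<^bsub>Q\<^esub> g [^]\<^bsub>Q\<^esub> (m mod k)"
          using g(1) by (simp only: Q.int_pow_mult Q.int_pow_pow)
        finally show ?thesis using k(2) g(1) by (simp add: Q.int_pow_one)
      qed
      then have "carrier Q \<subseteq> (\<lambda>m. g [^]\<^bsub>Q\<^esub> m) ` {-\<bar>k\<bar>..\<bar>k\<bar>}"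
      proof -
        have "m mod k \<in> {-\<bar>k\<bar>..\<bar>k\<bar>}" for m
          using abs_mod_less[OF k(1), of m] by (auto simp: abs_less_iff)
        then show ?thesis unfolding g(2) using \<open>\<And>m. g [^]\<^bsub>Q\<^esub> m = g [^]\<^bsub>Q\<^esub> (m mod k)\<close> by blast
      qed
      then show False using False finite_subset by blast
    qed
    then obtain i where i: "i \<in> jumps H" "i \<notin> jumps H'" using jumps_sub by blast
    have less: False if ij: "i \<in> jumps H - jumps H'" "j \<in> jumps H - jumps H'" "i < j" for i j
    proof -
      obtain x where x: "i < n" "x \<in> H" "x \<in> P (Suc i)" "c i x \<noteq> 0"
        using ij by (auto simp: jumps_def)
      obtain y where y: "j < n" "y \<in> H" "y \<in> P (Suc j)" "c j y \<noteq> 0"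
        using ij by (auto simp: jumps_def)
      have "coset x \<in> carrier Q" "coset y \<in> carrier Q" using x y carrier_Q by auto
      then obtain l m :: int where lm: "coset x = g [^]\<^bsub>Q\<^esub> m" "coset y = g [^]\<^bsub>Q\<^esub> l"
        unfolding g(2) by auto
      define z where "z = x [^] l \<otimes> y [^] (- m)"
      have xj: "x \<in> P j" using x(3) P_mono[of "Suc i" j] ij(3) y(1) by auto
      then have xj': "x \<in> P (Suc j)" "c j x = 0" using c_kernel[OF y(1)] by auto
      have z: "z \<in> H" "z \<in> P (Suc j)"
        using x y xj' H_int_pow P_int_pow[of "Suc j"] subgroup.m_closed[OF H]
          subgroup.m_closed[OF subgroup_P[of "Suc j"]] by (auto simp: z_def)
      have "coset z = \<one>\<^bsub>Q\<^esub>"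
        unfolding z_def coset_mult[OF H_int_pow[OF x(2)] H_int_pow[OF y(2)]]
          coset_int_pow[OF x(2)] coset_int_pow[OF y(2)] lm
        using g(1) by (simp only: Q.int_pow_pow Q.int_pow_mult[symmetric]) (simp add: mult.commute)
      then have "z \<in> H'" using coset_eq_one z by simp
      then have "c j z = 0" using ij(2) z y(1) by (auto simp: jumps_def)
      moreover have "c j z = - m * c j y"
        unfolding z_def using xj' y by (subst c_mult) (auto simp: c_int_pow P_int_pow)
      ultimately have "m = 0" using y(4) by simp
      then have "coset x = \<one>\<^bsub>Q\<^esub>" using lm(1) by simp
      then have "x \<in> H'" using coset_eq_one x by simp
      then show False using x ij by (auto simp: jumps_def)
    qed
    have "j = i" if "j \<in> jumps H - jumps H'" for j
      using less[of i j] less[of j i] i that by (meson DiffI linorder_neqE_nat)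
    then have "jumps H = insert i (jumps H')" using i jumps_sub by blast
    then show ?thesis using i False finite_jumps by simp
  qed
qed

end

text \<open>
  Along a series of subgroups the number of layers drops from \<open>n\<close> to zero, by one at each infinite
  factor and not at all at the finite ones.
\<close>

lemma infinite_factors_eq:
  assumes "cyclic_series G Hs"
  shows "infinite_factors G Hs = n"
proof -
  define f where "f i \<longleftrightarrow> infinite (carrier (G\<lparr>carrier := Hs ! i\<rparr> Mod Hs ! Suc i))" for i
  have Hs: "Hs \<noteq> []" "hd Hs = carrier G" "last Hs = {\<one>}" "\<And>H. H \<in> set Hs \<Longrightarrow> subgroup H G"
    "\<And>i. Suc i < length Hs \<Longrightarrow> Hs ! Suc i \<lhd> G\<lparr>carrier := Hs ! i\<rparr> \<and>
       cyclic_group (G\<lparr>carrier := Hs ! i\<rparr> Mod Hs ! Suc i)"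
    using assms by (auto simp: cyclic_series_def)
  have "card {i. Suc i \<le> k \<and> f i} + card (jumps (Hs ! k)) = n" if "k < length Hs" for k
    using that
  proof (induction k)
    case 0
    then show ?case using Hs(1,2) jumps_carrier by (simp add: hd_conv_nth)
  next
    case (Suc k)
    have "card (jumps (Hs ! k)) = card (jumps (Hs ! Suc k)) + (if f k then 1 else 0)"
      unfolding f_def using Hs(4,5) Suc.prems by (intro card_jumps_step) auto
    moreover have "{i. Suc i \<le> Suc k \<and> f i} =
        (if f k then insert k {i. Suc i \<le> k \<and> f i} else {i. Suc i \<le> k \<and> f i})"
      by (auto simp: le_Suc_eq)
    moreover have "finite {i. Suc i \<le> k \<and> f i}" by (rule finite_subset[of _ "{..k}"]) auto
    ultimately show ?case using Suc by (auto split: if_splits)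
  qed
  from this[of "length Hs - 1"]
  have "card {i. Suc i \<le> length Hs - 1 \<and> f i} + card (jumps {\<one>}) = n"
    using Hs(1,3) by (simp add: last_conv_nth)
  moreover have "{i. Suc i \<le> length Hs - 1 \<and> f i} = {i. Suc i < length Hs \<and> f i}" by auto
  ultimately show ?thesis by (simp add: infinite_factors_def f_def jumps_one)
qed

text \<open>
  The factor is generated by the coset of an element whose coordinate is the least positive one.
\<close>

lemma cyclic_factor:
  notes mult_FactGroup [simp del] and one_FactGroup [simp del]
  assumes i: "i < n"
  shows "P i \<lhd> G\<lparr>carrier := P (Suc i)\<rparr>" "cyclic_group (G\<lparr>carrier := P (Suc i)\<rparr> Mod P i)"
proof -
  have "kernel (G\<lparr>carrier := P (Suc i)\<rparr>) integer_group (c i) = P i"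
    using c_kernel[OF i] by (simp add: kernel_def)
  then show N: "P i \<lhd> G\<lparr>carrier := P (Suc i)\<rparr>"
    using group_hom.normal_kernel[OF c_group_hom[OF i]] by simp
  note sub = subgroup_P[of "Suc i"] subgroup_P[of i]
  have le: "Suc i \<le> n" "i \<le> n" using i by auto
  note facts = sub(1)[OF le(1)] sub(2)[OF le(2)] N
  interpret S: subgroup "P (Suc i)" G by (rule facts(1))
  let ?Q = "G\<lparr>carrier := P (Suc i)\<rparr> Mod P i"
  interpret Q: group ?Q using N by (rule normal.factorgroup_is_group)
  obtain x0 where x0: "x0 \<in> P (Suc i)" "c i x0 \<noteq> 0" using c_nonzero[OF i] by blast
  have "\<exists>d. d > 0 \<and> (\<exists>x \<in> P (Suc i). c i x = int d)"
  proof (cases "c i x0 > 0")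
    case True
    then show ?thesis using x0 by (intro exI[of _ "nat (c i x0)"]) auto
  next
    case False
    then show ?thesis using x0 c_int_pow[OF i x0(1), of "-1"] P_int_pow[OF le(1) x0(1), of "-1"]
      by (intro exI[of _ "nat (- c i x0)"]) force
  qed
  define d where "d = (LEAST d. d > 0 \<and> (\<exists>x \<in> P (Suc i). c i x = int d))"
  have d: "d > 0" "\<exists>x \<in> P (Suc i). c i x = int d"
    using LeastI_ex[OF \<open>\<exists>d. d > 0 \<and> _ d\<close>] unfolding d_def by blast+
  have least: "d \<le> e" if "e > 0" "\<exists>x \<in> P (Suc i). c i x = int e" for e
    unfolding d_def using that by (intro Least_le) simp
  obtain x where x: "x \<in> P (Suc i)" "c i x = int d" using d by blast
  let ?f = "\<lambda>x. P i #>\<^bsub>G\<lparr>carrier := P (Suc i)\<rparr>\<^esub> x"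
  have fx: "?f x \<in> carrier ?Q" using x carrier_Q[OF facts] by auto
  have "Y \<in> range (\<lambda>k::int. ?f x [^]\<^bsub>?Q\<^esub> k)" if Y: "Y \<in> carrier ?Q" for Y
  proof -
    obtain y where y: "y \<in> P (Suc i)" "Y = ?f y" using Y carrier_Q[OF facts] by auto
    define k where "k = c i y div int d"
    define z where "z = y \<otimes> x [^] (- k)"
    have z: "z \<in> P (Suc i)" using x y P_int_pow[OF le(1)] by (simp add: z_def)
    have cz: "c i z = c i y mod int d"
      unfolding z_def using x y i P_int_pow[OF le(1)]
      by (simp add: c_mult c_int_pow k_def minus_div_mult_eq_mod)
    have "c i z = 0"
    proof (rule ccontr)
      assume nz: "c i z \<noteq> 0"
      have "0 \<le> c i z" "c i z < int d" using cz d(1) by simp_all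
      moreover from this have "d \<le> nat (c i z)" using nz z by (intro least) auto
      ultimately show False by linarith
    qed
    then have zP: "z \<in> P i" using z c_kernel[OF i] by auto
    have "y = z \<otimes> x [^] k"
      using x y by (simp add: z_def m_assoc flip: int_pow_mult)
    then have "?f y = ?f z \<otimes>\<^bsub>?Q\<^esub> ?f x [^]\<^bsub>?Q\<^esub> k"
      using coset_mult[OF facts z, of "x [^] k"] coset_int_pow[OF facts x(1)] P_int_pow[OF le(1) x(1)]
      by simp
    also have "?f z = \<one>\<^bsub>?Q\<^esub>" using coset_eq_one[OF facts z] zP by simp
    finally have "Y = ?f x [^]\<^bsub>?Q\<^esub> k"
      using y(2) Q.l_one[OF Q.int_pow_closed[OF fx]] by simp
    then show ?thesis by blast
  qed
  moreover have "range (\<lambda>k::int. ?f x [^]\<^bsub>?Q\<^esub> k) \<subseteq> carrier ?Q"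
    using Q.int_pow_closed[OF fx] by blast
  ultimately show "cyclic_group ?Q" using Q.cyclic_group fx by blast
qed

lemma has_dimension: "has_dimension G n"
proof -
  define Hs where "Hs = map P (rev [0..<Suc n])"
  have len: "length Hs = Suc n" by (simp add: Hs_def)
  have nth: "Hs ! i = P (n - i)" if "i \<le> n" for i
    using that by (simp add: Hs_def rev_nth del: upt_Suc)
  have "cyclic_series G Hs"
    unfolding cyclic_series_def
  proof (intro conjI allI impI)
    show "Hs \<noteq> []" using len by auto
    show "hd Hs = carrier G" using nth[of 0] P_n len by (simp add: hd_conv_nth \<open>Hs \<noteq> []\<close>)
    show "last Hs = {\<one>}" using nth[of n] P_0 len by (simp add: last_conv_nth \<open>Hs \<noteq> []\<close>)
    show "\<forall>H\<in>set Hs. subgroup H G" using subgroup_P by (auto simp: Hs_def)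
    fix i assume "Suc i < length Hs"
    then have "Suc (n - Suc i) = n - i" "n - Suc i < n" "Suc i \<le> n" using len by auto
    then show "Hs ! Suc i \<lhd> G\<lparr>carrier := Hs ! i\<rparr>"
      "cyclic_group (G\<lparr>carrier := Hs ! i\<rparr> Mod Hs ! Suc i)"
      using cyclic_factor[of "n - Suc i"] nth[of i] nth[of "Suc i"] by simp_all
  qed
  then show ?thesis unfolding has_dimension_def using infinite_factors_eq is_group by blast
qed

end


section \<open>Indices from transversals\<close>

definition (in group) right_transversal :: "'a set \<Rightarrow> 'a set \<Rightarrow> 'a set \<Rightarrow> bool"
  where "right_transversal N B T \<longleftrightarrow> T \<subseteq> B \<and> (\<forall>g \<in> B. \<exists>t \<in> T. g \<otimes> inv t \<in> N) \<and>
    (\<forall>s \<in> T. \<forall>t \<in> T. s \<otimes> inv t \<in> N \<longrightarrow> s = t)"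

lemma (in group) card_rcosets_right_transversal:
  assumes N: "subgroup N G" and T: "right_transversal N (carrier G) T"
  shows "card (rcosets N) = card T"
proof -
  interpret N: subgroup N G by fact
  have Tc: "T \<subseteq> carrier G" using T by (simp add: right_transversal_def)
  have eq: "N #> s = N #> t" if "s \<otimes> inv t \<in> N" "s \<in> carrier G" "t \<in> carrier G" for s t
  proof -
    have "s = (s \<otimes> inv t) \<otimes> t" using that by (simp add: m_assoc)
    then have "s \<in> N #> t" using that(1) by (auto simp: r_coset_def)
    then show ?thesis using repr_independence[OF _ that(3) N] by simp
  qed
  have "inj_on (\<lambda>t. N #> t) T"
  proof (rule inj_onI)
    fix s t assume st: "s \<in> T" "t \<in> T" "N #> s = N #> t"
    have sc: "s \<in> carrier G" "t \<in> carrier G" using st Tc by auto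
    then have "s \<in> N #> t" using st(3) rcos_self[OF _ N] by metis
    then obtain n where "n \<in> N" "s = n \<otimes> t" by (auto simp: r_coset_def)
    then have "s \<otimes> inv t \<in> N" using sc by (simp add: m_assoc)
    then show "s = t" using T st by (simp add: right_transversal_def)
  qed
  moreover have "(\<lambda>t. N #> t) ` T = rcosets N"
  proof
    show "(\<lambda>t. N #> t) ` T \<subseteq> rcosets N" using Tc by (auto simp: RCOSETS_def)
    show "rcosets N \<subseteq> (\<lambda>t. N #> t) ` T"
    proof
      fix X assume "X \<in> rcosets N"
      then obtain g where g: "g \<in> carrier G" "X = N #> g" by (auto simp: RCOSETS_def)
      then obtain t where "t \<in> T" "g \<otimes> inv t \<in> N" using T by (auto simp: right_transversal_def)
      then show "X \<in> (\<lambda>t. N #> t) ` T" using eq[of g t] g Tc by auto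
    qed
  qed
  ultimately show ?thesis using card_image by metis
qed

text \<open>
  Every element of \<open>B\<close> lies in \<open>N A r\<close> for some \<open>r\<close> in \<open>R\<close>, and \<open>r\<close> is determined by this. For \<open>N \<subseteq> A\<close>
  this is the multiplicativity of the index. In general \<open>N\<close> also meets \<open>B - A\<close>, and \<open>R\<close> only has to
  represent what \<open>N\<close> leaves over.
\<close>

lemma (in group) right_transversal_extend:
  assumes N: "subgroup N G" and B: "subgroup B G" and AB: "A \<subseteq> B"
    and T: "right_transversal N A T" and R: "R \<subseteq> B"
    and ex: "\<And>g. g \<in> B \<Longrightarrow> \<exists>n \<in> N. \<exists>r \<in> R. n \<otimes> g \<otimes> inv r \<in> A"
    and unique: "\<And>r s \<alpha> \<beta> n. \<lbrakk>r \<in> R; s \<in> R; \<alpha> \<in> A; \<beta> \<in> A; n \<in> N; \<alpha> \<otimes> r = n \<otimes> (\<beta> \<otimes> s)\<rbrakk> \<Longrightarrow> r = s"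
  shows "\<exists>T'. right_transversal N B T' \<and> card T' = card T * card R"
proof -
  interpret N: subgroup N G by fact
  interpret B: subgroup B G by fact
  have TA: "T \<subseteq> A" using T by (simp add: right_transversal_def)
  have Rc [simp]: "r \<in> carrier G" if "r \<in> R" for r using R that by auto
  have Tc [simp]: "t \<in> carrier G" if "t \<in> T" for t using TA AB that by auto
  define T' where "T' = (\<lambda>(t, r). t \<otimes> r) ` (T \<times> R)"
  have same: "t = t' \<and> r = r'"
    if h: "t \<in> T" "t' \<in> T" "r \<in> R" "r' \<in> R" "t \<otimes> r \<otimes> inv (t' \<otimes> r') \<in> N" for t t' r r'
  proof -
    define n where "n = t \<otimes> r \<otimes> inv (t' \<otimes> r')"
    have n: "n \<in> N" using h by (simp add: n_def)
    have eq: "t \<otimes> r = n \<otimes> (t' \<otimes> r')" unfolding n_def using h by (simp add: word_simps)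
    have r: "r = r'" using unique[OF h(3,4) _ _ n eq] TA h by blast
    have "t \<otimes> inv t' = n" unfolding n_def r using h by (simp add: word_simps)
    then have "t = t'" using T n h by (simp add: right_transversal_def)
    then show ?thesis using r by simp
  qed
  have "inj_on (\<lambda>(t, r). t \<otimes> r) (T \<times> R)"
  proof (rule inj_onI, clarify)
    fix t r t' r' assume h: "t \<in> T" "r \<in> R" "t' \<in> T" "r' \<in> R" "t \<otimes> r = t' \<otimes> r'"
    have "t \<otimes> r \<otimes> inv (t' \<otimes> r') = \<one>" unfolding h(5) using h by simp
    then show "t = t' \<and> r = r'" using same[of t t' r r'] h by simp
  qed
  then have "card T' = card T * card R" unfolding T'_def by (simp add: card_image card_cartesian_product)
  moreover have "right_transversal N B T'"
    unfolding right_transversal_def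
  proof (intro conjI ballI impI)
    show "T' \<subseteq> B" using TA AB R by (auto simp: T'_def)
    fix g assume g: "g \<in> B"
    then obtain n r where nr: "n \<in> N" "r \<in> R" "n \<otimes> g \<otimes> inv r \<in> A" using ex by blast
    then obtain t where t: "t \<in> T" "(n \<otimes> g \<otimes> inv r) \<otimes> inv t \<in> N"
      using T unfolding right_transversal_def by blast
    have "g \<otimes> inv (t \<otimes> r) = inv n \<otimes> (n \<otimes> g \<otimes> inv r \<otimes> inv t)"
      using g nr t by (simp add: word_simps)
    then have "g \<otimes> inv (t \<otimes> r) \<in> N" using nr t by simp
    then show "\<exists>t\<in>T'. g \<otimes> inv t \<in> N" using t nr unfolding T'_def by blast
  next
    fix s t assume st: "s \<in> T'" "t \<in> T'" "s \<otimes> inv t \<in> N"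
    obtain t1 r1 t2 r2 where *: "s = t1 \<otimes> r1" "t = t2 \<otimes> r2" "t1 \<in> T" "t2 \<in> T" "r1 \<in> R" "r2 \<in> R"
      using st(1,2) by (auto simp: T'_def)
    show "s = t" using same[OF *(3-6)] st(3) unfolding *(1,2) by simp
  qed
  ultimately show ?thesis by blast
qed

text \<open>
  The representatives are \<open>1, x, \<dots>, x\<^sup>h\<^sup>-\<^sup>1\<close>. Division with remainder of the coordinate by \<open>h d\<close> splits off
  a power of \<open>y\<close>, which lies in \<open>N\<close>.
\<close>

lemma (in group) right_transversal_extend_int:
  fixes c :: "'a \<Rightarrow> int" and h :: nat
  assumes N: "subgroup N G" and B: "subgroup B G"
    and T: "right_transversal N {g \<in> B. c g = 0} T"
    and c: "\<And>g g'. \<lbrakk>g \<in> B; g' \<in> B\<rbrakk> \<Longrightarrow> c (g \<otimes> g') = c g + c g'"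
    and x: "x \<in> B" "c x = d" "d > 0" and dvd: "\<And>g. g \<in> B \<Longrightarrow> d dvd c g"
    and y: "y \<in> N" "y \<in> B" "c y = int h * d" "h > 0"
    and dvd_N: "\<And>g. \<lbrakk>g \<in> N; g \<in> B\<rbrakk> \<Longrightarrow> int h * d dvd c g"
  shows "\<exists>T'. right_transversal N B T' \<and> card T' = card T * h"
proof -
  interpret B: subgroup B G by fact
  have Bc [simp]: "g \<in> carrier G" if "g \<in> B" for g using that by simp
  have pow_B: "g [^] (k::int) \<in> B" if "g \<in> B" for g k
    using subgroup_int_pow_closed[OF B that] .
  have "c \<in> hom (G\<lparr>carrier := B\<rparr>) integer_group" by (simp add: hom_def c)
  then interpret c: group_hom "G\<lparr>carrier := B\<rparr>" integer_group c
    using subgroup_imp_group[OF B] by (simp add: group_hom_def group_hom_axioms_def)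
  have c_pow: "c (g [^] (k::int)) = k * c g" if "g \<in> B" for g k
    using c.hom_int_pow[of g k] int_pow_consistent[OF B that] that by (simp add: mult.commute)
  have c_inv: "c (inv g) = - c g" if "g \<in> B" for g
    using c_pow[OF that, of "-1"] that by (simp add: int_pow_neg)
  define R where "R = (\<lambda>j. x [^] (int j)) ` {..<h}"
  have inj: "inj_on (\<lambda>j. x [^] (int j)) {..<h}"
  proof (rule inj_onI)
    fix i j assume "x [^] (int i) = x [^] (int j)"
    then have "c (x [^] (int i)) = c (x [^] (int j))" by simp
    then show "i = j" using x by (simp add: c_pow)
  qed
  have "\<exists>T'. right_transversal N B T' \<and> card T' = card T * card R"
  proof (rule right_transversal_extend[OF N B _ T])
    show "{g \<in> B. c g = 0} \<subseteq> B" by auto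
    show "R \<subseteq> B" using pow_B x by (auto simp: R_def)
    fix g assume g: "g \<in> B"
    obtain s where s: "c g = d * s" using dvd[OF g] by auto
    define e j where "e = s div int h" and "j = nat (s mod int h)"
    have j: "int j = s mod int h" "j < h" using y(4) by (simp_all add: j_def nat_less_iff)
    let ?n = "y [^] (- e)" and ?r = "x [^] (int j)"
    have n: "?n \<in> N" using subgroup_int_pow_closed[OF N y(1)] .
    have nB: "?n \<in> B" "?r \<in> B" using pow_B x y by auto
    have "c (?n \<otimes> g \<otimes> inv ?r) = - e * (int h * d) + d * s - int j * d"
      using nB g x y s by (simp add: c c_pow c_inv)
    also have "\<dots> = d * (s - (int h * e + s mod int h))" unfolding j(1) by (simp add: algebra_simps)
    also have "\<dots> = 0" by (simp add: e_def)
    finally have "?n \<otimes> g \<otimes> inv ?r \<in> {g \<in> B. c g = 0}" using nB g by simp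
    moreover have "?r \<in> R" using j(2) by (auto simp: R_def)
    ultimately show "\<exists>n\<in>N. \<exists>r\<in>R. n \<otimes> g \<otimes> inv r \<in> {g \<in> B. c g = 0}" using n by blast
  next
    fix r s \<alpha> \<beta> n
    assume rs: "r \<in> R" "s \<in> R" "\<alpha> \<in> {g \<in> B. c g = 0}" "\<beta> \<in> {g \<in> B. c g = 0}" "n \<in> N"
      and eq: "\<alpha> \<otimes> r = n \<otimes> (\<beta> \<otimes> s)"
    obtain i j where ij: "i < h" "j < h" "r = x [^] (int i)" "s = x [^] (int j)"
      using rs(1,2) by (auto simp: R_def)
    have rB: "r \<in> B" "s \<in> B" using ij pow_B x by auto
    have "n \<in> carrier G" using subgroup.mem_carrier[OF N rs(5)] .
    then have "n = \<alpha> \<otimes> r \<otimes> inv (\<beta> \<otimes> s)" unfolding eq using rs rB by (simp add: m_assoc)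
    then have nB: "n \<in> B" using rs rB by simp
    have "c (\<alpha> \<otimes> r) = c (n \<otimes> (\<beta> \<otimes> s))" by (simp only: eq)
    then have "c \<alpha> + c r = c n + (c \<beta> + c s)" using rs(3,4) rB nB by (simp add: c)
    then have "c n = (int i - int j) * d"
      using rs(3,4) ij x by (simp add: c_pow algebra_simps)
    then have "int h dvd int i - int j" using dvd_N[OF rs(5) nB] x(3) by simp
    then have "i = j" using ij(1,2) by (metis mod_eq_dvd_iff mod_less of_nat_eq_iff of_nat_mod)
    then show "r = s" using ij by simp
  qed
  then show ?thesis using inj by (simp add: R_def card_image)
qed


section \<open>A quaternionic Heisenberg group\<close>

datatype quat = Quat (qre: int) (qi: int) (qj: int) (qk: int)

text \<open>
  The quaternions with integer coordinates; \<open>qre\<close>, \<open>qi\<close>, \<open>qj\<close>, \<open>qk\<close> are the coordinates with respect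
  to \<open>1, i, j, k\<close>.
\<close>

instantiation quat :: ring_1
begin

definition "0 = Quat 0 0 0 0"
definition "1 = Quat 1 0 0 0"
definition "p + q = Quat (qre p + qre q) (qi p + qi q) (qj p + qj q) (qk p + qk q)"
definition "p - q = Quat (qre p - qre q) (qi p - qi q) (qj p - qj q) (qk p - qk q)"
definition "- q = Quat (- qre q) (- qi q) (- qj q) (- qk q)"
definition "p * q = Quat
  (qre p * qre q - qi p * qi q - qj p * qj q - qk p * qk q)
  (qre p * qi q + qi p * qre q + qj p * qk q - qk p * qj q)
  (qre p * qj q - qi p * qk q + qj p * qre q + qk p * qi q)
  (qre p * qk q + qi p * qj q - qj p * qi q + qk p * qre q)"

instance
  by standard
    (simp_all add: zero_quat_def one_quat_def plus_quat_def minus_quat_def uminus_quat_def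
      times_quat_def algebra_simps)

end

lemmas quat_defs = zero_quat_def one_quat_def plus_quat_def minus_quat_def uminus_quat_def
  times_quat_def

definition qconj :: "quat \<Rightarrow> quat"
  where "qconj q = Quat (qre q) (- qi q) (- qj q) (- qk q)"

definition qnorm :: "quat \<Rightarrow> int"
  where "qnorm q = (qre q)\<^sup>2 + (qi q)\<^sup>2 + (qj q)\<^sup>2 + (qk q)\<^sup>2"

text \<open>
  The \<open>i\<close>-component is the right one: if an arbitrary linear combination of the three imaginary
  components is allowed here, then the fourth powers of \<open>ab\<close>, \<open>ab\<^sup>-\<^sup>1\<close> and \<open>b\<close> are trivial in \<open>QH\<close> for
  \<open>a = (i, 0, 0)\<close> and \<open>b = (j, 1, c)\<close> if and only if \<open>c = 0\<close> and the other two components do not occur.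
\<close>

definition form :: "quat \<Rightarrow> quat \<Rightarrow> int"
  where "form u v = qi (qconj u * v)"

lemma form_eq: "form u v = qre u * qi v - qi u * qre v - qj u * qk v + qk u * qj v"
  by (simp add: form_def qconj_def times_quat_def)

lemma form_simps:
  "form (u + u') v = form u v + form u' v" "form u (v + v') = form u v + form u v'"
  "form (u - u') v = form u v - form u' v" "form u (v - v') = form u v - form u v'"
  "form (- u) v = - form u v" "form u (- v) = - form u v"
  "form 0 v = 0" "form u 0 = 0" "form u u = 0"
  by (simp_all add: form_eq quat_defs algebra_simps)

lemma form_swap: "form v u = - form u v"
  by (simp add: form_eq)

lemma form_mult_left: "form (q * u) (q * v) = qnorm q * form u v"
  by (simp add: form_eq qnorm_def times_quat_def power2_eq_square algebra_simps)

lemma qnorm_mult: "qnorm (p * q) = qnorm p * qnorm q"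
  by (simp add: qnorm_def times_quat_def power2_eq_square algebra_simps)

lemma qnorm_simps: "qnorm 1 = 1" "qnorm (qconj q) = qnorm q"
  by (simp_all add: qnorm_def qconj_def one_quat_def)

lemma qconj_mult: "qnorm q = 1 \<Longrightarrow> qconj q * q = 1" "qnorm q = 1 \<Longrightarrow> q * qconj q = 1"
  by (simp_all add: qnorm_def times_quat_def qconj_def one_quat_def power2_eq_square algebra_simps)

text \<open>
  The unit quaternions with integer coordinates are the quaternion group.
\<close>

lemma unit_quat_cases:
  assumes "qnorm q = 1"
  shows "q \<in> {Quat 1 0 0 0, Quat (-1) 0 0 0, Quat 0 1 0 0, Quat 0 (-1) 0 0,
    Quat 0 0 1 0, Quat 0 0 (-1) 0, Quat 0 0 0 1, Quat 0 0 0 (-1)}"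
proof -
  obtain a b c d where q: "q = Quat a b c d" by (cases q)
  have sum: "a\<^sup>2 + b\<^sup>2 + c\<^sup>2 + d\<^sup>2 = 1" using assms q by (simp add: qnorm_def)
  have small: "x = 0 \<or> x = 1 \<or> x = -1" if "x\<^sup>2 \<le> 1" for x :: int
  proof -
    have "\<bar>x\<bar> \<le> 1" using that by (simp add: abs_square_le_1)
    then show ?thesis by auto
  qed
  have "0 \<le> a\<^sup>2" "0 \<le> b\<^sup>2" "0 \<le> c\<^sup>2" "0 \<le> d\<^sup>2" by auto
  then have "a\<^sup>2 \<le> 1" "b\<^sup>2 \<le> 1" "c\<^sup>2 \<le> 1" "d\<^sup>2 \<le> 1" using sum by linarith+
  note this[THEN small]
  then show ?thesis using sum q by (elim disjE) simp_all
qed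

text \<open>
  Triples \<open>(q, v, c)\<close> of a unit, a translation and a central coordinate. The units act on the
  translations by left multiplication and trivially on the centre.
\<close>

definition QH :: "(quat \<times> quat \<times> int) monoid"
  where "QH = \<lparr>carrier = {(q, v, z). qnorm q = 1},
    monoid.mult = (\<lambda>(q, v, z) (q', v', z'). (q * q', v + q * v', z + z' + form v (q * v'))),
    one = (1, 0, 0)\<rparr>"

abbreviation QH_times (infixl "\<star>" 70)
  where "X \<star> Y \<equiv> X \<otimes>\<^bsub>QH\<^esub> Y"

lemma QH_carrier: "(q, v, z) \<in> carrier QH \<longleftrightarrow> qnorm q = 1"
  and QH_mult: "(q, v, z) \<star> (q', v', z') = (q * q', v + q * v', z + z' + form v (q * v'))"
  and QH_one: "\<one>\<^bsub>QH\<^esub> = (1, 0, 0)"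
  by (simp_all add: QH_def)

lemma QH_group: "group QH"
proof (rule groupI)
  fix X Y Z :: "quat \<times> quat \<times> int"
  assume X: "X \<in> carrier QH" and Y: "Y \<in> carrier QH"
  obtain q v z q' v' z' q'' v'' z''
    where *: "X = (q, v, z)" "Y = (q', v', z')" "Z = (q'', v'', z'')" by (metis prod_cases3)
  show "X \<star> Y \<in> carrier QH" using X Y by (simp add: * QH_mult QH_carrier qnorm_mult)
  show "X \<star> Y \<star> Z = X \<star> (Y \<star> Z)"
    using X by (simp add: * QH_mult QH_carrier form_simps form_mult_left mult.assoc distrib_left)
next
  fix X :: "quat \<times> quat \<times> int"
  assume X: "X \<in> carrier QH"
  obtain q v z where *: "X = (q, v, z)" by (metis prod_cases3)
  show "\<one>\<^bsub>QH\<^esub> \<star> X = X" by (simp add: * QH_mult QH_one form_simps)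
  have "(qconj q, - (qconj q * v), - z) \<star> X = \<one>\<^bsub>QH\<^esub>"
    using X by (simp add: * QH_mult QH_one QH_carrier form_simps form_mult_left qconj_mult)
  moreover have "(qconj q, - (qconj q * v), - z) \<in> carrier QH"
    using X by (simp add: * QH_carrier qnorm_simps)
  ultimately show "\<exists>Y\<in>carrier QH. Y \<star> X = \<one>\<^bsub>QH\<^esub>" by blast
qed (simp add: QH_one QH_carrier qnorm_simps)

interpretation QH: group QH by (rule QH_group)

lemma QH_inv:
  assumes "qnorm q = 1"
  shows "inv\<^bsub>QH\<^esub> (q, v, z) = (qconj q, - (qconj q * v), - z)"
  using assms by (intro QH.inv_equality)
    (simp_all add: QH_mult QH_one QH_carrier qnorm_simps form_simps form_mult_left qconj_mult)

lemma of_nat_quat: "of_nat n = Quat (int n) 0 0 0"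
  by (induction n) (simp_all add: quat_defs)

lemma QH_nat_pow:
  "(1, v, z) [^]\<^bsub>QH\<^esub> (n::nat) = (1, of_nat n * v, int n * z)"
  by (induction n)
    (simp_all add: QH_one QH_mult of_nat_quat form_eq quat_defs algebra_simps)

lemma qconj_one: "qconj 1 = 1"
  by (simp add: qconj_def one_quat_def)

lemma QH_inv_translation: "inv\<^bsub>QH\<^esub> (1, v, c) = (1, - v, - c)"
  by (simp add: QH_inv qnorm_simps qconj_one)

lemma of_int_quat: "of_int n = Quat n 0 0 0"
  by (cases n rule: int_cases2) (simp_all add: of_nat_quat quat_defs)

lemma QH_int_pow: "(1, v, z) [^]\<^bsub>QH\<^esub> (n::int) = (1, of_int n * v, n * z)"
proof (cases n rule: int_cases2)
  case (nonneg m)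
  then show ?thesis by (simp add: int_pow_int QH_nat_pow)
next
  case (nonpos m)
  then show ?thesis
    by (simp add: QH.int_pow_neg_int QH_carrier qnorm_simps QH_nat_pow QH_inv_translation)
qed


section \<open>Primitive elements act as quarter turns\<close>

text \<open>
  The unit of such an element acts on \<open>\<real>\<^sup>4\<close> by turning every vector through a right angle.
\<close>

definition quarter_turn :: "quat \<times> quat \<times> int \<Rightarrow> bool"
  where "quarter_turn X \<longleftrightarrow> X \<in> carrier QH \<and> fst X * fst X = -1 \<and> X [^]\<^bsub>QH\<^esub> (4::nat) = \<one>\<^bsub>QH\<^esub>"

text \<open>
  The square of \<open>(q, v, c)\<close> is \<open>(-1, v + q v, f)\<close> with \<open>f = 2 c + form v (q v)\<close>, and the
  square of this is \<open>(1, 0, 2 f)\<close>.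
\<close>

lemma quarter_turn_iff:
  "quarter_turn (q, v, z) \<longleftrightarrow> qnorm q = 1 \<and> q * q = -1 \<and> 2 * z + form v (q * v) = 0"
proof (cases "qnorm q = 1 \<and> q * q = -1")
  case True
  have sq: "(q, v, z) \<star> (q, v, z) = (-1, v + q * v, 2 * z + form v (q * v))"
    using True by (simp add: QH_mult)
  have "(q, v, z) [^]\<^bsub>QH\<^esub> (4::nat) =
      ((q, v, z) \<star> (q, v, z)) \<star> ((q, v, z) \<star> (q, v, z))"
    using True by (simp add: numeral_eq_Suc QH_carrier QH.m_assoc)
  also have "\<dots> = (1, 0, 2 * (2 * z + form v (q * v)))"
    unfolding sq by (simp add: QH_mult form_simps form_swap[of "q * v" v])
  finally have "quarter_turn (q, v, z) \<longleftrightarrow> 2 * (2 * z + form v (q * v)) = 0"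
    using True by (simp add: quarter_turn_def QH_carrier QH_one del: mult_eq_0_iff)
  moreover have "2 * (2 * z + form v (q * v)) = 0 \<longleftrightarrow> 2 * z + form v (q * v) = 0"
    by (simp only: mult_eq_0_iff) simp
  ultimately show ?thesis using True by blast
qed (auto simp: quarter_turn_def QH_carrier)

lemma quarter_turn_conj:
  assumes "quarter_turn X" "g \<in> carrier QH"
  shows "quarter_turn (g \<star> X \<star> inv\<^bsub>QH\<^esub> g)"
proof -
  obtain q v z p w y where *: "X = (q, v, z)" "g = (p, w, y)" by (metis prod_cases3)
  have p: "qnorm p = 1" and q: "q * q = -1" and X: "X \<in> carrier QH" "X [^]\<^bsub>QH\<^esub> (4::nat) = \<one>\<^bsub>QH\<^esub>"
    using assms by (auto simp: quarter_turn_def QH_carrier *)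
  have "p * q * qconj p * (p * q * qconj p) = p * (q * (qconj p * p) * q) * qconj p"
    by (simp add: mult.assoc)
  also have "\<dots> = -1" using p q by (simp add: qconj_mult)
  finally have "fst (g \<star> X \<star> inv\<^bsub>QH\<^esub> g) * fst (g \<star> X \<star> inv\<^bsub>QH\<^esub> g) = -1"
    using p by (simp add: * QH_inv QH_mult)
  moreover have "(g \<star> X \<star> inv\<^bsub>QH\<^esub> g) [^]\<^bsub>QH\<^esub> (4::nat) =
      g \<star> X [^]\<^bsub>QH\<^esub> (4::nat) \<star> inv\<^bsub>QH\<^esub> g"
    using X(1) assms(2)
    by (simp add: numeral_eq_Suc QH.m_assoc flip: QH.m_assoc[of "inv\<^bsub>QH\<^esub> g" g])
  ultimately show ?thesis using X assms(2) by (simp add: quarter_turn_def)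
qed

lemma quarter_turn_inv:
  assumes "quarter_turn X"
  shows "quarter_turn (inv\<^bsub>QH\<^esub> X)"
proof -
  obtain q v z where *: "X = (q, v, z)" by (metis prod_cases3)
  have q: "qnorm q = 1" "q * q = -1" "2 * z + form v (q * v) = 0"
    using assms by (auto simp: * quarter_turn_iff)
  have "q * - q = 1" using q(2) by simp
  moreover have "qconj q * (q * - q) = - q"
    using qconj_mult(1)[OF q(1)] by (simp only: mult.assoc[symmetric] mult_1_left)
  ultimately have "qconj q = - q" by simp
  then show ?thesis
    using q qnorm_simps(2)[of q]
    by (simp add: * QH_inv quarter_turn_iff form_simps form_swap[of "q * v" v]
        mult.assoc[symmetric])
qed

text \<open>
  Let \<open>f (q, v, c) = 2 c + form v (q v)\<close> be the obstruction in \<open>quarter_turn_iff\<close>. If the units of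
  \<open>X\<close> and \<open>Y\<close> anticommute, then \<open>f (X Y Y) = f (X Y) + f (X Y\<^sup>-\<^sup>1) - f X + 2 f Y\<close>. For each of the finitely
  many pairs of units this is an identity between quadratic polynomials.
\<close>

lemma quarter_turn_triple:
  assumes "quarter_turn X" "quarter_turn Y" "quarter_turn (X \<star> Y)"
    "quarter_turn (X \<star> inv\<^bsub>QH\<^esub> Y)"
  shows "quarter_turn (X \<star> Y \<star> Y)"
proof -
  obtain q v z p w y where *: "X = (q, v, z)" "Y = (p, w, y)" by (metis prod_cases3)
  have qp: "qnorm q = 1" "qnorm p = 1" using assms by (auto simp: * quarter_turn_iff)
  show ?thesis
    using unit_quat_cases[OF qp(1)] unit_quat_cases[OF qp(2)] assms
    unfolding *
    by (elim insertE emptyE)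
      (simp_all add: QH_inv QH_mult quarter_turn_iff qnorm_def qconj_def form_eq quat_defs
        algebra_simps)
qed

lemma F2_generated: "generate F2 {free_gen Gen_a, free_gen Gen_b} = carrier F2"
proof
  let ?S = "{free_gen Gen_a, free_gen Gen_b}"
  show "generate F2 ?S \<subseteq> carrier F2" using free_gen_closed by (intro F2.generate_incl) auto
  have gen: "free_gen g \<in> generate F2 ?S" for g by (cases g) (auto intro: generate.incl)
  have letter: "[l] \<in> generate F2 ?S" for l
  proof (cases l)
    case (Pair g s)
    have "inv\<^bsub>F2\<^esub> free_gen g \<in> generate F2 ?S"
      by (cases g) (auto intro: generate.inv)
    then have "[(g, False)] \<in> generate F2 ?S"
      by (simp add: inv_free_group free_gen_def reduced_Cons inv_letter_def)
    then show ?thesis using gen[of g] Pair by (cases s) (auto simp: free_gen_def)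
  qed
  have "w \<in> generate F2 ?S" if "reduced w" for w
    using that
  proof (induction w)
    case Nil
    show ?case using generate.one[of F2 ?S] by (simp add: one_free_group)
  next
    case (Cons l w)
    have "[l] \<cdot> w \<in> generate F2 ?S"
      using Cons letter by (intro generate.eng) (auto simp: reduced_Cons)
    then show ?case using Cons.prems by (simp add: mult_reduced_append)
  qed
  then show "carrier F2 \<subseteq> generate F2 ?S" by (auto simp: carrier_free_group)
qed

text \<open>
  The two members of a generating set have to be distinct, which holds because \<open>F2\<close> is not cyclic.
\<close>

lemma primitive_iff:
  "primitive x \<longleftrightarrow> (\<exists>y. x \<in> carrier F2 \<and> y \<in> carrier F2 \<and> generate F2 {x, y} = carrier F2)"
proof
  assume "primitive x"
  then obtain S where S: "S \<subseteq> carrier F2" "card S = 2" "generate F2 S = carrier F2" "x \<in> S"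
    by (auto simp: primitive_def)
  then obtain y where "S = {x, y}" unfolding card_2_iff by blast
  then show "\<exists>y. x \<in> carrier F2 \<and> y \<in> carrier F2 \<and> generate F2 {x, y} = carrier F2" using S by auto
next
  assume "\<exists>y. x \<in> carrier F2 \<and> y \<in> carrier F2 \<and> generate F2 {x, y} = carrier F2"
  then obtain y where y: "x \<in> carrier F2" "y \<in> carrier F2" "generate F2 {x, y} = carrier F2" by blast
  have "x \<noteq> y"
  proof
    assume "x = y"
    then have "generate F2 {[], x} = carrier F2"
      using F2.generate_eq_carrier_mono[OF y(3), of "{[], x}"] y F2.one_closed
      by (auto simp: one_free_group intro: generate.incl)
    then show False using nielsen_generators_nontrivial y(1) by blast
  qed
  then show "primitive x" unfolding primitive_def using y by (intro exI[of _ "{x, y}"]) auto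
qed

lemma six_primitives:
  defines "a \<equiv> free_gen Gen_a" and "b \<equiv> free_gen Gen_b"
  shows "primitive a" "primitive b" "primitive (a \<cdot> b)" "primitive (a \<cdot> inv\<^bsub>F2\<^esub> b)"
    "primitive (a \<cdot> a \<cdot> b)" "primitive (a \<cdot> b \<cdot> b)"
proof -
  have [simp]: "a \<in> carrier F2" "b \<in> carrier F2" by (simp_all add: a_def b_def free_gen_closed)
  have gen: "generate F2 {a, b} = carrier F2" unfolding a_def b_def by (rule F2_generated)
  have prim: "primitive x" if "x \<in> carrier F2" "y \<in> carrier F2" "{a, b} \<subseteq> generate F2 {x, y}" for x y
    unfolding primitive_iff using F2.generate_eq_carrier_mono[OF gen that(3)] that(1,2) by blast
  note i = generate.incl generate.inv generate.eng
  show "primitive a" by (rule prim[of _ b]) (auto intro: generate.incl)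
  show "primitive b" by (rule prim[of _ a]) (auto intro: generate.incl)
  have 1: "(a \<cdot> b) \<cdot> inv\<^bsub>F2\<^esub> b \<in> generate F2 {a \<cdot> b, b}"
    by (intro i) auto
  then show "primitive (a \<cdot> b)"
    by (intro prim[of _ b]) (auto simp: F2.word_simps intro: generate.incl)
  have 2: "(a \<cdot> inv\<^bsub>F2\<^esub> b) \<cdot> b \<in> generate F2 {a \<cdot> inv\<^bsub>F2\<^esub> b, b}"
    by (intro i) auto
  then show "primitive (a \<cdot> inv\<^bsub>F2\<^esub> b)"
    by (intro prim[of _ b]) (auto simp: F2.word_simps intro: generate.incl)
  have 3: "inv\<^bsub>F2\<^esub> a \<cdot> (inv\<^bsub>F2\<^esub> a \<cdot> (a \<cdot> a \<cdot> b)) \<in>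
      generate F2 {a \<cdot> a \<cdot> b, a}"
    by (intro i) auto
  then have "b \<in> generate F2 {a \<cdot> a \<cdot> b, a}" by (simp add: F2.word_simps)
  then show "primitive (a \<cdot> a \<cdot> b)"
    by (intro prim[of _ a]) (auto intro: generate.incl)
  have 4: "(a \<cdot> b \<cdot> b) \<cdot> inv\<^bsub>F2\<^esub> b \<cdot> inv\<^bsub>F2\<^esub> b \<in>
      generate F2 {a \<cdot> b \<cdot> b, b}"
    by (intro i) auto
  then have "a \<in> generate F2 {a \<cdot> b \<cdot> b, b}" by (simp add: F2.word_simps)
  then show "primitive (a \<cdot> b \<cdot> b)"
    by (intro prim[of _ b]) (auto intro: generate.incl)
qed

text \<open>
  The property that \<open>X\<close>, \<open>Y\<close>, \<open>X Y\<close> and \<open>X Y\<^sup>-\<^sup>1\<close> are quarter turns passes along the Nielsen moves. Up to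
  inverses and conjugation the only element that is new after a move is \<open>X Y Y\<close>.
\<close>

lemma quarter_turn_primitive:
  assumes h: "h \<in> hom F2 QH"
    and ha: "h (free_gen Gen_a) = (Quat 0 1 0 0, 0, 0)" and hb: "h (free_gen Gen_b) = (Quat 0 0 1 0, 1, 0)"
    and x: "primitive x"
  shows "quarter_turn (h x)"
proof -
  interpret h: group_hom F2 QH h using h by unfold_locales
  obtain y where y: "x \<in> carrier F2" "y \<in> carrier F2" "generate F2 {x, y} = carrier F2"
    using x by (auto simp: primitive_iff)
  have cl: "x \<in> carrier F2 \<and> y \<in> carrier F2" if "nielsen_pair x y" for x y
    using that by induction (auto simp: free_gen_closed)
  have "quarter_turn (h x) \<and> quarter_turn (h y) \<and> quarter_turn (h x \<star> h y) \<and>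
    quarter_turn (h x \<star> inv\<^bsub>QH\<^esub> h y)"
    using nielsen_pair_of_generators[OF y]
  proof induction
    case base
    show ?case
      by (simp add: ha hb quarter_turn_iff QH_mult QH_inv qnorm_def qconj_def form_eq quat_defs)
  next
    case (swap x y)
    note [simp] = cl[OF swap.hyps, THEN conjunct1] cl[OF swap.hyps, THEN conjunct2]
    have "h y \<star> h x = h y \<star> (h x \<star> h y) \<star> inv\<^bsub>QH\<^esub> h y"
      by (simp add: QH.m_assoc)
    moreover have "h y \<star> inv\<^bsub>QH\<^esub> h x = inv\<^bsub>QH\<^esub> (h x \<star> inv\<^bsub>QH\<^esub> h y)"
      by (simp add: QH.inv_mult_group)
    ultimately show ?case using swap.IH quarter_turn_conj quarter_turn_inv by simp
  next
    case (invert x y)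
    note [simp] = cl[OF invert.hyps, THEN conjunct1] cl[OF invert.hyps, THEN conjunct2]
    have "inv\<^bsub>QH\<^esub> h x \<star> h y =
        inv\<^bsub>QH\<^esub> (inv\<^bsub>QH\<^esub> h y \<star> (h x \<star> inv\<^bsub>QH\<^esub> h y) \<star> inv\<^bsub>QH\<^esub> (inv\<^bsub>QH\<^esub> h y))"
      by (simp add: QH.word_simps)
    moreover have "inv\<^bsub>QH\<^esub> h x \<star> inv\<^bsub>QH\<^esub> h y =
        inv\<^bsub>QH\<^esub> (h y \<star> (h x \<star> h y) \<star> inv\<^bsub>QH\<^esub> h y)"
      by (simp add: QH.word_simps)
    moreover have "quarter_turn (inv\<^bsub>QH\<^esub> (inv\<^bsub>QH\<^esub> h y \<star> (h x \<star> inv\<^bsub>QH\<^esub> h y) \<star> inv\<^bsub>QH\<^esub> (inv\<^bsub>QH\<^esub> h y)))"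
      "quarter_turn (inv\<^bsub>QH\<^esub> (h y \<star> (h x \<star> h y) \<star> inv\<^bsub>QH\<^esub> h y))"
      "quarter_turn (inv\<^bsub>QH\<^esub> h x)"
      using invert.IH by (intro quarter_turn_inv quarter_turn_conj; simp)+
    ultimately show ?case using invert.IH by simp
  next
    case (mult x y)
    note [simp] = cl[OF mult.hyps, THEN conjunct1] cl[OF mult.hyps, THEN conjunct2]
    have "h x \<star> h y \<star> inv\<^bsub>QH\<^esub> h y = h x" by (simp add: QH.m_assoc)
    then show ?case using mult.IH quarter_turn_triple[of "h x" "h y"] by simp
  next
    case (conj x y g)
    note [simp] = cl[OF conj.hyps(1), THEN conjunct1] cl[OF conj.hyps(1), THEN conjunct2] conj.hyps(2)
    let ?c = "\<lambda>X. h g \<star> X \<star> inv\<^bsub>QH\<^esub> h g"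
    have "?c (h x) \<star> ?c (h y) = ?c (h x \<star> h y)"
      "?c (h x) \<star> inv\<^bsub>QH\<^esub> ?c (h y) = ?c (h x \<star> inv\<^bsub>QH\<^esub> h y)"
      by (simp_all add: QH.word_simps)
    moreover have "quarter_turn (?c (h x))" "quarter_turn (?c (h y))"
      "quarter_turn (?c (h x \<star> h y))" "quarter_turn (?c (h x \<star> inv\<^bsub>QH\<^esub> h y))"
      using conj.IH by (auto intro: quarter_turn_conj)
    ultimately show ?case by simp
  qed
  then show ?thesis by blast
qed


section \<open>Consequences of six fourth powers\<close>

text \<open>
  The relations come from the six relators below. Together they amount to the following elements
  commuting: \<open>x\<close> with \<open>y\<close>; \<open>u\<close> with \<open>x y\<close>; \<open>y\<close> with \<open>w u\<close> and \<open>u w\<close>; \<open>w\<close> with \<open>x u\<close> and \<open>u x\<close>; and to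
  \<open>[x, u] = [w, u]\<close>. Call this last commutator \<open>t\<close>. It commutes with \<open>w\<close> as a quotient of \<open>x u\<close>
  and \<open>u x\<close>, and with \<open>y\<close> as a quotient of \<open>w u\<close> and \<open>u w\<close>. Conjugating \<open>t\<close> by \<open>y\<close>, which acts on \<open>u\<close> as
  \<open>x\<^sup>-\<^sup>1\<close> does, shows that it commutes with \<open>x\<close>, and comparing the conjugates of \<open>w u\<close> and \<open>u w\<close> by \<open>y\<close>
  that it commutes with \<open>u\<close>.
\<close>

lemma (in group) commutator_calculus:
  assumes [simp]: "x \<in> carrier G" "y \<in> carrier G" "u \<in> carrier G" "w \<in> carrier G"
    and 1: "inv y \<otimes> inv x \<otimes> y \<otimes> x = \<one>"
    and 2: "x \<otimes> y \<otimes> inv u \<otimes> inv x \<otimes> inv y \<otimes> u = \<one>"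
    and 3: "inv u \<otimes> inv w \<otimes> x \<otimes> u \<otimes> inv y \<otimes> inv x \<otimes> y \<otimes> w = \<one>"
    and 4: "w \<otimes> inv x \<otimes> y \<otimes> inv u \<otimes> inv w \<otimes> x \<otimes> u \<otimes> inv y = \<one>"
    and 5: "x \<otimes> y \<otimes> inv u \<otimes> inv x \<otimes> w \<otimes> inv x \<otimes> inv w \<otimes> x \<otimes> u \<otimes> inv y = \<one>"
    and 6: "y \<otimes> inv u \<otimes> inv w \<otimes> inv y \<otimes> w \<otimes> u = \<one>"
    and 7: "u \<otimes> w \<otimes> y \<otimes> inv u \<otimes> inv x \<otimes> inv u \<otimes> inv w \<otimes> x \<otimes> u \<otimes> inv y = \<one>"
    and t: "t = x \<otimes> u \<otimes> inv x \<otimes> inv u"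
  shows "t \<otimes> x = x \<otimes> t" "t \<otimes> y = y \<otimes> t" "t \<otimes> u = u \<otimes> t" "t \<otimes> w = w \<otimes> t"
    and "y \<otimes> x = x \<otimes> y" "u \<otimes> x = x \<otimes> u \<otimes> inv t" "w \<otimes> x = x \<otimes> w \<otimes> inv t"
    and "u \<otimes> y = y \<otimes> u \<otimes> t" "w \<otimes> y = y \<otimes> w \<otimes> inv t" "w \<otimes> u = u \<otimes> w \<otimes> t"
proof -
  have [simp]: "t \<in> carrier G" by (simp add: t)
  have comm_of_inv: "g \<otimes> h = h \<otimes> g"
    if "g \<otimes> inv h = inv h \<otimes> g" "g \<in> carrier G" "h \<in> carrier G" for g h
    using commute_inv[of "inv h" g] that by simp
  have yx: "y \<otimes> x = x \<otimes> y"
  proof -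
    have "y \<otimes> x = x \<otimes> y \<otimes> (inv y \<otimes> inv x \<otimes> y \<otimes> x)" by (simp add: word_simps)
    then show ?thesis unfolding 1 by simp
  qed
  have yX: "inv x \<otimes> y = y \<otimes> inv x" by (rule commute_inv) (simp_all add: yx)
  have Yx: "inv y \<otimes> x = x \<otimes> inv y" by (rule commute_inv) (simp_all add: yx)
  have uxy: "x \<otimes> y \<otimes> u = u \<otimes> (x \<otimes> y)"
  proof (rule comm_of_inv)
    have "x \<otimes> y \<otimes> inv u =
        (x \<otimes> y \<otimes> inv u \<otimes> inv x \<otimes> inv y \<otimes> u) \<otimes> (inv u \<otimes> (y \<otimes> x))"
      by (simp add: word_simps)
    then show "x \<otimes> y \<otimes> inv u = inv u \<otimes> (x \<otimes> y)" unfolding 2 yx by simp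
  qed simp_all
  have y_WU: "y \<otimes> inv (w \<otimes> u) = inv (w \<otimes> u) \<otimes> y"
  proof -
    have "y \<otimes> inv (w \<otimes> u) =
        (y \<otimes> inv u \<otimes> inv w \<otimes> inv y \<otimes> w \<otimes> u) \<otimes> (inv (w \<otimes> u) \<otimes> y)"
      by (simp add: word_simps)
    then show ?thesis unfolding 6 by simp
  qed
  then have y_wu: "y \<otimes> (w \<otimes> u) = w \<otimes> u \<otimes> y" by (rule comm_of_inv) simp_all
  have wu: "x \<otimes> u \<otimes> inv x \<otimes> w = w \<otimes> u"
  proof -
    have "w \<otimes> u = w \<otimes> u \<otimes>
        (inv u \<otimes> inv w \<otimes> x \<otimes> u \<otimes> inv y \<otimes> inv x \<otimes> y \<otimes> w)"
      unfolding 3 by simp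
    also have "\<dots> = x \<otimes> u \<otimes> inv y \<otimes> (inv x \<otimes> y) \<otimes> w" by (simp add: word_simps)
    also have "\<dots> = x \<otimes> u \<otimes> inv x \<otimes> w" unfolding yX by (simp add: word_simps)
    finally show ?thesis by simp
  qed
  have w_ux: "w \<otimes> (u \<otimes> x) = u \<otimes> x \<otimes> w"
  proof (rule comm_of_inv)
    have "\<one> = w \<otimes> inv x \<otimes> (y \<otimes> inv (w \<otimes> u)) \<otimes> x \<otimes> u \<otimes> inv y"
      using 4 by (simp add: word_simps)
    also have "\<dots> = w \<otimes> inv x \<otimes> inv (w \<otimes> u) \<otimes> (y \<otimes> x \<otimes> u) \<otimes> inv y"
      unfolding y_WU by (simp add: m_assoc)
    also have "\<dots> = w \<otimes> inv (u \<otimes> x) \<otimes> inv w \<otimes> (u \<otimes> x)"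
      unfolding yx uxy by (simp add: word_simps)
    finally have *: "w \<otimes> inv (u \<otimes> x) \<otimes> inv w \<otimes> (u \<otimes> x) = \<one>" by simp
    have "w \<otimes> inv (u \<otimes> x) = (w \<otimes> inv (u \<otimes> x) \<otimes> inv w \<otimes> (u \<otimes> x)) \<otimes> (inv (u \<otimes> x) \<otimes> w)"
      by (simp add: word_simps)
    then show "w \<otimes> inv (u \<otimes> x) = inv (u \<otimes> x) \<otimes> w" unfolding * by simp
  qed simp_all
  have w_xu: "w \<otimes> (x \<otimes> u) = x \<otimes> u \<otimes> w"
  proof (rule comm_of_inv)
    have xUX: "x \<otimes> inv u \<otimes> inv x = w \<otimes> inv u \<otimes> inv w"
    proof -
      have "inv (x \<otimes> u \<otimes> inv x \<otimes> w \<otimes> inv w) = inv (w \<otimes> u \<otimes> inv w)"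
        unfolding wu by simp
      then show ?thesis by (simp add: word_simps)
    qed
    have "\<one> = inv y \<otimes> (x \<otimes> y \<otimes> inv u \<otimes> inv x \<otimes> w \<otimes> inv x \<otimes> inv w \<otimes> x \<otimes> u \<otimes> inv y) \<otimes> y"
      unfolding 5 by simp
    also have "\<dots> = (inv y \<otimes> x) \<otimes> y \<otimes> inv u \<otimes> inv x \<otimes> w \<otimes> inv x \<otimes> inv w \<otimes> x \<otimes> u"
      by (simp add: word_simps)
    also have "\<dots> = (x \<otimes> inv u \<otimes> inv x) \<otimes> w \<otimes> inv x \<otimes> inv w \<otimes> x \<otimes> u"
      unfolding Yx by (simp add: word_simps)
    also have "\<dots> = w \<otimes> inv (x \<otimes> u) \<otimes> inv w \<otimes> (x \<otimes> u)"
      unfolding xUX by (simp add: word_simps)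
    finally have *: "w \<otimes> inv (x \<otimes> u) \<otimes> inv w \<otimes> (x \<otimes> u) = \<one>" by simp
    have "w \<otimes> inv (x \<otimes> u) = (w \<otimes> inv (x \<otimes> u) \<otimes> inv w \<otimes> (x \<otimes> u)) \<otimes> (inv (x \<otimes> u) \<otimes> w)"
      by (simp add: word_simps)
    then show "w \<otimes> inv (x \<otimes> u) = inv (x \<otimes> u) \<otimes> w" unfolding * by simp
  qed simp_all
  have y_UW: "y \<otimes> inv (u \<otimes> w) = inv (u \<otimes> w) \<otimes> y"
  proof -
    have "inv (w \<otimes> u) \<otimes> (x \<otimes> u) = inv w \<otimes> x"
      unfolding wu[symmetric] by (simp add: word_simps)
    then have "u \<otimes> w \<otimes> y \<otimes> inv u \<otimes> inv x \<otimes> (inv w \<otimes> x) \<otimes> inv y = \<one>"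
      using 7 by (simp add: word_simps)
    then have "\<one> = u \<otimes> w \<otimes> y \<otimes> inv (w \<otimes> (x \<otimes> u)) \<otimes> x \<otimes> inv y" by (simp add: word_simps)
    also have "\<dots> = u \<otimes> w \<otimes> y \<otimes> inv (u \<otimes> w) \<otimes> inv y"
      unfolding w_xu by (simp add: word_simps)
    finally have *: "u \<otimes> w \<otimes> y \<otimes> inv (u \<otimes> w) \<otimes> inv y = \<one>" by simp
    have "y \<otimes> inv (u \<otimes> w) = inv (u \<otimes> w) \<otimes> (u \<otimes> w \<otimes> y \<otimes> inv (u \<otimes> w) \<otimes> inv y) \<otimes> y"
      by (simp add: word_simps)
    then show ?thesis unfolding * by simp
  qed
  then have y_uw: "y \<otimes> (u \<otimes> w) = u \<otimes> w \<otimes> y" by (rule comm_of_inv) simp_all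
  have t_wu: "t = (w \<otimes> u) \<otimes> inv (u \<otimes> w)"
    unfolding t wu[symmetric] by (simp add: word_simps)
  have t_xu: "t = (x \<otimes> u) \<otimes> inv (u \<otimes> x)" unfolding t by (simp add: word_simps)
  show ty: "t \<otimes> y = y \<otimes> t"
  proof -
    have "y \<otimes> t = (y \<otimes> (w \<otimes> u)) \<otimes> inv (u \<otimes> w)" unfolding t_wu by (simp add: m_assoc)
    also have "\<dots> = (w \<otimes> u) \<otimes> (y \<otimes> inv (u \<otimes> w))" unfolding y_wu by (simp add: m_assoc)
    also have "\<dots> = t \<otimes> y" unfolding y_UW t_wu by (simp add: m_assoc)
    finally show ?thesis by simp
  qed
  show tw: "t \<otimes> w = w \<otimes> t"
  proof -
    have W: "inv (u \<otimes> x) \<otimes> w = w \<otimes> inv (u \<otimes> x)" by (rule commute_inv) (simp_all add: w_ux)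
    have "w \<otimes> t = (w \<otimes> (x \<otimes> u)) \<otimes> inv (u \<otimes> x)" unfolding t_xu by (simp add: m_assoc)
    also have "\<dots> = (x \<otimes> u) \<otimes> (w \<otimes> inv (u \<otimes> x))" unfolding w_xu by (simp add: m_assoc)
    also have "\<dots> = t \<otimes> w" unfolding W[symmetric] t_xu by (simp add: m_assoc)
    finally show ?thesis by simp
  qed
  have xu: "x \<otimes> u = t \<otimes> (u \<otimes> x)" unfolding t by (simp add: word_simps)
  have wu': "w \<otimes> u = t \<otimes> (u \<otimes> w)" unfolding t_wu by (simp add: word_simps)
  have yu: "y \<otimes> u = inv x \<otimes> u \<otimes> x \<otimes> y"
  proof -
    have "y \<otimes> u = inv x \<otimes> (x \<otimes> y \<otimes> u)" by (simp add: word_simps)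
    then show ?thesis unfolding uxy by (simp add: m_assoc)
  qed
  have yU: "y \<otimes> inv u = inv x \<otimes> inv u \<otimes> x \<otimes> y"
  proof -
    have "inv x \<otimes> inv u \<otimes> x \<otimes> y = inv x \<otimes> inv u \<otimes> x \<otimes> (y \<otimes> u) \<otimes> inv u"
      by (simp add: word_simps)
    then show ?thesis unfolding yu by (simp add: word_simps)
  qed
  have t_eq: "t = u \<otimes> inv x \<otimes> inv u \<otimes> x"
  proof -
    have "t \<otimes> y = y \<otimes> t" by (rule ty)
    also have "\<dots> = (y \<otimes> x) \<otimes> u \<otimes> inv x \<otimes> inv u" unfolding t by (simp add: m_assoc)
    also have "\<dots> = x \<otimes> (y \<otimes> u) \<otimes> inv x \<otimes> inv u" unfolding yx by (simp add: m_assoc)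
    also have "\<dots> = u \<otimes> x \<otimes> (y \<otimes> inv x) \<otimes> inv u" unfolding yu by (simp add: word_simps)
    also have "\<dots> = u \<otimes> (y \<otimes> inv u)" unfolding yX[symmetric] by (simp add: word_simps)
    also have "\<dots> = u \<otimes> inv x \<otimes> inv u \<otimes> x \<otimes> y" unfolding yU by (simp add: m_assoc)
    finally show ?thesis by simp
  qed
  show tx: "t \<otimes> x = x \<otimes> t"
  proof -
    have "x \<otimes> t = (x \<otimes> u \<otimes> inv x \<otimes> inv u) \<otimes> x" unfolding t_eq by (simp add: m_assoc)
    then show ?thesis unfolding t[symmetric] by simp
  qed
  have Tx: "inv t \<otimes> x = x \<otimes> inv t" by (rule commute_inv) (simp_all add: tx)
  have Tw: "inv t \<otimes> w = w \<otimes> inv t" by (rule commute_inv) (simp_all add: tw)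
  have uy: "u \<otimes> y = t \<otimes> (y \<otimes> u)"
  proof -
    have "t \<otimes> (y \<otimes> u) = (t \<otimes> inv x) \<otimes> u \<otimes> x \<otimes> y" unfolding yu by (simp add: m_assoc)
    also have "t \<otimes> inv x = inv x \<otimes> t" by (rule commute_inv[symmetric]) (simp_all add: tx)
    also have "inv x \<otimes> t \<otimes> u \<otimes> x \<otimes> y = inv x \<otimes> (t \<otimes> (u \<otimes> x)) \<otimes> y" by (simp add: m_assoc)
    also have "\<dots> = u \<otimes> y" unfolding xu[symmetric] by (simp add: word_simps)
    finally show ?thesis by simp
  qed
  have yw: "y \<otimes> w = w \<otimes> t \<otimes> y"
  proof -
    have "y \<otimes> w \<otimes> u = w \<otimes> (u \<otimes> y)" using y_wu by (simp add: m_assoc)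
    also have "\<dots> = w \<otimes> t \<otimes> y \<otimes> u" unfolding uy by (simp add: m_assoc)
    finally show ?thesis by simp
  qed
  show tu: "t \<otimes> u = u \<otimes> t"
  proof -
    have "t \<otimes> u \<otimes> w \<otimes> y = t \<otimes> (y \<otimes> u) \<otimes> w" using y_uw by (simp add: m_assoc)
    also have "\<dots> = u \<otimes> (y \<otimes> w)" unfolding uy[symmetric] by (simp add: m_assoc)
    also have "\<dots> = u \<otimes> t \<otimes> w \<otimes> y" unfolding yw by (simp add: m_assoc tw)
    finally show ?thesis by simp
  qed
  have Tu: "inv t \<otimes> u = u \<otimes> inv t" by (rule commute_inv) (simp_all add: tu)
  show "y \<otimes> x = x \<otimes> y" by (rule yx)
  show "u \<otimes> x = x \<otimes> u \<otimes> inv t"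
  proof -
    have "u \<otimes> x = inv t \<otimes> (x \<otimes> u)" unfolding xu by (simp add: word_simps)
    also have "\<dots> = x \<otimes> (inv t \<otimes> u)" using Tx by (simp flip: m_assoc)
    finally show ?thesis unfolding Tu by (simp add: m_assoc)
  qed
  show "w \<otimes> x = x \<otimes> w \<otimes> inv t"
  proof -
    have "w \<otimes> x \<otimes> u = x \<otimes> (u \<otimes> w)" using w_xu by (simp add: m_assoc)
    also have "\<dots> = x \<otimes> (inv t \<otimes> (w \<otimes> u))" unfolding wu' by (simp add: word_simps)
    also have "\<dots> = x \<otimes> (inv t \<otimes> w) \<otimes> u" by (simp add: m_assoc)
    also have "\<dots> = x \<otimes> w \<otimes> inv t \<otimes> u" unfolding Tw by (simp add: m_assoc)
    finally show ?thesis by simp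
  qed
  show "u \<otimes> y = y \<otimes> u \<otimes> t"
  proof -
    have "u \<otimes> y = (t \<otimes> y) \<otimes> u" unfolding uy by (simp add: m_assoc)
    then show ?thesis unfolding ty by (simp add: m_assoc tu)
  qed
  show "w \<otimes> y = y \<otimes> w \<otimes> inv t"
  proof -
    have "y \<otimes> w = w \<otimes> (t \<otimes> y)" unfolding yw by (simp add: m_assoc)
    also have "\<dots> = w \<otimes> y \<otimes> t" unfolding ty by (simp add: m_assoc)
    finally show ?thesis by (simp add: word_simps)
  qed
  show "w \<otimes> u = u \<otimes> w \<otimes> t"
  proof -
    have "w \<otimes> u = (t \<otimes> u) \<otimes> w" unfolding wu' by (simp add: m_assoc)
    then show ?thesis unfolding tu by (simp add: m_assoc tw)
  qed
qed

text \<open>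
  Six of the relators of \<open>F2/P4\<close>. They belong to the slopes \<open>0, \<infinity>, 1, -1, 1/2, 2\<close>
  of simple closed curves on the punctured torus, one from each class modulo four.
\<close>

locale quarter_power_group = group G for G (structure) +
  fixes a b
  assumes a [simp]: "a \<in> carrier G" and b [simp]: "b \<in> carrier G"
    and generated: "generate G {a, b} = carrier G"
    and pow_a: "a [^] (4::nat) = \<one>" and pow_b: "b [^] (4::nat) = \<one>"
    and pow_ab: "(a \<otimes> b) [^] (4::nat) = \<one>"
    and pow_aB: "(a \<otimes> inv b) [^] (4::nat) = \<one>"
    and pow_aab: "(a \<otimes> a \<otimes> b) [^] (4::nat) = \<one>"
    and pow_abb: "(a \<otimes> b \<otimes> b) [^] (4::nat) = \<one>"
begin

text \<open>
  Schreier generators of the kernel of the map onto the quaternion group with \<open>a \<mapsto> i\<close> and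
  \<open>b \<mapsto> j\<close>, for the transversal \<open>r0, \<dots>, r7\<close> below. The remaining Schreier generators are expressed by
  these four in \<open>table_a\<close> and \<open>table_b\<close>.
\<close>

definition "x1 = a \<otimes> a \<otimes> b \<otimes> b"
definition "x2 = inv a \<otimes> b \<otimes> b \<otimes> inv a"
definition "x3 = b \<otimes> a \<otimes> b \<otimes> inv a"
definition "x4 = a \<otimes> b \<otimes> a \<otimes> inv b"
definition "x5 = x1 \<otimes> x3 \<otimes> inv x1 \<otimes> inv x3"

lemma closed [simp]: "x1 \<in> carrier G" "x2 \<in> carrier G" "x3 \<in> carrier G" "x4 \<in> carrier G" "x5 \<in> carrier G"
  by (simp_all add: x1_def x2_def x3_def x4_def x5_def)

lemma pow_4: "g \<in> carrier G \<Longrightarrow> g [^] (4::nat) = g \<otimes> g \<otimes> g \<otimes> g"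
  by (simp add: numeral_eq_Suc m_assoc)

lemma inv_squares:
  "inv a \<otimes> inv a = a \<otimes> a" "inv b \<otimes> inv b = b \<otimes> b"
proof -
  have "inv g \<otimes> inv g = g \<otimes> g" if "g \<in> carrier G" "g [^] (4::nat) = \<one>" for g
  proof -
    have "inv (g \<otimes> g) = g \<otimes> g"
      using that by (intro inv_equality) (simp_all add: pow_4 m_assoc)
    then show ?thesis using that by (simp add: inv_mult_group)
  qed
  then show "inv a \<otimes> inv a = a \<otimes> a" "inv b \<otimes> inv b = b \<otimes> b"
    using pow_a pow_b by simp_all
qed

lemma cubes: "a \<otimes> (a \<otimes> a) = inv a" "b \<otimes> (b \<otimes> b) = inv b"
  using pow_a pow_b by (intro inv_equality[symmetric]; simp add: pow_4 m_assoc)+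

lemma inv_squares_assoc:
  "g \<in> carrier G \<Longrightarrow> inv a \<otimes> (inv a \<otimes> g) = a \<otimes> (a \<otimes> g)"
  "g \<in> carrier G \<Longrightarrow> inv b \<otimes> (inv b \<otimes> g) = b \<otimes> (b \<otimes> g)"
  using inv_squares by (simp_all flip: m_assoc)

definition "r0 = \<one>"
definition "r1 = a"
definition "r2 = a \<otimes> a"
definition "r3 = inv a"
definition "r4 = b"
definition "r5 = inv b"
definition "r6 = a \<otimes> b"
definition "r7 = a \<otimes> inv b"

lemmas rep_defs = r0_def r1_def r2_def r3_def r4_def r5_def r6_def r7_def

lemma rep_closed [simp]:
  "r0 \<in> carrier G" "r1 \<in> carrier G" "r2 \<in> carrier G" "r3 \<in> carrier G"
  "r4 \<in> carrier G" "r5 \<in> carrier G" "r6 \<in> carrier G" "r7 \<in> carrier G"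
  by (simp_all add: rep_defs)

text \<open>
  The entries for \<open>r5\<close> and \<open>r7\<close> are the relator \<open>(ab\<^sup>-\<^sup>1)\<^sup>4\<close> read from different cosets, after
  simplification by \<open>a\<^sup>4\<close> and \<open>b\<^sup>4\<close>; the others are definitions of the \<open>xi\<close> or follow from \<open>a\<^sup>4 = 1\<close>.
\<close>

lemma table_a:
  "r0 \<otimes> a = r1" "r1 \<otimes> a = r2" "r2 \<otimes> a = r3" "r3 \<otimes> a = r0"
  "r4 \<otimes> a = x3 \<otimes> r7" "r5 \<otimes> a = x2 \<otimes> inv x3 \<otimes> inv x1 \<otimes> r6" "r6 \<otimes> a = x4 \<otimes> r4"
  "r7 \<otimes> a = inv x3 \<otimes> inv x4 \<otimes> x1 \<otimes> x3 \<otimes> inv x2 \<otimes> r5"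
proof -
  show "r0 \<otimes> a = r1" "r1 \<otimes> a = r2" "r3 \<otimes> a = r0" "r4 \<otimes> a = x3 \<otimes> r7" "r6 \<otimes> a = x4 \<otimes> r4"
    by (simp_all add: rep_defs x3_def x4_def word_simps)
  show "r2 \<otimes> a = r3" using cubes by (simp add: rep_defs m_assoc)
  have 1: "(inv a \<otimes> b) \<otimes> (inv a \<otimes> b) \<otimes> (inv a \<otimes> b) = inv b \<otimes> a"
  proof -
    have "inv ((a \<otimes> inv b) \<otimes> (a \<otimes> inv b) \<otimes> (a \<otimes> inv b) \<otimes> (a \<otimes> inv b)) = \<one>"
      using pow_aB by (simp add: pow_4)
    then have *: "b \<otimes> ((inv a \<otimes> b) \<otimes> (inv a \<otimes> b) \<otimes> (inv a \<otimes> b)) \<otimes> inv a = \<one>"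
      by (simp add: word_simps)
    have "(inv a \<otimes> b) \<otimes> (inv a \<otimes> b) \<otimes> (inv a \<otimes> b) =
        inv b \<otimes> (b \<otimes> ((inv a \<otimes> b) \<otimes> (inv a \<otimes> b) \<otimes> (inv a \<otimes> b)) \<otimes> inv a) \<otimes> a"
      by (simp add: word_simps)
    then show ?thesis unfolding * by simp
  qed
  have bbb: "inv b \<otimes> (inv b \<otimes> (inv b \<otimes> g)) = b \<otimes> g" if "g \<in> carrier G" for g
    using that by (simp add: inv_squares_assoc mult_inv_cancel)
  have "x2 \<otimes> inv x3 \<otimes> inv x1 \<otimes> r6 = (inv a \<otimes> b) \<otimes> (inv a \<otimes> b) \<otimes> (inv a \<otimes> b)"
    by (simp add: rep_defs x1_def x2_def x3_def word_simps bbb)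
  then show "r5 \<otimes> a = x2 \<otimes> inv x3 \<otimes> inv x1 \<otimes> r6" using 1 by (simp add: rep_defs)
  have 2: "inv b \<otimes> a \<otimes> inv b \<otimes> a \<otimes> inv b \<otimes> a \<otimes> inv b = inv a"
  proof -
    have "a \<otimes> (inv b \<otimes> a \<otimes> inv b \<otimes> a \<otimes> inv b \<otimes> a \<otimes> inv b) = \<one>"
      using pow_aB by (simp add: pow_4 m_assoc)
    then show ?thesis by (intro inv_equality[symmetric] inv_comm[of a]) simp_all
  qed
  have "inv x3 \<otimes> inv x4 \<otimes> x1 \<otimes> x3 \<otimes> inv x2 \<otimes> r5 =
      a \<otimes> inv b \<otimes> inv a \<otimes> inv a \<otimes> (inv b \<otimes> a \<otimes> (b \<otimes> b \<otimes> b) \<otimes> a \<otimes> inv b \<otimes> a \<otimes> inv b)"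
    by (simp add: rep_defs x1_def x2_def x3_def x4_def word_simps)
  also have "b \<otimes> b \<otimes> b = inv b" using cubes by (simp add: m_assoc)
  also have "inv b \<otimes> a \<otimes> inv b \<otimes> a \<otimes> inv b \<otimes> a \<otimes> inv b = inv a" by (rule 2)
  finally show "r7 \<otimes> a = inv x3 \<otimes> inv x4 \<otimes> x1 \<otimes> x3 \<otimes> inv x2 \<otimes> r5"
    by (simp add: rep_defs m_assoc inv_squares_assoc inv_squares word_simps)
qed

lemma table_b:
  "r0 \<otimes> b = r4" "r1 \<otimes> b = r6" "r2 \<otimes> b = x1 \<otimes> r5" "r3 \<otimes> b = x2 \<otimes> r7"
  "r4 \<otimes> b = inv x1 \<otimes> r2" "r5 \<otimes> b = r0" "r6 \<otimes> b = inv x2 \<otimes> r3" "r7 \<otimes> b = r1"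
  by (simp_all add: rep_defs x1_def x2_def word_simps inv_squares inv_squares_assoc cubes)

text \<open>
  In this form the table rewrites a product that is nested to the left from its inner end, so that
  the simplifier carries a coset representative through a relator and collects the word in the
  \<open>xi\<close> that it picks up.
\<close>

lemma table_assoc:
  assumes "k \<in> carrier G"
  shows "k \<otimes> r0 \<otimes> a = k \<otimes> r1" "k \<otimes> r1 \<otimes> a = k \<otimes> r2" "k \<otimes> r2 \<otimes> a = k \<otimes> r3"
    "k \<otimes> r3 \<otimes> a = k \<otimes> r0" "k \<otimes> r4 \<otimes> a = k \<otimes> x3 \<otimes> r7"
    "k \<otimes> r5 \<otimes> a = k \<otimes> x2 \<otimes> inv x3 \<otimes> inv x1 \<otimes> r6" "k \<otimes> r6 \<otimes> a = k \<otimes> x4 \<otimes> r4"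
    "k \<otimes> r7 \<otimes> a = k \<otimes> inv x3 \<otimes> inv x4 \<otimes> x1 \<otimes> x3 \<otimes> inv x2 \<otimes> r5"
    "k \<otimes> r0 \<otimes> b = k \<otimes> r4" "k \<otimes> r1 \<otimes> b = k \<otimes> r6" "k \<otimes> r2 \<otimes> b = k \<otimes> x1 \<otimes> r5"
    "k \<otimes> r3 \<otimes> b = k \<otimes> x2 \<otimes> r7" "k \<otimes> r4 \<otimes> b = k \<otimes> inv x1 \<otimes> r2" "k \<otimes> r5 \<otimes> b = k \<otimes> r0"
    "k \<otimes> r6 \<otimes> b = k \<otimes> inv x2 \<otimes> r3" "k \<otimes> r7 \<otimes> b = k \<otimes> r1"
  using assms by (simp_all add: m_assoc table_a table_b)

text \<open>
  In the last relator \<open>b\<^sup>-\<^sup>1\<close> is written as \<open>b b b\<close>, since the table has entries for \<open>a\<close> and \<open>b\<close> only.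
\<close>

lemma lift_relators:
  assumes "r \<in> carrier G"
  shows "r \<otimes> a \<otimes> b \<otimes> a \<otimes> b \<otimes> a \<otimes> b \<otimes> a \<otimes> b = r"
    "r \<otimes> a \<otimes> a \<otimes> b \<otimes> a \<otimes> a \<otimes> b \<otimes> a \<otimes> a \<otimes> b \<otimes> a \<otimes> a \<otimes> b = r"
    "r \<otimes> a \<otimes> b \<otimes> b \<otimes> a \<otimes> b \<otimes> b \<otimes> a \<otimes> b \<otimes> b \<otimes> a \<otimes> b \<otimes> b = r"
    "r \<otimes> a \<otimes> b \<otimes> b \<otimes> b \<otimes> a \<otimes> b \<otimes> b \<otimes> b \<otimes> a \<otimes> b \<otimes> b \<otimes> b \<otimes> a \<otimes> b \<otimes> b \<otimes> b = r"
proof -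
  have "r \<otimes> (a \<otimes> b) [^] (4::nat) = r" "r \<otimes> (a \<otimes> a \<otimes> b) [^] (4::nat) = r"
    "r \<otimes> (a \<otimes> b \<otimes> b) [^] (4::nat) = r" "r \<otimes> (a \<otimes> (b \<otimes> (b \<otimes> b))) [^] (4::nat) = r"
    using assms unfolding cubes by (simp_all add: pow_ab pow_aab pow_abb pow_aB)
  from this[unfolded pow_4[OF m_closed[OF a b]] pow_4[OF m_closed[OF m_closed[OF a a] b]]
    pow_4[OF m_closed[OF m_closed[OF a b] b]] pow_4[OF m_closed[OF a m_closed[OF b m_closed[OF b b]]]]]
  show "r \<otimes> a \<otimes> b \<otimes> a \<otimes> b \<otimes> a \<otimes> b \<otimes> a \<otimes> b = r"
    "r \<otimes> a \<otimes> a \<otimes> b \<otimes> a \<otimes> a \<otimes> b \<otimes> a \<otimes> a \<otimes> b \<otimes> a \<otimes> a \<otimes> b = r"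
    "r \<otimes> a \<otimes> b \<otimes> b \<otimes> a \<otimes> b \<otimes> b \<otimes> a \<otimes> b \<otimes> b \<otimes> a \<otimes> b \<otimes> b = r"
    "r \<otimes> a \<otimes> b \<otimes> b \<otimes> b \<otimes> a \<otimes> b \<otimes> b \<otimes> b \<otimes> a \<otimes> b \<otimes> b \<otimes> b \<otimes> a \<otimes> b \<otimes> b \<otimes> b = r"
    using assms by (simp_all add: m_assoc)
qed

text \<open>
  Each of these relations is what a relator contributes when it is read from one of the cosets.
\<close>

lemma relation_1: "inv x2 \<otimes> inv x1 \<otimes> x2 \<otimes> x1 = \<one>"
  using lift_relators(3)[of r0]
  by ((simp add: table_a table_b table_assoc), (simp add: word_simps)?)

lemma relation_2: "x1 \<otimes> x2 \<otimes> inv x3 \<otimes> inv x1 \<otimes> inv x2 \<otimes> x3 = \<one>"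
  using lift_relators(1)[of r1]
  by ((simp add: table_a table_b table_assoc), (simp add: word_simps)?)

lemma relation_3: "inv x3 \<otimes> inv x4 \<otimes> x1 \<otimes> x3 \<otimes> inv x2 \<otimes> inv x1 \<otimes> x2 \<otimes> x4 = \<one>"
  using lift_relators(4)[of r0]
  by ((simp add: table_a table_b table_assoc), (simp add: word_simps)?)

lemma relation_4: "x4 \<otimes> inv x1 \<otimes> x2 \<otimes> inv x3 \<otimes> inv x4 \<otimes> x1 \<otimes> x3 \<otimes> inv x2 = \<one>"
  using lift_relators(1)[of r0]
  by ((simp add: table_a table_b table_assoc), (simp add: word_simps)?)

lemma relation_5: "x1 \<otimes> x2 \<otimes> inv x3 \<otimes> inv x1 \<otimes> x4 \<otimes> inv x1 \<otimes> inv x4 \<otimes> x1 \<otimes> x3 \<otimes> inv x2 = \<one>"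
  using lift_relators(2)[of r0]
  by ((simp add: table_a table_b table_assoc), (simp add: word_simps)?)

lemma relation_6: "x2 \<otimes> inv x3 \<otimes> inv x4 \<otimes> inv x2 \<otimes> x4 \<otimes> x3 = \<one>"
  using lift_relators(2)[of r1]
  by ((simp add: table_a table_b table_assoc), (simp add: word_simps)?)

lemma relation_7: "x3 \<otimes> x4 \<otimes> x2 \<otimes> inv x3 \<otimes> inv x1 \<otimes> inv x3 \<otimes> inv x4 \<otimes> x1 \<otimes> x3 \<otimes> inv x2 = \<one>"
  using lift_relators(3)[of r4]
  by ((simp add: table_a table_b table_assoc), (simp add: word_simps)?)

end
context quarter_power_group
begin

lemmas x5_central = commutator_calculus(1-4)[OF closed(1-4) relation_1 relation_2 relation_3
    relation_4 relation_5 relation_6 relation_7 x5_def]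
lemmas commutations = commutator_calculus(5-10)[OF closed(1-4) relation_1 relation_2 relation_3
    relation_4 relation_5 relation_6 relation_7 x5_def]

definition "K = generate G {x1, x2, x3, x4, x5}"

lemma subgroup_K: "subgroup K G"
  unfolding K_def by (rule generate_is_subgroup) simp

lemma K_normal_form:
  assumes "k \<in> K"
  shows "\<exists>(n1::int) (n2::int) (n3::int) (n4::int) (n5::int).
    k = x1 [^] n1 \<otimes> (x2 [^] n2 \<otimes> (x3 [^] n3 \<otimes> (x4 [^] n4 \<otimes> x5 [^] n5)))"
proof -
  have *: "x5 [^] (0::int) = \<one>" "x5 [^] (1::int) = x5" "x5 [^] (-1::int) = inv x5"
    by (simp_all add: int_pow_neg)
  have c0: "\<exists>e::int. x2 \<otimes> x1 = x1 \<otimes> x2 \<otimes> x5 [^] e"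
    by (rule exI[of _ "0"]) (simp add: commutations)
  have c1: "\<exists>e::int. x3 \<otimes> x1 = x1 \<otimes> x3 \<otimes> x5 [^] e"
    by (rule exI[of _ "-1"]) (simp only: commutations *)
  have c2: "\<exists>e::int. x4 \<otimes> x1 = x1 \<otimes> x4 \<otimes> x5 [^] e"
    by (rule exI[of _ "-1"]) (simp only: commutations *)
  have c3: "\<exists>e::int. x3 \<otimes> x2 = x2 \<otimes> x3 \<otimes> x5 [^] e"
    by (rule exI[of _ "1"]) (simp only: commutations *)
  have c4: "\<exists>e::int. x4 \<otimes> x2 = x2 \<otimes> x4 \<otimes> x5 [^] e"
    by (rule exI[of _ "-1"]) (simp only: commutations *)
  have c5: "\<exists>e::int. x4 \<otimes> x3 = x3 \<otimes> x4 \<otimes> x5 [^] e"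
    by (rule exI[of _ "1"]) (simp only: commutations *)
  have cz: "\<exists>e::int. x5 \<otimes> g = g \<otimes> x5 \<otimes> x5 [^] e" if "x5 \<otimes> g = g \<otimes> x5" "g \<in> carrier G" for g
    by (rule exI[of _ 0]) (simp add: that)
  note c = c0 c1 c2 c3 c4 c5 cz[OF x5_central(1) closed(1)] cz[OF x5_central(2) closed(2)]
    cz[OF x5_central(3) closed(3)] cz[OF x5_central(4) closed(4)]
  have "\<exists>n::int. \<exists>h \<in> generate G {x2, x3, x4, x5}. k = x1 [^] n \<otimes> h"
  proof (rule generate_insert_normal_form[where t = x5, OF _ _ _ _ _ _ assms[unfolded K_def]])
    show "{x2, x3, x4, x5} \<subseteq> carrier G" "x1 \<in> carrier G" by simp_all
    show "x5 \<in> generate G {x2, x3, x4, x5}" by (intro generate.incl) simp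
    show "x5 \<otimes> x1 = x1 \<otimes> x5" by (rule x5_central)
    show "x5 \<otimes> s = s \<otimes> x5" if "s \<in> {x2, x3, x4, x5}" for s
      using that x5_central by blast
    show "\<exists>e::int. s \<otimes> x1 = x1 \<otimes> s \<otimes> x5 [^] e" if "s \<in> {x2, x3, x4, x5}" for s
      using that c by blast
  qed
  then obtain n1 :: int and k1 where 1: "k1 \<in> generate G {x2, x3, x4, x5}" "k = x1 [^] n1 \<otimes> k1"
    by blast
  have "\<exists>n::int. \<exists>h \<in> generate G {x3, x4, x5}. k1 = x2 [^] n \<otimes> h"
  proof (rule generate_insert_normal_form[where t = x5, OF _ _ _ _ _ _ 1(1)])
    show "{x3, x4, x5} \<subseteq> carrier G" "x2 \<in> carrier G" by simp_all
    show "x5 \<in> generate G {x3, x4, x5}" by (intro generate.incl) simp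
    show "x5 \<otimes> x2 = x2 \<otimes> x5" by (rule x5_central)
    show "x5 \<otimes> s = s \<otimes> x5" if "s \<in> {x3, x4, x5}" for s
      using that x5_central by blast
    show "\<exists>e::int. s \<otimes> x2 = x2 \<otimes> s \<otimes> x5 [^] e" if "s \<in> {x3, x4, x5}" for s
      using that c by blast
  qed
  then obtain n2 :: int and k2 where 2: "k2 \<in> generate G {x3, x4, x5}" "k1 = x2 [^] n2 \<otimes> k2"
    by blast
  have "\<exists>n::int. \<exists>h \<in> generate G {x4, x5}. k2 = x3 [^] n \<otimes> h"
  proof (rule generate_insert_normal_form[where t = x5, OF _ _ _ _ _ _ 2(1)])
    show "{x4, x5} \<subseteq> carrier G" "x3 \<in> carrier G" by simp_all
    show "x5 \<in> generate G {x4, x5}" by (intro generate.incl) simp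
    show "x5 \<otimes> x3 = x3 \<otimes> x5" by (rule x5_central)
    show "x5 \<otimes> s = s \<otimes> x5" if "s \<in> {x4, x5}" for s
      using that x5_central by blast
    show "\<exists>e::int. s \<otimes> x3 = x3 \<otimes> s \<otimes> x5 [^] e" if "s \<in> {x4, x5}" for s
      using that c by blast
  qed
  then obtain n3 :: int and k3 where 3: "k3 \<in> generate G {x4, x5}" "k2 = x3 [^] n3 \<otimes> k3"
    by blast
  have "\<exists>n::int. \<exists>h \<in> generate G {x5}. k3 = x4 [^] n \<otimes> h"
  proof (rule generate_insert_normal_form[where t = x5, OF _ _ _ _ _ _ 3(1)])
    show "{x5} \<subseteq> carrier G" "x4 \<in> carrier G" by simp_all
    show "x5 \<in> generate G {x5}" by (intro generate.incl) simp
    show "x5 \<otimes> x4 = x4 \<otimes> x5" by (rule x5_central)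
    show "x5 \<otimes> s = s \<otimes> x5" if "s \<in> {x5}" for s
      using that x5_central by blast
    show "\<exists>e::int. s \<otimes> x4 = x4 \<otimes> s \<otimes> x5 [^] e" if "s \<in> {x5}" for s
      using that c by blast
  qed
  then obtain n4 :: int and k4 where 4: "k4 \<in> generate G {x5}" "k3 = x4 [^] n4 \<otimes> k4"
    by blast
  obtain n5 :: int where "k4 = x5 [^] n5"
    using 4(1) generate_pow[of x5] by auto
  then have "k = x1 [^] n1 \<otimes> (x2 [^] n2 \<otimes> (x3 [^] n3 \<otimes> (x4 [^] n4 \<otimes> x5 [^] n5)))"
    by (simp only: 1(2) 2(2) 3(2) 4(2))
  then show ?thesis by (intro exI, assumption)
qed

lemma K_closed: "x1 \<in> K" "x2 \<in> K" "x3 \<in> K" "x4 \<in> K"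
  unfolding K_def by (auto intro: generate.incl)

abbreviation "reps \<equiv> {r0, r1, r2, r3, r4, r5, r6, r7}"

text \<open>
  By the table the union of the cosets \<open>K r\<close> is closed under right multiplication by \<open>a\<close> and \<open>b\<close>, and
  hence by their inverses, which are cubes.
\<close>

lemma K_cosets:
  assumes "g \<in> carrier G"
  shows "\<exists>k \<in> K. \<exists>r \<in> reps. g = k \<otimes> r"
proof -
  interpret K: subgroup K G by (rule subgroup_K)
  define D where "D = {d. \<exists>k \<in> K. \<exists>r \<in> reps. d = k \<otimes> r}"
  have Dc: "d \<in> carrier G" if "d \<in> D" for d using that by (auto simp: D_def)
  have table: "\<exists>k \<in> K. \<exists>r' \<in> reps. r \<otimes> a = k \<otimes> r'" "\<exists>k \<in> K. \<exists>r' \<in> reps. r \<otimes> b = k \<otimes> r'" if "r \<in> reps" for r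
  proof -
    have one: "\<exists>k \<in> K. \<exists>r' \<in> reps. r \<otimes> s = k \<otimes> r'" if "r \<otimes> s \<in> reps" for s
      using that by (intro bexI[of _ \<one>] bexI[of _ "r \<otimes> s"]) auto
    have two: "\<exists>k' \<in> K. \<exists>r' \<in> reps. r \<otimes> s = k' \<otimes> r'" if "r \<otimes> s = k \<otimes> r'" "k \<in> K" "r' \<in> reps" for s k r'
      using that by blast
    show "\<exists>k \<in> K. \<exists>r' \<in> reps. r \<otimes> a = k \<otimes> r'"
      using \<open>r \<in> reps\<close> table_a one[of a] two[of a] K_closed
      by (elim insertE emptyE; simp; metis K.m_closed K.m_inv_closed insertI1 insertI2)
    show "\<exists>k \<in> K. \<exists>r' \<in> reps. r \<otimes> b = k \<otimes> r'"
      using \<open>r \<in> reps\<close> table_b one[of b] two[of b] K_closed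
      by (elim insertE emptyE; simp; metis K.m_closed K.m_inv_closed insertI1 insertI2)
  qed
  have step: "d \<otimes> s \<in> D" if d: "d \<in> D" and s: "s = a \<or> s = b" for d s
  proof -
    obtain k r where kr: "k \<in> K" "r \<in> reps" "d = k \<otimes> r" using d by (auto simp: D_def)
    obtain k' r' where kr': "k' \<in> K" "r' \<in> reps" "r \<otimes> s = k' \<otimes> r'" using table[OF kr(2)] s by blast
    have [simp]: "r \<in> carrier G" "r' \<in> carrier G" "s \<in> carrier G" using kr(2) kr'(2) s by auto
    have "d \<otimes> s = k \<otimes> (r \<otimes> s)" using kr by (simp add: m_assoc)
    also have "\<dots> = (k \<otimes> k') \<otimes> r'" unfolding kr'(3) using kr kr' by (simp add: m_assoc)
    finally show ?thesis unfolding D_def using kr(1) kr'(1,2) by blast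
  qed
  have stepi: "d \<otimes> inv s \<in> D" if d: "d \<in> D" and s: "s = a \<or> s = b" for d s
  proof -
    have "d \<otimes> s \<otimes> s \<otimes> s \<in> D" using d s step by blast
    then show ?thesis using s cubes Dc[OF d] by (auto simp: m_assoc)
  qed
  have "d \<otimes> g \<in> D" if "d \<in> D" for d
    using assms that unfolding generated[symmetric]
  proof (induction arbitrary: d rule: generate.induct)
    case one
    then show ?case using Dc by simp
  next
    case (incl s)
    then show ?case using step by auto
  next
    case (inv s)
    then show ?case using stepi by auto
  next
    case (eng g h)
    have "{g, h} \<subseteq> carrier G" using generated eng by auto
    then have "d \<otimes> (g \<otimes> h) = d \<otimes> g \<otimes> h" using Dc[OF eng.prems] by (simp add: m_assoc)
    then show ?case using eng by simp
  qed
  moreover have "\<one> \<in> D" unfolding D_def using r0_def by (auto intro!: bexI[of _ \<one>])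
  ultimately have "\<one> \<otimes> g \<in> D" by blast
  then show ?thesis using assms by (auto simp: D_def)
qed

end


section \<open>Comparison with the quaternionic model\<close>

locale quarter_power_model = quarter_power_group +
  fixes \<psi>
  assumes \<psi>: "\<psi> \<in> hom G QH"
    and \<psi>_a: "\<psi> a = (Quat 0 1 0 0, 0, 0)" and \<psi>_b: "\<psi> b = (Quat 0 0 1 0, 1, 0)"
begin

sublocale \<psi>: group_hom G QH \<psi>
  using \<psi> by unfold_locales

lemma \<psi>_gens:
  "\<psi> x1 = (1, Quat (-1) 0 (-1) 0, 0)" "\<psi> x2 = (1, Quat 0 (-1) 0 (-1), 0)"
  "\<psi> x3 = (1, Quat 1 0 0 (-1), 0)" "\<psi> x4 = (1, Quat (-1) 1 0 0, 1)" "\<psi> x5 = (1, 0, -2)"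
  by (simp_all add: x1_def x2_def x3_def x4_def x5_def \<psi>_a \<psi>_b QH_mult QH_inv qnorm_def qconj_def
      form_eq quat_defs)

lemma \<psi>_reps:
  "fst (\<psi> r0) = Quat 1 0 0 0" "fst (\<psi> r1) = Quat 0 1 0 0" "fst (\<psi> r2) = Quat (-1) 0 0 0"
  "fst (\<psi> r3) = Quat 0 (-1) 0 0" "fst (\<psi> r4) = Quat 0 0 1 0" "fst (\<psi> r5) = Quat 0 0 (-1) 0"
  "fst (\<psi> r6) = Quat 0 0 0 1" "fst (\<psi> r7) = Quat 0 0 0 (-1)"
  by (simp_all add: rep_defs \<psi>_a \<psi>_b QH_mult QH_one QH_inv qnorm_def qconj_def quat_defs)

lemma \<psi>_normal_form:
  fixes n1 n2 n3 n4 n5 :: int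
  shows "\<exists>c. \<psi> (x1 [^] n1 \<otimes> (x2 [^] n2 \<otimes> (x3 [^] n3 \<otimes> (x4 [^] n4 \<otimes> x5 [^] n5)))) =
    (1, Quat (n3 - n1 - n4) (n4 - n2) (- n1) (- n2 - n3), c)"
proof -
  have "\<psi> (x1 [^] n1 \<otimes> (x2 [^] n2 \<otimes> (x3 [^] n3 \<otimes> (x4 [^] n4 \<otimes> x5 [^] n5)))) =
      (1, of_int n1 * Quat (-1) 0 (-1) 0, n1 * 0) \<star>
      ((1, of_int n2 * Quat 0 (-1) 0 (-1), n2 * 0) \<star>
      ((1, of_int n3 * Quat 1 0 0 (-1), n3 * 0) \<star>
      ((1, of_int n4 * Quat (-1) 1 0 0, n4 * 1) \<star> (1, of_int n5 * 0, n5 * -2))))"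
    by (simp only: \<psi>_gens \<psi>.hom_int_pow QH_int_pow \<psi>.hom_mult closed int_pow_closed m_closed)
  then show ?thesis by (simp add: QH_mult of_int_quat quat_defs)
qed

text \<open>
  The units of the representatives are distinct, so only \<open>K\<close> matters. On normal forms the four
  translation coordinates determine the exponents of \<open>x1, \<dots>, x4\<close>, and then the central coordinate
  determines that of \<open>x5\<close>.
\<close>

lemma \<psi>_one_iff:
  assumes g: "g \<in> carrier G" and one: "\<psi> g = \<one>\<^bsub>QH\<^esub>"
  shows "g = \<one>"
proof -
  interpret K: subgroup K G by (rule subgroup_K)
  obtain k r where k: "k \<in> K" and r: "r \<in> reps" and gkr: "g = k \<otimes> r" using K_cosets[OF g] by blast
  obtain n1 n2 n3 n4 n5 :: int where
    n: "k = x1 [^] n1 \<otimes> (x2 [^] n2 \<otimes> (x3 [^] n3 \<otimes> (x4 [^] n4 \<otimes> x5 [^] n5)))"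
    using K_normal_form[OF k] by blast
  obtain c where \<psi>k: "\<psi> k = (1, Quat (n3 - n1 - n4) (n4 - n2) (- n1) (- n2 - n3), c)"
    using \<psi>_normal_form[of n1 n2 n3 n4 n5] n by auto
  have "r \<in> carrier G" using r by auto
  then have \<psi>g: "\<psi> g = \<psi> k \<star> \<psi> r" using k gkr by simp
  then have "fst (\<psi> r) = 1"
    using one \<psi>k by (cases "\<psi> r") (simp add: QH_mult QH_one)
  then have "r = r0" using r \<psi>_reps by (auto simp: one_quat_def)
  then have gk: "g = k" using gkr k by (simp add: r0_def)
  then have "n1 = 0" "n2 = 0" "n3 = 0" "n4 = 0"
    using \<psi>k one by (auto simp: QH_one zero_quat_def)
  then have gz: "g = x5 [^] n5" using gk n by simp
  then have "(1, of_int n5 * 0, n5 * -2) = \<one>\<^bsub>QH\<^esub>"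
    using one by (simp only: \<psi>.hom_int_pow closed \<psi>_gens QH_int_pow)
  then have "n5 = 0" by (simp add: QH_one)
  then show ?thesis using gz by simp
qed

lemma \<psi>_inj: "inj_on \<psi> (carrier G)"
  using \<psi>.inj_on_one_iff \<psi>_one_iff by blast

text \<open>
  The central coordinate is determined modulo two by the translation, since the form is modulo two
  the polarisation of the quadratic form \<open>v\<^sub>0 v\<^sub>1 + v\<^sub>2 v\<^sub>3\<close>.
\<close>

lemma \<psi>_K:
  assumes "k \<in> K"
  shows "\<exists>v c. \<psi> k = (1, v, c) \<and> even (qre v + qi v + qj v + qk v) \<and>
    even (c - qre v * qi v - qj v * qk v)"
  using assms unfolding K_def
proof (induction rule: generate.induct)
  case one
  show ?case by (simp add: QH_one zero_quat_def)
next
  case (incl h)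
  then show ?case by (auto simp: \<psi>_gens zero_quat_def)
next
  case (inv h)
  then show ?case by (auto simp: \<psi>_gens QH_inv_translation uminus_quat_def zero_quat_def)
next
  case (eng g h)
  then obtain v c v' c' where *: "\<psi> g = (1, v, c)" "even (qre v + qi v + qj v + qk v)"
    "even (c - qre v * qi v - qj v * qk v)" "\<psi> h = (1, v', c')"
    "even (qre v' + qi v' + qj v' + qk v')" "even (c' - qre v' * qi v' - qj v' * qk v')"
    by blast
  have "{g, h} \<subseteq> carrier G" using generate_in_carrier[of "{x1, x2, x3, x4, x5}"] eng by auto
  then have "\<psi> (g \<otimes> h) = (1, v + v', c + c' + form v v')" using * by (simp add: QH_mult)
  moreover have "even (c + c' + form v v' - qre (v + v') * qi (v + v') - qj (v + v') * qk (v + v'))"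
  proof -
    have "c + c' + form v v' - qre (v + v') * qi (v + v') - qj (v + v') * qk (v + v') =
        (c - qre v * qi v - qj v * qk v) + (c' - qre v' * qi v' - qj v' * qk v') -
        2 * (qi v * qre v' + qj v * qk v')"
      by (simp add: form_eq plus_quat_def algebra_simps)
    then show ?thesis by (simp only: dvd_diff[OF dvd_add[OF *(3) *(6)] dvd_triv_left])
  qed
  ultimately show ?case using *(2,5) by (auto simp: plus_quat_def)
qed

end


section \<open>Heisenberg groups and the added relator\<close>

abbreviation "HH \<equiv> heisenberg \<times>\<times> heisenberg"

definition heis :: "int \<Rightarrow> int \<Rightarrow> int \<Rightarrow> int^3^3"
  where "heis x y z = vector [vector [1, x, z], vector [0, 1, y], vector [0, 0, 1]]"

lemma heis_closed: "heis x y z \<in> carrier heisenberg"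
  by (simp add: heis_def heisenberg_def)

lemma heis_entries: "heis x y z $ 1 $ 2 = x" "heis x y z $ 2 $ 3 = y" "heis x y z $ 1 $ 3 = z"
  by (simp_all add: heis_def)

lemma carrier_heisenbergE:
  assumes "M \<in> carrier heisenberg"
  obtains x y z where "M = heis x y z"
proof
  show "M = heis (M $ 1 $ 2) (M $ 2 $ 3) (M $ 1 $ 3)"
    using assms by (simp add: heisenberg_def heis_def vec_eq_iff forall_3)
qed

lemma heis_mult:
  "heis x y z \<otimes>\<^bsub>heisenberg\<^esub> heis x' y' z' = heis (x + x') (y + y') (z + z' + x * y')"
  by (simp add: heisenberg_def heis_def vec_eq_iff forall_3 matrix_matrix_mult_def sum_3)

lemma heis_one: "\<one>\<^bsub>heisenberg\<^esub> = heis 0 0 0"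
  by (simp add: heisenberg_def heis_def vec_eq_iff forall_3 mat_def)

lemma HH_group: "group HH"
  by (intro DirProd_group heisenberg_group)

interpretation HH: group HH by (rule HH_group)

text \<open>
  The generators \<open>X\<close>, \<open>Y\<close> of the first factor go to the images \<open>p\<close>, \<open>q\<close> of \<open>a1\<close>, \<open>a3\<close>, those of the second
  factor to the images \<open>r\<close>, \<open>s\<close> of \<open>a1 a2\<close> and \<open>a4 a3\<^sup>-\<^sup>1\<close>. With this choice the two pairs commute with each other,
  and \<open>[r, s] = [p, q]\<^sup>2\<close>. The formula is \<open>q\<^sup>y p\<^sup>x t\<^sup>z s\<^sup>y\<^sup>' r\<^sup>x\<^sup>' t\<^sup>2\<^sup>z\<^sup>'\<close> with \<open>t = [p, q] = (1, 0, 16)\<close>.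
\<close>

definition chi :: "(int^3^3) \<times> (int^3^3) \<Rightarrow> quat \<times> quat \<times> int"
  where "chi = (\<lambda>(M, M').
    let x = M $ 1 $ 2; y = M $ 2 $ 3; z = M $ 1 $ 3; x' = M' $ 1 $ 2; y' = M' $ 2 $ 3; z' = M' $ 1 $ 3
    in (1, Quat (- 2 * x + 4 * y - 4 * x' - 4 * y') (- 2 * x) (- 2 * x - 4 * x') (- 2 * x + 4 * y'),
      4 * y - 4 * x' - 4 * y' - 8 * x * y - 16 * x' * y' + 16 * z + 32 * z'))"

lemma chi_heis: "chi (heis x y z, heis x' y' z') =
    (1, Quat (- 2 * x + 4 * y - 4 * x' - 4 * y') (- 2 * x) (- 2 * x - 4 * x') (- 2 * x + 4 * y'),
      4 * y - 4 * x' - 4 * y' - 8 * x * y - 16 * x' * y' + 16 * z + 32 * z')"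
  by (simp add: chi_def heis_entries)

lemma chi_hom: "chi \<in> hom HH QH"
proof (rule homI)
  fix M N assume "M \<in> carrier HH" "N \<in> carrier HH"
  then obtain M1 M2 N1 N2 where MN: "M = (M1, M2)" "N = (N1, N2)" "M1 \<in> carrier heisenberg"
    "M2 \<in> carrier heisenberg" "N1 \<in> carrier heisenberg" "N2 \<in> carrier heisenberg"
    by (auto simp: DirProd_def)
  obtain x1 y1 z1 x2 y2 z2 where M: "M1 = heis x1 y1 z1" "M2 = heis x2 y2 z2"
    using MN carrier_heisenbergE by metis
  obtain x3 y3 z3 x4 y4 z4 where N: "N1 = heis x3 y3 z3" "N2 = heis x4 y4 z4"
    using MN carrier_heisenbergE by metis
  show "chi M \<in> carrier QH" by (simp add: MN M chi_heis QH_carrier qnorm_simps)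
  show "chi (M \<otimes>\<^bsub>HH\<^esub> N) = chi M \<star> chi N"
    by (simp add: MN M N heis_mult chi_heis QH_mult form_eq plus_quat_def algebra_simps)
qed

interpretation chi: group_hom HH QH chi
  using chi_hom by unfold_locales

definition relator :: "(int^3^3) \<times> (int^3^3)"
  where "relator = (heis 0 0 2, heis 0 0 (- 1))"

lemma relator_closed: "relator \<in> carrier HH"
  by (simp add: relator_def heis_closed)

lemma relator_nontrivial: "relator \<noteq> \<one>\<^bsub>HH\<^esub>"
proof
  assume "relator = \<one>\<^bsub>HH\<^esub>"
  then have "heis 0 0 2 = heis 0 0 0" by (simp add: relator_def DirProd_def heis_one)
  then show False using heis_entries(3) by (metis zero_neq_numeral)
qed

text \<open>
  The four translation coordinates determine \<open>x, y, x', y'\<close>, so the kernel consists of the central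
  elements with \<open>z + 2 z' = 0\<close>, which are the powers of the relator.
\<close>

lemma kernel_chi: "kernel HH QH chi = normal_closure HH {relator}"
proof
  have r: "relator \<in> kernel HH QH chi"
    using relator_closed by (simp add: kernel_def relator_def chi_heis QH_one zero_quat_def)
  interpret N: normal "kernel HH QH chi" HH by (rule chi.normal_kernel)
  show "normal_closure HH {relator} \<subseteq> kernel HH QH chi"
    unfolding normal_closure_def
    by (rule HH.generate_subgroup_incl[OF _ N.subgroup_axioms]) (use N.inv_op_closed2 r in blast)
  have nc: "subgroup (normal_closure HH {relator}) HH"
    using HH.normal_closure_normal[of "{relator}"] relator_closed by (simp add: normal_imp_subgroup)
  interpret nc: subgroup "normal_closure HH {relator}" HH by (rule nc)
  have "\<one>\<^bsub>HH\<^esub> \<otimes>\<^bsub>HH\<^esub> relator \<otimes>\<^bsub>HH\<^esub> inv\<^bsub>HH\<^esub> \<one>\<^bsub>HH\<^esub> \<in> normal_closure HH {relator}"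
    unfolding normal_closure_def by (rule generate.incl) blast
  then have rnc: "relator \<in> normal_closure HH {relator}" using relator_closed by (simp del: one_DirProd mult_DirProd)
  have mult: "(heis 0 0 a, heis 0 0 b) \<otimes>\<^bsub>HH\<^esub> (heis 0 0 c, heis 0 0 d) = (heis 0 0 (a + c), heis 0 0 (b + d))"
    for a b c d by (simp add: heis_mult)
  have inv_r: "inv\<^bsub>HH\<^esub> relator = (heis 0 0 (- 2), heis 0 0 1)"
    using relator_closed
    by (intro HH.inv_equality) (simp_all add: relator_def heis_mult heis_one heis_closed DirProd_def)
  have pow: "(heis 0 0 (2 * n), heis 0 0 (- n)) \<in> normal_closure HH {relator}" for n
  proof (induction n rule: int_induct[where k = 0])
    case base
    then show ?case using nc.one_closed by (simp add: heis_one DirProd_def)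
  next
    case (step1 n)
    have "(heis 0 0 (2 * n), heis 0 0 (- n)) \<otimes>\<^bsub>HH\<^esub> relator \<in> normal_closure HH {relator}"
      using step1 rnc by (intro nc.m_closed)
    then show ?case unfolding relator_def mult by (simp add: algebra_simps)
  next
    case (step2 n)
    have "(heis 0 0 (2 * n), heis 0 0 (- n)) \<otimes>\<^bsub>HH\<^esub> inv\<^bsub>HH\<^esub> relator \<in> normal_closure HH {relator}"
      using step2 rnc by (intro nc.m_closed nc.m_inv_closed)
    then show ?case unfolding inv_r mult by (simp add: algebra_simps)
  qed
  show "kernel HH QH chi \<subseteq> normal_closure HH {relator}"
  proof
    fix M assume "M \<in> kernel HH QH chi"
    then have M: "M \<in> carrier HH" "chi M = \<one>\<^bsub>QH\<^esub>" by (auto simp: kernel_def)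
    obtain M1 M2 where *: "M = (M1, M2)" "M1 \<in> carrier heisenberg" "M2 \<in> carrier heisenberg"
      using M(1) by (auto simp: DirProd_def)
    obtain x y z x' y' z' where h: "M1 = heis x y z" "M2 = heis x' y' z'"
      using * carrier_heisenbergE by metis
    have "x = 0" "x' = 0" "y' = 0" "y = 0" "z = 2 * (- z')"
      using M(2) by (auto simp: * h chi_heis QH_one zero_quat_def)
    then show "M \<in> normal_closure HH {relator}" using pow[of "- z'"] by (simp add: * h)
  qed
qed

lemma chi_image:
  "chi ` carrier HH = generate QH {(1, Quat (-2) (-2) (-2) (-2), 0), (1, Quat (-2) 2 (-2) 2, -4),
    (1, Quat 4 0 0 0, 4), (1, Quat 0 0 0 4, 0)}" (is "_ = generate QH ?S")
proof
  have im: "chi (heis x y z, heis x' y' z') \<in> chi ` carrier HH" for x y z x' y' z'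
    by (simp add: heis_closed)
  have "?S \<subseteq> chi ` carrier HH"
    using im[of 1 0 0 0 0 0] im[of "-1" 0 0 1 0 0] im[of 0 1 0 0 0 0] im[of 0 1 0 0 1 0]
    by (simp add: chi_heis)
  then show "generate QH ?S \<subseteq> chi ` carrier HH"
    by (rule QH.generate_subgroup_incl[OF _ chi.img_is_subgroup])
  have S: "?S \<subseteq> carrier QH" by (simp add: QH_carrier qnorm_simps)
  interpret N: subgroup "generate QH ?S" QH using S by (rule QH.generate_is_subgroup)
  have pow: "g [^]\<^bsub>QH\<^esub> (n::int) \<in> generate QH ?S" if "g \<in> generate QH ?S" for g n
    using QH.subgroup_int_pow_closed[OF N.subgroup_axioms that] .
  have gens: "(1, Quat (-2) (-2) (-2) (-2), 0) \<in> generate QH ?S" "(1, Quat (-2) 2 (-2) 2, -4) \<in> generate QH ?S"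
    "(1, Quat 4 0 0 0, 4) \<in> generate QH ?S" "(1, Quat 0 0 0 4, 0) \<in> generate QH ?S"
    by (auto intro: generate.incl)
  \<comment> \<open>the images of the generators of the two Heisenberg groups and of the centre\<close>
  define p q r s where "p = (1::quat, Quat (-2) (-2) (-2) (-2), 0::int)" and "q = (1::quat, Quat 4 0 0 0, 4::int)"
    and "r = (1::quat, Quat (-4) 0 (-4) 0, -4::int)" and "s = (1::quat, Quat (-4) 0 0 4, -4::int)"
  have p: "p \<in> generate QH ?S" and q: "q \<in> generate QH ?S" using gens by (simp_all add: p_def q_def)
  have "r = p \<star> (1, Quat (-2) 2 (-2) 2, -4)"
    by (simp add: p_def r_def QH_mult form_eq quat_defs)
  then have r: "r \<in> generate QH ?S" using p gens by simp
  have "s = (1, Quat 0 0 0 4, 0) \<star> inv\<^bsub>QH\<^esub> q"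
    unfolding s_def q_def QH_inv_translation by (simp add: QH_mult form_eq quat_defs)
  then have s: "s \<in> generate QH ?S" using q gens by simp
  define t where "t = (1::quat, 0::quat, 16::int)"
  have "t = p \<star> q \<star> inv\<^bsub>QH\<^esub> p \<star> inv\<^bsub>QH\<^esub> q"
    unfolding p_def q_def t_def QH_inv_translation by (simp add: QH_mult form_eq quat_defs)
  then have t: "t \<in> generate QH ?S" using p q by simp
  show "chi ` carrier HH \<subseteq> generate QH ?S"
  proof
    fix X assume "X \<in> chi ` carrier HH"
    then obtain M1 M2 where M: "M1 \<in> carrier heisenberg" "M2 \<in> carrier heisenberg" "X = chi (M1, M2)"
      by (auto simp: DirProd_def)
    obtain x y z x' y' z' where h: "M1 = heis x y z" "M2 = heis x' y' z'"
      using M carrier_heisenbergE by metis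
    have "X = q [^]\<^bsub>QH\<^esub> y \<star> p [^]\<^bsub>QH\<^esub> x \<star> t [^]\<^bsub>QH\<^esub> (z + 2 * z') \<star>
        (s [^]\<^bsub>QH\<^esub> y' \<star> r [^]\<^bsub>QH\<^esub> x')"
      unfolding M(3) h chi_heis p_def q_def r_def s_def t_def QH_int_pow
      by (simp add: QH_mult form_eq of_int_quat quat_defs algebra_simps)
    then show "X \<in> generate QH ?S" using pow p q r s t by simp
  qed
qed


section \<open>The nilpotent subgroup\<close>

text \<open>
  Central coordinate first, so that each coordinate is additive on the elements for which all later
  coordinates vanish.
\<close>

definition coord :: "nat \<Rightarrow> quat \<times> quat \<times> int \<Rightarrow> int"
  where "coord i = (\<lambda>(q, v, c). if i = 0 then c else if i = 1 then qk v else if i = 2 then qj v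
    else if i = 3 then qi v else qre v)"

lemma coord_mult:
  assumes "j = 0 \<Longrightarrow> v = 0"
  shows "coord j ((1, v, c) \<star> (1, v', c')) = coord j (1, v, c) + coord j (1, v', c')"
  using assms by (simp add: coord_def QH_mult form_simps) (simp add: plus_quat_def)

lemma coord_inv: "coord j (1, - v, - c) = - coord j (1, v, c)"
  by (simp add: coord_def uminus_quat_def)

context quarter_power_model
begin

lemma K_iff: "g \<in> K \<longleftrightarrow> g \<in> carrier G \<and> fst (\<psi> g) = 1"
proof
  interpret K: subgroup K G by (rule subgroup_K)
  show "g \<in> carrier G \<and> fst (\<psi> g) = 1" if "g \<in> K" using \<psi>_K[OF that] that by auto
  show "g \<in> K" if g: "g \<in> carrier G \<and> fst (\<psi> g) = 1"
  proof -
    obtain k r where k: "k \<in> K" and r: "r \<in> reps" and gkr: "g = k \<otimes> r" using K_cosets g by blast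
    obtain v c where \<psi>k: "\<psi> k = (1, v, c)" using \<psi>_K[OF k] by blast
    have "r \<in> carrier G" using r by auto
    then have "\<psi> g = \<psi> k \<star> \<psi> r" using k gkr by simp
    then have "fst (\<psi> r) = 1" using g \<psi>k by (cases "\<psi> r") (simp add: QH_mult)
    then have "r = r0" using r \<psi>_reps by (auto simp: one_quat_def)
    then show ?thesis using gkr k by (simp add: r0_def)
  qed
qed

text \<open>
  The elements of \<open>K\<close> for which only the first \<open>i\<close> coordinates can be different from zero.
\<close>

definition "layer i = {g \<in> K. \<forall>j. i \<le> j \<and> j < 5 \<longrightarrow> coord j (\<psi> g) = 0}"

lemma layer_5: "layer 5 = K" by (auto simp: layer_def)

lemma layer_0: "layer 0 = {\<one>}"
proof -
  have "g = \<one>" if "g \<in> layer 0" for g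
  proof -
    obtain v c where v: "\<psi> g = (1, v, c)" and g: "g \<in> carrier G"
      using \<open>g \<in> layer 0\<close> \<psi>_K[of g] by (auto simp: layer_def K_iff)
    have "coord j (1, v, c) = 0" if "j < 5" for j using \<open>g \<in> layer 0\<close> v that by (auto simp: layer_def)
    from this[of 0] this[of 1] this[of 2] this[of 3] this[of 4]
    have "c = 0" "v = 0" by (simp_all add: coord_def zero_quat_def quat.expand)
    then show ?thesis using \<psi>_one_iff[OF g] v by (simp add: QH_one)
  qed
  moreover have "\<one> \<in> layer 0"
    using subgroup.one_closed[OF subgroup_K] by (auto simp: layer_def QH_one coord_def zero_quat_def)
  ultimately show ?thesis by blast
qed

lemma layer_translation:
  assumes "g \<in> layer i" "i \<le> 1"
  obtains c where "\<psi> g = (1, 0, c)"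
proof -
  obtain v c where v: "\<psi> g = (1, v, c)" using assms \<psi>_K[of g] by (auto simp: layer_def)
  have "coord j (1, v, c) = 0" if "1 \<le> j" "j < 5" for j using assms v that by (auto simp: layer_def)
  from this[of 1] this[of 2] this[of 3] this[of 4]
  have "v = 0" by (simp add: coord_def zero_quat_def quat.expand)
  then show ?thesis using that v by blast
qed

lemma layer_add:
  assumes "i \<le> Suc j" "g \<in> layer i" "h \<in> layer i"
  shows "coord j (\<psi> (g \<otimes> h)) = coord j (\<psi> g) + coord j (\<psi> h)"
proof -
  have gh: "g \<in> carrier G" "h \<in> carrier G" using assms by (auto simp: layer_def K_iff)
  obtain v c v' c' where v: "\<psi> g = (1, v, c)" "\<psi> h = (1, v', c')"
    using assms \<psi>_K[of g] \<psi>_K[of h] by (auto simp: layer_def)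
  have "v = 0" if "j = 0" using layer_translation[OF assms(2)] assms(1) that v by auto
  then show ?thesis using gh coord_mult[of j v c v' c'] by (simp add: v)
qed

lemma subgroup_layer: "subgroup (layer i) G"
proof -
  interpret K: subgroup K G by (rule subgroup_K)
  show ?thesis
  proof (rule subgroupI)
    show "layer i \<subseteq> carrier G" by (auto simp: layer_def)
    have "\<one> \<in> layer i" by (auto simp: layer_def QH_one coord_def zero_quat_def)
    then show "layer i \<noteq> {}" by blast
    show "inv g \<in> layer i" if g: "g \<in> layer i" for g
    proof -
      obtain v c where v: "\<psi> g = (1, v, c)" using g \<psi>_K[of g] by (auto simp: layer_def)
      have "g \<in> carrier G" using g by (auto simp: layer_def)
      then show ?thesis using g by (auto simp: layer_def v QH_inv_translation coord_inv)
    qed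
    show "g \<otimes> h \<in> layer i" if gh: "g \<in> layer i" "h \<in> layer i" for g h
      using gh layer_add[of i _ g h] by (auto simp: layer_def)
  qed
qed

lemma layer_kernel: "i < 5 \<Longrightarrow> {g \<in> layer (Suc i). coord i (\<psi> g) = 0} = layer i"
  unfolding layer_def by (auto simp: Suc_le_eq) (metis le_neq_implies_less)

end

text \<open>
  The subgroup \<open>N\<close> is described by the images of its generators only; these determine the generators,
  since \<open>\<psi>\<close> is injective.
\<close>

locale nilpotent_subgroup = quarter_power_model +
  fixes a1 a2 a3 a4 N
  assumes a_closed: "a1 \<in> carrier G" "a2 \<in> carrier G" "a3 \<in> carrier G" "a4 \<in> carrier G"
    and \<psi>_as: "\<psi> a1 = (1, Quat (-2) (-2) (-2) (-2), 0)" "\<psi> a2 = (1, Quat (-2) 2 (-2) 2, -4)"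
      "\<psi> a3 = (1, Quat 4 0 0 0, 4)" "\<psi> a4 = (1, Quat 0 0 0 4, 0)"
    and N_def: "N = generate G {a1, a2, a3, a4}"
begin

abbreviation "G\<^sub>N \<equiv> G\<lparr>carrier := N\<rparr>"

lemma subgroup_N: "subgroup N G"
  unfolding N_def using a_closed by (intro generate_is_subgroup) simp

interpretation N: subgroup N G by (rule subgroup_N)

lemma \<psi>_N: "\<psi> ` N = chi ` carrier HH"
  unfolding N_def chi_image using \<psi>.generate_img[of "{a1, a2, a3, a4}"] a_closed by (simp add: \<psi>_as)

lemma N_coords:
  assumes "g \<in> N"
  obtains x y m x' y' m' where "\<psi> g = chi (heis x y m, heis x' y' m')"
proof -
  have "\<psi> g \<in> chi ` carrier HH" using assms \<psi>_N by blast
  then obtain M1 M2 where "M1 \<in> carrier heisenberg" "M2 \<in> carrier heisenberg" "\<psi> g = chi (M1, M2)"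
    by (auto simp: DirProd_def)
  then show thesis using that carrier_heisenbergE by metis
qed

lemma N_ex:
  obtains g where "g \<in> N" "\<psi> g = chi (heis x y m, heis x' y' m')"
proof -
  have "chi (heis x y m, heis x' y' m') \<in> \<psi> ` N" unfolding \<psi>_N by (simp add: heis_closed)
  then show thesis using that by auto
qed

lemma N_sub_K: "N \<subseteq> K"
proof
  fix g assume g: "g \<in> N"
  then have "g \<in> carrier G" by simp
  with g show "g \<in> K" by (cases rule: N_coords) (simp_all add: K_iff chi_heis)
qed

lemma less_5_cases: "i < 5 \<Longrightarrow> i = 0 \<or> i = 1 \<or> i = 2 \<or> i = 3 \<or> i = (4::nat)"
  by linarith

lemma layer_memI:
  assumes "g \<in> carrier G" "\<psi> g = (1, v, c)" "\<And>j. \<lbrakk>i \<le> j; j < 5\<rbrakk> \<Longrightarrow> coord j (1, v, c) = 0"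
  shows "g \<in> layer i"
  using assms by (auto simp: layer_def K_iff)

text \<open>
  The values of a coordinate on its layer of \<open>K\<close> are the multiples of 1 for the first three translation
  coordinates. The last one and the central one are even by \<open>\<psi>_K\<close>.
\<close>

lemma K_steps:
  assumes "i < 5"
  shows "\<exists>g \<in> layer (Suc i). coord i (\<psi> g) = [2, 2, 1, 1, 1] ! i"
    and "g \<in> layer (Suc i) \<Longrightarrow> [2, 2, 1, 1, 1] ! i dvd coord i (\<psi> g)"
proof -
  have ex: "\<exists>g \<in> layer (Suc i). coord i (\<psi> g) = d" if "g \<in> carrier G" "\<psi> g = (1, v, c)"
    "\<And>j. \<lbrakk>Suc i \<le> j; j < 5\<rbrakk> \<Longrightarrow> coord j (1, v, c) = 0" "coord i (1, v, c) = d" for g v c d i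
    using layer_memI[OF that(1-3)] that by force
  have 0: "\<exists>g \<in> layer (Suc 0). coord 0 (\<psi> g) = 2"
    by (rule ex[of "inv x5" 0 2])
      (simp_all add: \<psi>_gens QH_inv_translation coord_def zero_quat_def uminus_quat_def)
  have 1: "\<exists>g \<in> layer (Suc 1). coord 1 (\<psi> g) = 2"
    by (rule ex[of "inv x2 \<otimes> inv x3 \<otimes> inv x4" "Quat 0 0 0 2" 0])
      (auto simp: \<psi>_gens QH_inv_translation QH_mult coord_def form_eq plus_quat_def uminus_quat_def)
  have 2: "\<exists>g \<in> layer (Suc 2). coord 2 (\<psi> g) = 1"
    by (rule ex[of "inv x1 \<otimes> inv x3" "Quat 0 0 1 1" "-1"])
      (auto simp: \<psi>_gens QH_inv_translation QH_mult coord_def form_eq plus_quat_def uminus_quat_def)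
  have 3: "\<exists>g \<in> layer (Suc 3). coord 3 (\<psi> g) = 1"
    by (rule ex[of "inv x2" "Quat 0 1 0 1" 0])
      (auto simp: \<psi>_gens QH_inv_translation coord_def uminus_quat_def)
  have 4: "\<exists>g \<in> layer (Suc 4). coord 4 (\<psi> g) = 1"
    by (rule ex[of "x3" "Quat 1 0 0 (-1)" 0]) (auto simp: \<psi>_gens coord_def)
  show "\<exists>g \<in> layer (Suc i). coord i (\<psi> g) = [2, 2, 1, 1, 1] ! i"
    using less_5_cases[OF assms] 0 1 2 3 4 by (auto simp: numeral_eq_Suc)
  show "[2, 2, 1, 1, 1] ! i dvd coord i (\<psi> g)" if g: "g \<in> layer (Suc i)"
  proof -
    have "g \<in> K" using g by (simp add: layer_def)
    then obtain v c where v: "\<psi> g = (1, v, c)" "even (qre v + qi v + qj v + qk v)"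
      "even (c - qre v * qi v - qj v * qk v)" using \<psi>_K by blast
    have 0: "coord j (1, v, c) = 0" if "Suc i \<le> j" "j < 5" for j
      using g v(1) that by (auto simp: layer_def)
    show ?thesis
      using less_5_cases[OF assms] v 0[of 1] 0[of 2] 0[of 3] 0[of 4]
      by (elim disjE) (simp_all add: coord_def)
  qed
qed

text \<open>
  The translations in \<open>N\<close> form the lattice generated by \<open>(2, 2, 2, 2)\<close> and \<open>4 \<int>\<^sup>4\<close>. The commutators of \<open>N\<close>
  are the multiples of 16 in the centre.
\<close>

lemma N_steps:
  assumes "i < 5"
  shows "\<exists>g \<in> N \<inter> layer (Suc i). coord i (\<psi> g) = [16, 4, 4, 4, 2] ! i"
    and "g \<in> N \<inter> layer (Suc i) \<Longrightarrow> [16, 4, 4, 4, 2] ! i dvd coord i (\<psi> g)"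
proof -
  have ex: "\<exists>g \<in> N \<inter> layer (Suc i). coord i (\<psi> g) = d"
    if h: "chi (heis x y m, heis x' y' m') = (1, v, c)" "coord i (1, v, c) = d"
    "\<And>j. \<lbrakk>Suc i \<le> j; j < 5\<rbrakk> \<Longrightarrow> coord j (1, v, c) = 0" for x y m x' y' m' v c d i
  proof -
    obtain g where g: "g \<in> N" "\<psi> g = (1, v, c)" using N_ex[of x y m x' y' m'] h(1) by metis
    have "g \<in> layer (Suc i)" using h(3) N.mem_carrier[OF g(1)] g(2) by (intro layer_memI)
    moreover have "coord i (\<psi> g) = d" using g(2) h(2) by simp
    ultimately show ?thesis using g(1) by blast
  qed
  have 0: "\<exists>g \<in> N \<inter> layer (Suc 0). coord 0 (\<psi> g) = 16"
    by (rule ex[of 0 0 1 0 0 0 "Quat 0 0 0 0" 16]) (auto simp: chi_heis coord_def)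
  have 1: "\<exists>g \<in> N \<inter> layer (Suc 1). coord 1 (\<psi> g) = 4"
    by (rule ex[of 0 1 0 0 1 0 "Quat 0 0 0 4" 0]) (auto simp: chi_heis coord_def)
  have 2: "\<exists>g \<in> N \<inter> layer (Suc 2). coord 2 (\<psi> g) = 4"
    by (rule ex[of 0 "-1" 0 "-1" 0 0 "Quat 0 0 4 0" 0]) (auto simp: chi_heis coord_def)
  have 3: "\<exists>g \<in> N \<inter> layer (Suc 3). coord 3 (\<psi> g) = 4"
    by (rule ex[of "-2" "-1" 0 0 0 0 "Quat 0 4 4 4" "-20"]) (auto simp: chi_heis coord_def)
  have 4: "\<exists>g \<in> N \<inter> layer (Suc 4). coord 4 (\<psi> g) = 2"
    by (rule ex[of "-1" 0 0 0 0 0 "Quat 2 2 2 2" 0]) (auto simp: chi_heis coord_def)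
  show "\<exists>g \<in> N \<inter> layer (Suc i). coord i (\<psi> g) = [16, 4, 4, 4, 2] ! i"
    using less_5_cases[OF assms] 0 1 2 3 4 by (auto simp: numeral_eq_Suc)
  show "[16, 4, 4, 4, 2] ! i dvd coord i (\<psi> g)" if g: "g \<in> N \<inter> layer (Suc i)"
  proof -
    obtain x y m x' y' m' where \<psi>g: "\<psi> g = chi (heis x y m, heis x' y' m')"
      using g N_coords by blast
    have 0: "coord j (\<psi> g) = 0" if "Suc i \<le> j" "j < 5" for j
      using g that by (auto simp: layer_def)
    show ?thesis
      using less_5_cases[OF assms] 0[of 1] 0[of 2] 0[of 3] 0[of 4] unfolding \<psi>g chi_heis
      by (elim disjE) (simp_all add: coord_def, presburger+)
  qed
qed

lemma transversals:
  assumes "i \<le> 5"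
  shows "\<exists>T. right_transversal N (layer i) T \<and> card T = (\<Prod>j<i. [8, 2, 4, 4, 2] ! j)"
  using assms
proof (induction i)
  case 0
  have "right_transversal N (layer 0) {\<one>}" unfolding layer_0 by (simp add: right_transversal_def)
  then show ?case by (intro exI[of _ "{\<one>}"]) simp
next
  case (Suc i)
  then have i: "i < 5" by simp
  obtain T where T: "right_transversal N (layer i) T" "card T = (\<Prod>j<i. [8, 2, 4, 4, 2] ! j)"
    using Suc by auto
  obtain x where x: "x \<in> layer (Suc i)" "coord i (\<psi> x) = [2, 2, 1, 1, 1] ! i"
    using K_steps(1)[OF i] by blast
  obtain y where y: "y \<in> N" "y \<in> layer (Suc i)" "coord i (\<psi> y) = [16, 4, 4, 4, 2] ! i"
    using N_steps(1)[OF i] by blast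
  have eq: "int ([8, 2, 4, 4, 2] ! i) * [2, 2, 1, 1, 1] ! i = [16, 4, 4, 4, 2] ! i"
    and pos: "[2, 2, 1, 1, 1] ! i > (0::int)" "[8, 2, 4, 4, 2] ! i > (0::nat)"
    using less_5_cases[OF i] by (auto simp: numeral_eq_Suc)
  have "\<exists>T'. right_transversal N (layer (Suc i)) T' \<and> card T' = card T * [8, 2, 4, 4, 2] ! i"
  proof (rule right_transversal_extend_int[where c = "\<lambda>g. coord i (\<psi> g)" and x = x and y = y
        and d = "[2, 2, 1, 1, 1] ! i", OF subgroup_N subgroup_layer])
    show "right_transversal N {g \<in> layer (Suc i). coord i (\<psi> g) = 0} T" using T(1) layer_kernel[OF i] by simp
  qed (use x y eq pos K_steps(2)[OF i] N_steps(2)[OF i] layer_add[of "Suc i" i] in auto)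
  then show ?case using T(2) by simp
qed

text \<open>
  The index of \<open>N\<close> in \<open>K\<close> is \<open>512\<close>, and since \<open>N \<subseteq> K\<close> the eight cosets of \<open>K\<close> contribute a
  further factor.
\<close>

lemma card_rcosets_N: "card (rcosets N) = 2 ^ 12"
proof -
  obtain T where T: "right_transversal N K T" "card T = (\<Prod>j<5. [8, 2, 4, 4, 2] ! j)"
    using transversals[of 5] layer_5 by auto
  interpret K: subgroup K G by (rule subgroup_K)
  have "distinct (map (\<lambda>r. fst (\<psi> r)) [r0, r1, r2, r3, r4, r5, r6, r7])" by (simp add: \<psi>_reps)
  then have dist: "distinct [r0, r1, r2, r3, r4, r5, r6, r7]"
    and inj: "inj_on (\<lambda>r. fst (\<psi> r)) (set [r0, r1, r2, r3, r4, r5, r6, r7])"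
    unfolding distinct_map by blast+
  from distinct_card[OF dist] have "card reps = 8" by simp
  moreover have "\<exists>T'. right_transversal N (carrier G) T' \<and> card T' = card T * card reps"
  proof (rule right_transversal_extend[OF subgroup_N subgroup_self _ T(1)])
    fix g assume g: "g \<in> carrier G"
    obtain k r where kr: "k \<in> K" "r \<in> reps" "g = k \<otimes> r" using K_cosets[OF g] by blast
    have "r \<in> carrier G" using kr(2) by auto
    then have "\<one> \<otimes> g \<otimes> inv r \<in> K" using kr by (simp add: m_assoc)
    then show "\<exists>n\<in>N. \<exists>r\<in>reps. n \<otimes> g \<otimes> inv r \<in> K" using kr N.one_closed by blast
  next
    fix r s \<alpha> \<beta> n
    assume h: "r \<in> reps" "s \<in> reps" "\<alpha> \<in> K" "\<beta> \<in> K" "n \<in> N" "\<alpha> \<otimes> r = n \<otimes> (\<beta> \<otimes> s)"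
    have c: "r \<in> carrier G" "s \<in> carrier G" using h(1,2) by (auto simp del: rep_defs)
    have n: "n \<in> K" using h(5) N_sub_K by blast
    have fst: "fst (\<psi> (k \<otimes> g)) = fst (\<psi> g)" if "k \<in> K" "g \<in> carrier G" for k g
    proof -
      obtain v c where "\<psi> k = (1, v, c)" using \<psi>_K[OF \<open>k \<in> K\<close>] by blast
      moreover have "\<psi> (k \<otimes> g) = \<psi> k \<star> \<psi> g" using that by simp
      ultimately show ?thesis by (cases "\<psi> g") (simp add: QH_mult)
    qed
    have "fst (\<psi> (\<alpha> \<otimes> r)) = fst (\<psi> (n \<otimes> (\<beta> \<otimes> s)))" by (simp only: h(6))
    then have "fst (\<psi> r) = fst (\<psi> s)"
      by (simp only: fst[OF h(3) c(1)] fst[OF h(4) c(2)] fst[OF n m_closed[OF K.mem_carrier[OF h(4)] c(2)]])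
    then show "r = s" using inj_onD[OF inj, of r s] h(1,2) by simp
  qed auto
  ultimately obtain T' where "right_transversal N (carrier G) T'" "card T' = card T * 8" by auto
  moreover have "(\<Prod>j<5. [8, 2, 4, 4, 2] ! j) = (512::nat)"
  proof -
    have "{..<5} = {0, 1, 2, 3, 4::nat}" by auto
    then show ?thesis by simp
  qed
  ultimately show ?thesis
    using card_rcosets_right_transversal[OF subgroup_N] T(2) by simp
qed

lemma group_N: "group G\<^sub>N"
  using subgroup_N by (rule subgroup_imp_group)

lemma group_hom_N: "group_hom G\<^sub>N QH \<psi>"
  using \<psi>.hom_mult group_N by (auto simp: group_hom_def group_hom_axioms_def hom_def QH_group)

lemma poly_Z_N: "poly_Z G\<^sub>N (\<lambda>i. N \<inter> layer i) (\<lambda>i g. coord i (\<psi> g)) 5"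
proof -
  interpret GN: group G\<^sub>N by (rule group_N)
  show ?thesis
  proof (intro poly_Z.intro poly_Z_axioms.intro group_N)
    show "N \<inter> layer 0 = {\<one>\<^bsub>G\<^sub>N\<^esub>}" using layer_0 by auto
    show "N \<inter> layer 5 = carrier G\<^sub>N" using layer_5 N_sub_K by auto
    show "subgroup (N \<inter> layer i) G\<^sub>N" for i
      using subgroups_Inter_pair[OF subgroup_N subgroup_layer] by (intro subgroup_incl subgroup_N) auto
    show "coord i (\<psi> (g \<otimes>\<^bsub>G\<^sub>N\<^esub> h)) = coord i (\<psi> g) + coord i (\<psi> h)"
      if "i < 5" "g \<in> N \<inter> layer (Suc i)" "h \<in> N \<inter> layer (Suc i)" for i g h
      using layer_add[of "Suc i" i g h] that by simp
    show "{g \<in> N \<inter> layer (Suc i). coord i (\<psi> g) = 0} = N \<inter> layer i" if i: "i < 5" for i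
      using layer_kernel[OF i] by blast
    show "\<exists>g\<in>N \<inter> layer (Suc i). coord i (\<psi> g) \<noteq> 0" if i: "i < 5" for i
    proof -
      have "[16, 4, 4, 4, 2] ! i \<noteq> (0::int)" using less_5_cases[OF i] by (auto simp: numeral_eq_Suc)
      then show ?thesis using N_steps(1)[OF i] by force
    qed
  qed
qed

text \<open>
  The commutator of two translations is a central coordinate.
\<close>

lemma nilpotent_N: "nilpotent G\<^sub>N"
proof -
  interpret GN: group G\<^sub>N by (rule group_N)
  interpret h: group_hom G\<^sub>N QH \<psi> by (rule group_hom_N)
  show ?thesis
  proof (rule GN.nilpotent_if_commutators_central)
    fix x y g assume xyg: "x \<in> carrier G\<^sub>N" "y \<in> carrier G\<^sub>N" "g \<in> carrier G\<^sub>N"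
    let ?c = "x \<otimes>\<^bsub>G\<^sub>N\<^esub> y \<otimes>\<^bsub>G\<^sub>N\<^esub> inv\<^bsub>G\<^sub>N\<^esub> x \<otimes>\<^bsub>G\<^sub>N\<^esub> inv\<^bsub>G\<^sub>N\<^esub> y"
    have *: "\<exists>v c. \<psi> n = (1, v, c)" if "n \<in> carrier G\<^sub>N" for n
      using \<psi>_K N_sub_K that by fastforce
    obtain v c v' c' v'' c'' where "\<psi> x = (1, v, c)" "\<psi> y = (1, v', c')" "\<psi> g = (1, v'', c'')"
      using *[OF xyg(1)] *[OF xyg(2)] *[OF xyg(3)] by blast
    then have "\<psi> (?c \<otimes>\<^bsub>G\<^sub>N\<^esub> g) = \<psi> (g \<otimes>\<^bsub>G\<^sub>N\<^esub> ?c)"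
      using xyg by (simp only: h.hom_mult h.hom_inv GN.m_closed GN.inv_closed)
        (simp add: QH_inv_translation QH_mult form_simps)
    moreover have "?c \<otimes>\<^bsub>G\<^sub>N\<^esub> g \<in> carrier G\<^sub>N" "g \<otimes>\<^bsub>G\<^sub>N\<^esub> ?c \<in> carrier G\<^sub>N"
      using xyg by (simp_all only: GN.m_closed GN.inv_closed)
    moreover have "inj_on \<psi> (carrier G\<^sub>N)" using inj_on_subset[OF \<psi>_inj] N.subset by simp
    ultimately show "?c \<otimes>\<^bsub>G\<^sub>N\<^esub> g = g \<otimes>\<^bsub>G\<^sub>N\<^esub> ?c" by (meson inj_onD)
  qed
qed

lemma iso_N: "G\<^sub>N \<cong> HH Mod normal_closure HH {relator}"
proof -
  let ?I = "QH\<lparr>carrier := chi ` carrier HH\<rparr>"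
  have I: "group ?I" using QH.subgroup_imp_group[OF chi.img_is_subgroup] .
  have "\<psi> \<in> iso G\<^sub>N ?I"
    using \<psi>_N \<psi>_inj N.subset \<psi>.hom_mult
    by (auto simp: iso_def hom_def bij_betw_def intro: inj_on_subset)
  then have "G\<^sub>N \<cong> ?I" by (rule is_isoI)
  also have "?I \<cong> HH Mod kernel HH ?I chi"
  proof -
    have "chi \<in> hom HH ?I" by (rule homI) (simp_all del: mult_DirProd carrier_DirProd)
    then interpret chi': group_hom HH ?I chi
      using I HH_group by (simp add: group_hom_def group_hom_axioms_def)
    have "HH Mod kernel HH ?I chi \<cong> ?I" by (rule chi'.FactGroup_iso) simp
    then show ?thesis
      by (rule group.iso_sym[OF normal.factorgroup_is_group[OF chi'.normal_kernel]])
  qed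
  also have "kernel HH ?I chi = normal_closure HH {relator}"
    unfolding kernel_chi[symmetric] by (simp add: kernel_def)
  finally show ?thesis .
qed

end


section \<open>The quotient by the fourth powers of primitive elements\<close>

text \<open>
  The six relators hold because the six words are primitive, and the map from \<open>F2\<close> to \<open>QH\<close> factors
  through the quotient because all primitive elements become quarter turns.
\<close>

lemma model_exists:
  defines "G \<equiv> F2 Mod P4" and "a \<equiv> P4 #>\<^bsub>F2\<^esub> free_gen Gen_a" and "b \<equiv> P4 #>\<^bsub>F2\<^esub> free_gen Gen_b"
  shows "\<exists>\<psi>. quarter_power_model G a b \<psi>"
proof -
  note mult_FactGroup [simp del] one_FactGroup [simp del]
  have normal: "P4 \<lhd> F2" by (rule primitive_powers_normal)
  interpret P: normal P4 F2 by (rule normal)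
  interpret G: group G unfolding G_def by (rule P.factorgroup_is_group)
  let ?p = "\<lambda>w. P4 #>\<^bsub>F2\<^esub> w"
  have p_hom: "?p \<in> hom F2 G" unfolding G_def by (rule P.r_coset_hom_Mod)
  interpret p: group_hom F2 G ?p using p_hom by unfold_locales
  have pow: "?p w [^]\<^bsub>G\<^esub> (4::nat) = \<one>\<^bsub>G\<^esub>" if w: "primitive w" for w
  proof -
    have wc: "w \<in> carrier F2" using w by (auto simp: primitive_iff)
    have "w [^]\<^bsub>F2\<^esub> (4::nat) \<in> P4"
      unfolding primitive_powers_def using w by (intro generate.incl) blast
    then have "?p (w [^]\<^bsub>F2\<^esub> (4::nat)) = P4" by (intro F2.coset_join2 P.subgroup_axioms) (use wc in auto)
    then show ?thesis using p.hom_nat_pow[OF wc, of 4] by (simp add: G_def one_FactGroup)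
  qed
  obtain h where h: "h \<in> hom F2 QH" "h (free_gen Gen_a) = (Quat 0 1 0 0, 0, 0)"
    "h (free_gen Gen_b) = (Quat 0 0 1 0, 1, 0)"
  proof -
    define f where "f = case_gen2 (Quat 0 1 0 0, 0::quat, 0::int) (Quat 0 0 1 0, 1, 0)"
    have "f g \<in> carrier QH" for g by (cases g) (simp_all add: f_def QH_carrier qnorm_def)
    then obtain h where "h \<in> hom F2 QH" "\<forall>g. h (free_gen g) = f g"
      using free_group_universal(1)[OF QH_group, of f] by blast
    then show thesis using that[of h] by (simp add: f_def)
  qed
  interpret h: group_hom F2 QH h using h(1) by unfold_locales
  have ker: "P4 \<subseteq> kernel F2 QH h"
    unfolding primitive_powers_def
  proof (rule F2.generate_subgroup_incl)
    show "subgroup (kernel F2 QH h) F2" by (rule h.subgroup_kernel)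
    show "{x [^]\<^bsub>F2\<^esub> (4::nat) |x. primitive x} \<subseteq> kernel F2 QH h"
    proof clarify
      fix x assume x: "primitive x"
      have "x \<in> carrier F2" using x by (auto simp: primitive_iff)
      then show "x [^]\<^bsub>F2\<^esub> (4::nat) \<in> kernel F2 QH h"
        using quarter_turn_primitive[OF h x] by (simp add: kernel_def h.hom_nat_pow quarter_turn_def)
    qed
  qed
  obtain \<psi> where \<psi>: "\<psi> \<in> hom G QH" "\<And>w. w \<in> carrier F2 \<Longrightarrow> \<psi> (?p w) = h w"
  proof (rule FactGroup_universal[OF h(1) normal])
    fix x y assume xy: "x \<in> carrier F2" "y \<in> carrier F2" "?p x = ?p y"
    have "x \<in> ?p y" using F2.rcos_self[OF xy(1) P.subgroup_axioms] xy(3) by simp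
    then obtain q where q: "q \<in> P4" "x = q \<cdot> y" by (auto simp: r_coset_def)
    have "q \<in> carrier F2" "h q = \<one>\<^bsub>QH\<^esub>" using q(1) ker by (auto simp: kernel_def)
    then show "h x = h y" using q(2) xy(2) by simp
  qed (use that G_def in blast)
  have gens: "free_gen Gen_a \<in> carrier F2" "free_gen Gen_b \<in> carrier F2" by (simp_all add: free_gen_closed)
  have "quarter_power_group G a b"
  proof unfold_locales
    show "a \<in> carrier G" "b \<in> carrier G" unfolding a_def b_def using gens p.hom_closed by auto
    have "generate G (?p ` {free_gen Gen_a, free_gen Gen_b}) = ?p ` carrier F2"
      using p.generate_img[of "{free_gen Gen_a, free_gen Gen_b}"] gens F2_generated by simp
    then show "generate G {a, b} = carrier G"
      by (simp add: a_def b_def G_def carrier_FactGroup)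
    note prims = six_primitives[THEN pow]
    show "a [^]\<^bsub>G\<^esub> (4::nat) = \<one>\<^bsub>G\<^esub>" "b [^]\<^bsub>G\<^esub> (4::nat) = \<one>\<^bsub>G\<^esub>"
      unfolding a_def b_def by (rule prims)+
    show "(a \<otimes>\<^bsub>G\<^esub> b) [^]\<^bsub>G\<^esub> (4::nat) = \<one>\<^bsub>G\<^esub>" "(a \<otimes>\<^bsub>G\<^esub> inv\<^bsub>G\<^esub> b) [^]\<^bsub>G\<^esub> (4::nat) = \<one>\<^bsub>G\<^esub>"
      "(a \<otimes>\<^bsub>G\<^esub> a \<otimes>\<^bsub>G\<^esub> b) [^]\<^bsub>G\<^esub> (4::nat) = \<one>\<^bsub>G\<^esub>" "(a \<otimes>\<^bsub>G\<^esub> b \<otimes>\<^bsub>G\<^esub> b) [^]\<^bsub>G\<^esub> (4::nat) = \<one>\<^bsub>G\<^esub>"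
      using prims(3-6) gens unfolding a_def b_def by simp_all
  qed
  then have "quarter_power_model G a b \<psi>"
    using \<psi> h(2,3) gens by (simp add: quarter_power_model_def quarter_power_model_axioms_def a_def b_def)
  then show ?thesis by blast
qed

theorem proposition4p1:
  fixes G :: "gen2 letter list set monoid" (structure)
    and a b A B C D E a1 a2 a3 a4 :: "gen2 letter list set"
    and N :: "gen2 letter list set set"
  assumes "G = F2 Mod P4"
    and "a = P4 #>\<^bsub>F2\<^esub> free_gen Gen_a"
    and "b = P4 #>\<^bsub>F2\<^esub> free_gen Gen_b"
    and "A = b \<otimes> inv a \<otimes> inv b \<otimes> a"
    and "B = inv b \<otimes> a \<otimes> b \<otimes> inv a"
    and "C = inv b \<otimes> inv a \<otimes> b \<otimes> a"
    and "D = a [^] (2::nat) \<otimes> b \<otimes> (inv a \<otimes> inv b) [^] (2::nat) \<otimes> inv a \<otimes> b \<otimes> a"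
    and "E = inv b \<otimes> (a \<otimes> b) [^] (2::nat) \<otimes> a [^] (-3::int) \<otimes> inv b \<otimes> a"
    and "a1 = E [^] (-2::int)"
    and "a2 = A [^] (4::nat) \<otimes> D [^] (2::nat)"
    and "a3 = A \<otimes> E [^] (-2::int) \<otimes> A [^] (-4::int) \<otimes> B \<otimes> inv A \<otimes> inv B"
    and "a4 = A [^] (9::nat) \<otimes> C \<otimes> inv A \<otimes> inv C \<otimes> B \<otimes> A \<otimes> inv B \<otimes> inv A"
    and "N = generate G {a1, a2, a3, a4}"
  shows "subgroup N G \<and> card (rcosets N) = 2 ^ 12 \<and>
    has_dimension (G\<lparr>carrier := N\<rparr>) 5 \<and>
    torsion_free (G\<lparr>carrier := N\<rparr>) \<and>
    nilpotent (G\<lparr>carrier := N\<rparr>) \<and>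
    (\<exists>r \<in> carrier (heisenberg \<times>\<times> heisenberg).
       r \<noteq> \<one>\<^bsub>heisenberg \<times>\<times> heisenberg\<^esub> \<and>
       G\<lparr>carrier := N\<rparr> \<cong>
         (heisenberg \<times>\<times> heisenberg) Mod normal_closure (heisenberg \<times>\<times> heisenberg) {r})"
proof -
  obtain \<psi> where "quarter_power_model G a b \<psi>" using model_exists assms(1-3) by blast
  then interpret quarter_power_model G a b \<psi> .
  note simps = \<psi>_a \<psi>_b QH_mult QH_inv qnorm_def qconj_def form_eq quat_defs numeral_eq_Suc QH_one
  have A: "A \<in> carrier G" "\<psi> A = (-1, Quat 1 (-1) 0 0, -1)" by (simp_all add: assms(4) simps)
  have B: "B \<in> carrier G" "\<psi> B = (-1, Quat 0 0 1 1, -1)" by (simp_all add: assms(5) simps)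
  have C: "C \<in> carrier G" "\<psi> C = (-1, Quat 0 0 1 (-1), 1)" by (simp_all add: assms(6) simps)
  have D: "D \<in> carrier G" "\<psi> D = (1, Quat (-1) 1 (-1) 1, 0)" by (simp_all add: assms(7) \<psi>.hom_nat_pow simps)
  have E: "E \<in> carrier G" "\<psi> E = (1, Quat 1 1 1 1, 0)"
    unfolding assms(8) int_pow_neg_numeral[OF a] by (simp_all add: \<psi>.hom_nat_pow simps)
  have "nilpotent_subgroup G a b \<psi> a1 a2 a3 a4 N"
  proof unfold_locales
    show "a1 \<in> carrier G" "a2 \<in> carrier G" "a3 \<in> carrier G" "a4 \<in> carrier G"
      using A(1) B(1) C(1) D(1) E(1) by (simp_all add: assms(9-12))
    show "\<psi> a1 = (1, Quat (-2) (-2) (-2) (-2), 0)"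
      unfolding assms(9) int_pow_neg_numeral[OF E(1)] using E by (simp add: \<psi>.hom_nat_pow simps)
    show "\<psi> a2 = (1, Quat (-2) 2 (-2) 2, -4)"
      unfolding assms(10) using A D by (simp add: \<psi>.hom_nat_pow simps)
    show "\<psi> a3 = (1, Quat 4 0 0 0, 4)"
      unfolding assms(11) int_pow_neg_numeral[OF E(1)] int_pow_neg_numeral[OF A(1)]
      using A B E by (simp add: \<psi>.hom_nat_pow simps)
    show "\<psi> a4 = (1, Quat 0 0 0 4, 0)"
      unfolding assms(12) using A B C by (simp add: \<psi>.hom_nat_pow simps)
  qed (rule assms(13))
  then interpret N: nilpotent_subgroup G a b \<psi> a1 a2 a3 a4 N .
  show ?thesis
    using N.subgroup_N N.card_rcosets_N N.nilpotent_N N.iso_N relator_closed relator_nontrivial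
      poly_Z.has_dimension[OF N.poly_Z_N] poly_Z.torsion_free[OF N.poly_Z_N]
    by blast
qed

end
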